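(* Let $m\ge0$ and let $\Lambda=(a_1,\dots,a_m;\lambda)$ be an $m$-partition. Let $$(q;q)_\Lambda=(q;q)_{a_1}\cdots(q;q)_{a_m}(q;q)_{\lambda_1}\cdots(q;q)_{\lambda_{\ell(\lambda)}},\qquad (q;q)_r=(1-q)(1-q^2)\cdots(1-q^r).$$ Then $$\lim_{t\to1}J_\Lambda\left[\frac{X}{1-t};q,t\right]=q^{|\pmb a|}(q;q)_\Lambda\,h_\Lambda\left[\frac{X}{1-q};q\right]=(q;q)_\Lambda\,h_{a_1}\left[x_1+\frac{qX}{1-q}\right]\cdots h_{a_m}\left[x_m+\frac{qX}{1-q}\right]h_\lambda\left[\frac{X}{1-q}\right].$$
   Context: **$m$-partitions.** $R_m\simeq\mathbb Q(q,t)[x_1,\dots,x_m]\otimes\mathbf\Lambda_m$ is the ring of $m$-symmetric functions, i.e. the formal power series (of bounded degree) in $x_1,x_2,\dots$ over $\mathbb Q(q,t)$ that are symmetric in $x_{m+1},x_{m+2},\dots$ ($\mathbf\Lambda_m$ is the ring of symmetric functions in $x_{m+1},x_{m+2},\dots$). An $m$-partition is a pair $\Lambda=(\pmb a;\lambda)$ with $\pmb a=(a_1,\dots,a_m)\in\mathbb Z_{\ge0}^m$ and $\lambda$ a partition; $|\pmb a|=\sum_i a_i$. $\pmb a\cup\lambda$ is the partition obtained by sorting all the entries of $\pmb a$ and $\lambda$. $\pmb a$ is dominant if $a_1\ge\cdots\ge a_m$. The diagram of $\Lambda$ (English notation) is the Young diagram of $\pmb a\cup\lambda$ with, for each $i=1,\dots,m$,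 an $i$-circle added at the right end of a row of size $a_i$ (possibly $0$); among the rows of a given size the circles occupy the topmost ones, in increasing order from top to bottom. For $0\le i\le m$, $\Lambda^{(i)}=(a_1+1,\dots,a_i+1,a_{i+1},\dots,a_m)\cup\lambda$. Order: $\Lambda\ge\Omega$ iff $\Lambda^{(i)}\ge\Omega^{(i)}$ in the dominance order on partitions for all $i=0,\dots,m$. Monomials: $m_\Lambda(x)=x_1^{a_1}\cdots x_m^{a_m}\,m_\lambda(x_{m+1},x_{m+2},\dots)$. **Hecke algebra and power sums.** $T_i=t+\frac{tx_i-x_{i+1}}{x_i-x_{i+1}}(K_{i,i+1}-1)$ for $1\le i\le m-1$, where $K_{i,i+1}$ exchanges $x_i$ and $x_{i+1}$. $H_{\pmb a}(x;t)$ is defined by $H_{\pmb a}=x^{\pmb a}$ if $\pmb a$ is dominant, and $T_iH_{\pmb a}=H_{s_i\pmb a}$ if $a_i>a_{i+1}$ ($s_i$ swaps entries $i$ and $i+1$). $p_\Lambda(x;t)=H_{\pmb a}(x;t)\,p_\lambda(x)$, where $p_\lambda(x)$ is the power sum in all the variables $x_1,x_2,\dots$; these form a basis of $R_m$. $\mathrm{Inv}(\pmb a)=\#\{i<j: a_i<a_j\}$; $z_\lambda=\prod_i i^{n_\lambda(i)}n_\lambda(i)!$, with $n_\lambda(i)$ the multiplicity of $i$ in $\lambda$. **Macdonald polynomials.** Let $\langle\cdot,\cdot\rangle_{q,t}$ be the bilinear form on $R_m$ with $\langle p_\Lambda(x;t),p_\Omega(x;t)\rangle_{q,t}=\delta_{\Lambda\Omega}q^{|\pmb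 a|}t^{\mathrm{Inv}(\pmb a)}z_\lambda\prod_i\frac{1-q^{\lambda_i}}{1-t^{\lambda_i}}$. The $m$-symmetric Macdonald polynomials $\{P_\Lambda(x;q,t)\}$ are the unique basis of $R_m$ that is orthogonal for this form and satisfies $P_\Lambda=m_\Lambda+\sum_{\Omega<\Lambda}d_{\Lambda\Omega}(q,t)m_\Omega$. The integral form is $J_\Lambda(x;q,t)=c_\Lambda(q,t)P_\Lambda(x;q,t)$, $c_\Lambda(q,t)=\prod_{s\in\Lambda}(1-q^{a(s)}t^{\ell(s)+1})$, the product being over the square cells $s$ of the diagram, where $a(s)$ is the number of squares strictly to the right of $s$ in its row, plus $1$ if the row ends with a circle, and $\ell(s)$ is the number of squares strictly below $s$ in its column, plus, if the row of $s$ ends with a circle labelled $i$, the number of circles at the bottom of the column of $s$ with label smaller than $i$. $J_\Lambda[\frac{X}{1-t};q,t]$ is the image of $J_\Lambda(x;q,t)$ under the $\mathbb Q(q,t)$-linear map $p_\Lambda(x;t)\mapsto p_\Lambda(x;t)/\prod_i(1-t^{\lambda_i})$. **The functions $h_\Lambda$.** In plethystic notation with $X=x_1+x_2+\cdots$, $h_\Lambda(x;q)=h_{a_1}[q^{-1}x_1+X]\cdots h_{a_m}[q^{-1}x_m+X]\,h_\lambda[X]$, where $h_r[q^{-1}x_i+X]=\sum_{c=0}^r q^{-c}x_i^c\,h_{r-c}(x)$ and $h_r(x)$ is the complete homogeneous symmetric function in all variables. $h_\Lambda[\frac{X}{1-q};q]$ is the image of $h_\Lambda(x;q)$ under the linear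 map $x^{\pmb a}p_\lambda(x)\mapsto x^{\pmb a}p_\lambda(x)/\prod_i(1-q^{\lambda_i})$; likewise $h_r[\frac{X}{1-q}]$ is the image of $h_r(x)$ under $p_k\mapsto p_k/(1-q^k)$, $h_\lambda[\frac X{1-q}]=\prod_i h_{\lambda_i}[\frac X{1-q}]$, and $h_r[x_i+\frac{qX}{1-q}]=\sum_{c=0}^r x_i^c\,q^{r-c}h_{r-c}[\frac{X}{1-q}]$. *)

theory Defs
  imports
    "HOL-Library.Poly_Mapping"
    "HOL-Library.Multiset"
    "HOL-Combinatorics.Permutations"
    "HOL-Computational_Algebra.Polynomial"
    "HOL-Computational_Algebra.Fraction_Field"
begin

section \<open>Formal power series in countably many variables\<close>

text \<open>
  The exponent \<^term>\<open>\<alpha> :: nat \<Rightarrow>\<^sub>0 nat\<close> stands for the monomial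
  \<open>\<Prod>k. x\<^bsub>k+1\<^esub> ^ \<alpha>(k)\<close>: variables are numbered from 0, so that \<open>X i\<close> below is
  the variable written \<open>x\<^bsub>i+1\<^esub>\<close> on paper, and the distinguished variables of the ring of
  \<open>m\<close>-symmetric functions are \<open>X 0, \<dots>, X (m - 1)\<close>.
\<close>

typedef 'a mps = "{f :: (nat \<Rightarrow>\<^sub>0 nat) \<Rightarrow> 'a. True}"
  morphisms mcoeff Abs_mps
  by simp

lemma mcoeff_Abs_mps [simp]: "mcoeff (Abs_mps f) = f"
  by (simp add: Abs_mps_inverse)

lemma mps_eqI: "(\<And>\<alpha>. mcoeff f \<alpha> = mcoeff g \<alpha>) \<Longrightarrow> f = g"
  by (simp add: mcoeff_inject[symmetric] fun_eq_iff)

lemma mps_eq_iff: "f = g \<longleftrightarrow> (\<forall>\<alpha>. mcoeff f \<alpha> = mcoeff g \<alpha>)"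
  by (metis mps_eqI)

lemma finite_add_eq:
  fixes \<alpha> :: "nat \<Rightarrow>\<^sub>0 nat"
  shows "finite {(\<beta>, \<gamma>). \<beta> + \<gamma> = \<alpha>}"
proof -
  let ?K = "Poly_Mapping.keys \<alpha>"
  let ?N = "\<Sum>k\<in>?K. Poly_Mapping.lookup \<alpha> k"
  let ?F = "{f. \<forall>k. (k \<in> ?K \<longrightarrow> f k \<in> {..?N}) \<and> (k \<notin> ?K \<longrightarrow> f k = 0)}"
  let ?S = "{(\<beta>, \<gamma>). \<beta> + \<gamma> = \<alpha>}"
  let ?L = "\<lambda>p. (Poly_Mapping.lookup (fst p), Poly_Mapping.lookup (snd p))"
  have F: "Poly_Mapping.lookup \<beta> \<in> ?F"
    if le: "\<And>k. Poly_Mapping.lookup \<beta> k \<le> Poly_Mapping.lookup \<alpha> k" for \<beta> :: "nat \<Rightarrow>\<^sub>0 nat"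
  proof (rule CollectI, rule allI, rule conjI; rule impI)
    fix k assume "k \<in> ?K"
    then have "Poly_Mapping.lookup \<alpha> k \<le> ?N"
      by (intro member_le_sum) simp_all
    then show "Poly_Mapping.lookup \<beta> k \<in> {..?N}"
      using le[of k] by simp
  next
    fix k assume "k \<notin> ?K"
    then show "Poly_Mapping.lookup \<beta> k = 0"
      using le[of k] by (simp add: in_keys_iff)
  qed
  have "finite ?F"
    by (rule finite_set_of_finite_funs) simp_all
  then have "finite (?F \<times> ?F)"
    by simp
  moreover have "?L ` ?S \<subseteq> ?F \<times> ?F"
  proof (rule image_subsetI)
    fix p assume "p \<in> ?S"
    then have *: "fst p + snd p = \<alpha>"
      by (simp add: case_prod_unfold)
    have "Poly_Mapping.lookup (fst p) \<in> ?F" "Poly_Mapping.lookup (snd p) \<in> ?F"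
      by (rule F, simp add: *[symmetric] lookup_add)+
    then show "?L p \<in> ?F \<times> ?F"
      by blast
  qed
  ultimately have "finite (?L ` ?S)"
    by (rule rev_finite_subset)
  moreover have "inj_on ?L ?S"
    by (rule inj_onI) (simp add: prod_eq_iff lookup_inject)
  ultimately show ?thesis
    by (rule finite_imageD)
qed

instantiation mps :: (comm_ring_1) comm_ring_1
begin

definition zero_mps :: "'a mps" where "0 = Abs_mps (\<lambda>_. 0)"
definition one_mps :: "'a mps" where "1 = Abs_mps (\<lambda>\<alpha>. if \<alpha> = 0 then 1 else 0)"
definition plus_mps :: "'a mps \<Rightarrow> 'a mps \<Rightarrow> 'a mps"
  where "f + g = Abs_mps (\<lambda>\<alpha>. mcoeff f \<alpha> + mcoeff g \<alpha>)"
definition minus_mps :: "'a mps \<Rightarrow> 'a mps \<Rightarrow> 'a mps"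
  where "f - g = Abs_mps (\<lambda>\<alpha>. mcoeff f \<alpha> - mcoeff g \<alpha>)"
definition uminus_mps :: "'a mps \<Rightarrow> 'a mps" where "- f = Abs_mps (\<lambda>\<alpha>. - mcoeff f \<alpha>)"
definition times_mps :: "'a mps \<Rightarrow> 'a mps \<Rightarrow> 'a mps"
  where "f * g = Abs_mps (\<lambda>\<alpha>. \<Sum>(\<beta>, \<gamma>) | \<beta> + \<gamma> = \<alpha>. mcoeff f \<beta> * mcoeff g \<gamma>)"

lemma times_mps_assoc:
  fixes f g h :: "'a mps"
  shows "f * g * h = f * (g * h)"
proof (rule mps_eqI)
  fix \<alpha>
  let ?T = "\<lambda>\<beta> \<gamma> \<delta>. mcoeff f \<beta> * mcoeff g \<gamma> * mcoeff h \<delta>"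
  have "mcoeff (f * g * h) \<alpha> = (\<Sum>p | fst p + snd p = \<alpha>. \<Sum>r | fst r + snd r = fst p.
          ?T (fst r) (snd r) (snd p))"
    by (simp add: times_mps_def sum_distrib_right case_prod_unfold)
  also have "\<dots> = (\<Sum>(p, r) \<in> (SIGMA p:{p. fst p + snd p = \<alpha>}. {r. fst r + snd r = fst p}).
          ?T (fst r) (snd r) (snd p))"
    using finite_add_eq by (subst sum.Sigma) (auto simp: case_prod_unfold)
  also have "\<dots> = (\<Sum>(p, r) \<in> (SIGMA p:{p. fst p + snd p = \<alpha>}. {r. fst r + snd r = snd p}).
          ?T (fst p) (fst r) (snd r))"
    by (rule sum.reindex_bij_witness
          [where j = "\<lambda>(p, r). ((fst r, snd r + snd p), (snd r, snd p))"
             and i = "\<lambda>(p, r). ((fst p + fst r, snd r), (fst p, fst r))"])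
       (auto simp: add.assoc)
  also have "\<dots> = (\<Sum>p | fst p + snd p = \<alpha>. \<Sum>r | fst r + snd r = snd p.
          ?T (fst p) (fst r) (snd r))"
    using finite_add_eq by (subst sum.Sigma) (auto simp: case_prod_unfold)
  also have "\<dots> = mcoeff (f * (g * h)) \<alpha>"
    by (simp add: times_mps_def sum_distrib_left case_prod_unfold mult.assoc)
  finally show "mcoeff (f * g * h) \<alpha> = mcoeff (f * (g * h)) \<alpha>" .
qed

lemma times_mps_commute:
  fixes f g :: "'a mps"
  shows "f * g = g * f"
proof (rule mps_eqI)
  fix \<alpha>
  show "mcoeff (f * g) \<alpha> = mcoeff (g * f) \<alpha>"
    unfolding times_mps_def mcoeff_Abs_mps
    by (rule sum.reindex_bij_witness[where i = "\<lambda>(\<beta>, \<gamma>). (\<gamma>, \<beta>)" and j = "\<lambda>(\<beta>, \<gamma>). (\<gamma>, \<beta>)"])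
       (auto simp: add.commute mult.commute)
qed

lemma times_mps_one:
  fixes f :: "'a mps"
  shows "1 * f = f"
proof (rule mps_eqI)
  fix \<alpha>
  have "mcoeff (1 * f) \<alpha> =
      (\<Sum>p | fst p + snd p = \<alpha>. if p = (0, \<alpha>) then mcoeff f \<alpha> else 0)"
    unfolding times_mps_def one_mps_def mcoeff_Abs_mps case_prod_unfold
    by (rule sum.cong) (auto simp: prod_eq_iff)
  also have "\<dots> = mcoeff f \<alpha>"
    using finite_add_eq[of \<alpha>] by (simp add: case_prod_unfold)
  finally show "mcoeff (1 * f) \<alpha> = mcoeff f \<alpha>" .
qed

instance
proof
  fix f g h :: "'a mps"
  show "f * g * h = f * (g * h)" by (rule times_mps_assoc)
  show "f * g = g * f" by (rule times_mps_commute)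
  show "1 * f = f" by (rule times_mps_one)
  show "(f + g) * h = f * h + g * h"
    by (simp add: times_mps_def plus_mps_def mps_eq_iff sum.distrib distrib_right case_prod_unfold)
  have "mcoeff (0 :: 'a mps) 0 \<noteq> mcoeff (1 :: 'a mps) 0"
    by (simp add: zero_mps_def one_mps_def)
  then show "(0 :: 'a mps) \<noteq> 1" by metis
qed (simp_all add: zero_mps_def plus_mps_def minus_mps_def uminus_mps_def mps_eq_iff add.assoc add.commute)

end

definition mscale :: "'a \<Rightarrow> 'a mps \<Rightarrow> 'a::field mps"
  where "mscale c f = Abs_mps (\<lambda>\<alpha>. c * mcoeff f \<alpha>)"

interpretation mps: vector_space "mscale :: 'a \<Rightarrow> 'a mps \<Rightarrow> 'a::field mps"
  by unfold_locales
     (simp_all add: mscale_def plus_mps_def mps_eq_iff distrib_left distrib_right mult.assoc)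

definition X :: "nat \<Rightarrow> 'a::field mps"
  where "X i = Abs_mps (\<lambda>\<alpha>. if \<alpha> = Poly_Mapping.single i 1 then 1 else 0)"

definition mdeg :: "(nat \<Rightarrow>\<^sub>0 nat) \<Rightarrow> nat"
  where "mdeg \<alpha> = (\<Sum>k\<in>Poly_Mapping.keys \<alpha>. Poly_Mapping.lookup \<alpha> k)"

text \<open>The ring \<open>R\<^sub>m\<close> (as a subset of all power series).\<close>

definition msym :: "nat \<Rightarrow> 'a::field mps set"
  where "msym m = {f. (\<exists>d. \<forall>\<alpha>. mdeg \<alpha> > d \<longrightarrow> mcoeff f \<alpha> = 0) \<and>
    (\<forall>\<pi> \<alpha>. \<pi> permutes {m..} \<longrightarrow> mcoeff f (Poly_Mapping.map_key \<pi> \<alpha>) = mcoeff f \<alpha>)}"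


section \<open>\<open>m\<close>-partitions\<close>

text \<open>
  Partitions are finite multisets of positive integers; an \<open>m\<close>-partition is a pair
  \<open>(a, \<mu>)\<close> of a list of length \<open>m\<close> and a partition. As \<open>X\<close>, the entries of \<open>a\<close>
  and the circle labels are numbered from 0.
\<close>

type_synonym mpart = "nat list \<times> nat multiset"

definition mparts :: "nat \<Rightarrow> mpart set"
  where "mparts m = {(a, \<mu>). length a = m \<and> 0 \<notin># \<mu>}"

definition parts_desc :: "nat multiset \<Rightarrow> nat list"
  where "parts_desc M = rev (sorted_list_of_multiset M)"

text \<open>Zero parts, which occur in \<open>lift_part\<close> below, do not matter for the following order.\<close>

definition dominates :: "nat multiset \<Rightarrow> nat multiset \<Rightarrow> bool"
  where "dominates M N \<longleftrightarrow> sum_mset M = sum_mset N \<and>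
    (\<forall>k. sum_list (take k (parts_desc N)) \<le> sum_list (take k (parts_desc M)))"

text \<open>The partition \<open>\<Lambda>\<^sup>(\<^sup>i\<^sup>)\<close>, up to zero parts.\<close>

definition lift_part :: "nat \<Rightarrow> mpart \<Rightarrow> nat multiset"
  where "lift_part i \<Lambda> = (case \<Lambda> of (a, \<mu>) \<Rightarrow>
    mset (map (\<lambda>j. if j < i then a ! j + 1 else a ! j) [0..<length a]) + \<mu>)"

definition mpart_le :: "nat \<Rightarrow> mpart \<Rightarrow> mpart \<Rightarrow> bool"
  where "mpart_le m \<Omega> \<Lambda> \<longleftrightarrow> (\<forall>i\<le>m. dominates (lift_part i \<Lambda>) (lift_part i \<Omega>))"

definition mpart_less :: "nat \<Rightarrow> mpart \<Rightarrow> mpart \<Rightarrow> bool"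
  where "mpart_less m \<Omega> \<Lambda> \<longleftrightarrow> mpart_le m \<Omega> \<Lambda> \<and> \<Omega> \<noteq> \<Lambda>"

lemma finite_mpart_less: "finite {\<Omega>. \<Omega> \<in> mparts m \<and> mpart_less m \<Omega> \<Lambda>}"
proof -
  define N where "N = sum_mset (lift_part 0 \<Lambda>)"
  define L where "L = {xs. set xs \<subseteq> {..N} \<and> length xs \<le> m + N}"
  have size_le: "size \<mu> \<le> sum_mset \<mu>" if "0 \<notin># \<mu>" for \<mu> :: "nat multiset"
    using that by (induction \<mu>) auto
  have "finite L"
    unfolding L_def by (rule finite_lists_length_le) simp
  have "{\<Omega>. \<Omega> \<in> mparts m \<and> mpart_less m \<Omega> \<Lambda>} \<subseteq> (\<lambda>(xs, ys). (xs, mset ys)) ` (L \<times> L)"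
  proof (clarify)
    fix a \<mu> assume "(a, \<mu>) \<in> mparts m" and less: "mpart_less m (a, \<mu>) \<Lambda>"
    then have *: "length a = m" "0 \<notin># \<mu>" by (auto simp: mparts_def)
    have "dominates (lift_part 0 \<Lambda>) (lift_part 0 (a, \<mu>))"
      using less by (auto simp: mpart_less_def mpart_le_def)
    then have N: "sum_list a + sum_mset \<mu> = N"
      by (simp add: dominates_def N_def lift_part_def map_nth sum_mset_sum_list)
    obtain ys where ys: "\<mu> = mset ys"
      using ex_mset by metis
    have le: "set xs \<subseteq> {..N}" if "sum_list xs \<le> N" for xs :: "nat list"
    proof
      fix x assume "x \<in> set xs"
      then have "x \<le> sum_list xs" by (intro member_le_sum_list) simp_all
      then show "x \<in> {..N}" using that by simp
    qed
    have "sum_list a \<le> N"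
      using N by linarith
    then have "a \<in> L"
      using *(1) le by (simp add: L_def)
    have "sum_list ys \<le> N" "length ys \<le> N"
      using N size_le[OF *(2)] by (simp_all add: ys sum_mset_sum_list)
    then have "ys \<in> L"
      using le by (simp add: L_def)
    with \<open>a \<in> L\<close> show "(a, \<mu>) \<in> (\<lambda>(xs, ys). (xs, mset ys)) ` (L \<times> L)"
      by (intro image_eqI[where x = "(a, ys)"]) (simp_all add: ys)
  qed
  then show ?thesis
    by (rule finite_subset) (intro finite_imageI finite_cartesian_product \<open>finite L\<close>)
qed

text \<open>
  The rows of the diagram from top to bottom, each given by its number of squares and the label
  of its circle, if any. (All entries of \<open>a\<close> and \<open>\<mu>\<close> are bounded by the sum of all entries.)
\<close>

definition rows :: "mpart \<Rightarrow> (nat \<times> nat option) list"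
  where "rows \<Lambda> = (case \<Lambda> of (a, \<mu>) \<Rightarrow>
    concat (map (\<lambda>r. map (\<lambda>i. (r, Some i)) (filter (\<lambda>i. a ! i = r) [0..<length a])
                     @ replicate (count \<mu> r) (r, None))
                (rev [0..<Suc (sum_list a + sum_mset \<mu>)])))"

text \<open>Squares are pairs of a row index and a column index, both starting from 0.\<close>

definition squares :: "mpart \<Rightarrow> (nat \<times> nat) set"
  where "squares \<Lambda> = {(r, c). r < length (rows \<Lambda>) \<and> c < fst (rows \<Lambda> ! r)}"

definition arm :: "mpart \<Rightarrow> nat \<times> nat \<Rightarrow> nat"
  where "arm \<Lambda> s = (case s of (r, c) \<Rightarrow>
    fst (rows \<Lambda> ! r) - Suc c + (if snd (rows \<Lambda> ! r) = None then 0 else 1))"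

text \<open>A circle lies in column \<open>c\<close> iff its row consists of exactly \<open>c\<close> squares.\<close>

definition leg :: "mpart \<Rightarrow> nat \<times> nat \<Rightarrow> nat"
  where "leg \<Lambda> s = (case s of (r, c) \<Rightarrow>
    card {r'. r < r' \<and> (r', c) \<in> squares \<Lambda>} +
    (case snd (rows \<Lambda> ! r) of
       None \<Rightarrow> 0
     | Some i \<Rightarrow> card {r'. r' < length (rows \<Lambda>) \<and> (\<exists>j<i. rows \<Lambda> ! r' = (c, Some j))}))"

definition c_coeff :: "'a::field \<Rightarrow> 'a \<Rightarrow> mpart \<Rightarrow> 'a"
  where "c_coeff q t \<Lambda> = (\<Prod>s\<in>squares \<Lambda>. 1 - q ^ arm \<Lambda> s * t ^ (leg \<Lambda> s + 1))"

definition Inv :: "nat list \<Rightarrow> nat"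
  where "Inv a = card {(i, j). i < j \<and> j < length a \<and> a ! i < a ! j}"

definition z_coeff :: "nat multiset \<Rightarrow> nat"
  where "z_coeff \<mu> = (\<Prod>i\<in>set_mset \<mu>. i ^ count \<mu> i * fact (count \<mu> i))"


section \<open>Bases of \<open>R\<^sub>m\<close>\<close>

definition x_pow :: "nat list \<Rightarrow> 'a::field mps"
  where "x_pow a = (\<Prod>i<length a. X i ^ (a ! i))"

definition mono_sym :: "nat \<Rightarrow> nat multiset \<Rightarrow> 'a::field mps" \<comment> \<open>\<open>m\<^sub>\<mu>(x\<^bsub>m+1\<^esub>, x\<^bsub>m+2\<^esub>, \<dots>)\<close>\<close>
  where "mono_sym m \<mu> = Abs_mps (\<lambda>\<alpha>. if Poly_Mapping.keys \<alpha> \<subseteq> {m..} \<and>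
    image_mset (Poly_Mapping.lookup \<alpha>) (mset_set (Poly_Mapping.keys \<alpha>)) = \<mu> then 1 else 0)"

definition m_fun :: "mpart \<Rightarrow> 'a::field mps"
  where "m_fun \<Lambda> = (case \<Lambda> of (a, \<mu>) \<Rightarrow> x_pow a * mono_sym (length a) \<mu>)"

definition power_sum :: "nat \<Rightarrow> 'a::field mps"
  where "power_sum k = Abs_mps (\<lambda>\<alpha>. if \<exists>i. \<alpha> = Poly_Mapping.single i k then 1 else 0)"

definition p_sym :: "nat multiset \<Rightarrow> 'a::field mps"
  where "p_sym \<mu> = (\<Prod>k\<in>#\<mu>. power_sum k)"

definition swap_vars :: "nat \<Rightarrow> nat \<Rightarrow> 'a mps \<Rightarrow> 'a mps"
  where "swap_vars i j f =
    Abs_mps (\<lambda>\<alpha>. mcoeff f (Poly_Mapping.map_key (Transposition.transpose i j) \<alpha>))"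

text \<open>The quotient by \<open>X i - X (i + 1)\<close> is described as the unique solution \<open>g\<close> of the
  corresponding equation.\<close>

definition hecke :: "'a \<Rightarrow> nat \<Rightarrow> 'a::field mps \<Rightarrow> 'a mps"
  where "hecke t i f = mscale t f +
    (THE g. (X i - X (Suc i)) * g = (mscale t (X i) - X (Suc i)) * (swap_vars i (Suc i) f - f))"

definition dominant :: "nat list \<Rightarrow> bool"
  where "dominant a \<longleftrightarrow> sorted_wrt (\<ge>) a"

inductive is_H :: "'a::field \<Rightarrow> nat list \<Rightarrow> 'a mps \<Rightarrow> bool" for t where
  dominant: "dominant a \<Longrightarrow> is_H t a (x_pow a)"
| hecke: "is_H t a f \<Longrightarrow> Suc i < length a \<Longrightarrow> a ! Suc i < a ! i \<Longrightarrow>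
    is_H t (a[i := a ! Suc i, Suc i := a ! i]) (hecke t i f)"

definition H_fun :: "'a::field \<Rightarrow> nat list \<Rightarrow> 'a mps"
  where "H_fun t a = (THE f. is_H t a f)"

definition p_fun :: "'a::field \<Rightarrow> mpart \<Rightarrow> 'a mps"
  where "p_fun t \<Lambda> = (case \<Lambda> of (a, \<mu>) \<Rightarrow> H_fun t a * p_sym \<mu>)"

definition xp_fun :: "mpart \<Rightarrow> 'a::field mps"
  where "xp_fun \<Lambda> = (case \<Lambda> of (a, \<mu>) \<Rightarrow> x_pow a * p_sym \<mu>)"


section \<open>Linear maps and forms given on a basis\<close>

text \<open>The coefficient of \<open>b i\<close> in the expansion of \<open>f\<close> in the basis \<open>b i\<close> (\<open>i \<in> I\<close>).\<close>

definition coord :: "'i set \<Rightarrow> ('i \<Rightarrow> 'a::field mps) \<Rightarrow> 'a mps \<Rightarrow> 'i \<Rightarrow> 'a"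
  where "coord I b f i = mps.representation (b ` I) f (b i)"

text \<open>The linear map with \<open>b i \<mapsto> w i \<cdot> b i\<close>, and the bilinear form with
  \<open>\<langle>b i, b j\<rangle> = \<delta>\<^sub>i\<^sub>j w i\<close>.\<close>

definition diag_map :: "'i set \<Rightarrow> ('i \<Rightarrow> 'a::field mps) \<Rightarrow> ('i \<Rightarrow> 'a) \<Rightarrow> 'a mps \<Rightarrow> 'a mps"
  where "diag_map I b w f =
    (\<Sum>i | i \<in> I \<and> coord I b f i \<noteq> 0. mscale (coord I b f i * w i) (b i))"

definition diag_form :: "'i set \<Rightarrow> ('i \<Rightarrow> 'a::field mps) \<Rightarrow> ('i \<Rightarrow> 'a) \<Rightarrow> 'a mps \<Rightarrow> 'a mps \<Rightarrow> 'a"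
  where "diag_form I b w f g =
    (\<Sum>i | i \<in> I \<and> coord I b f i \<noteq> 0. coord I b f i * coord I b g i * w i)"

definition is_basis :: "'i set \<Rightarrow> ('i \<Rightarrow> 'a::field mps) \<Rightarrow> 'a mps set \<Rightarrow> bool"
  where "is_basis I b V \<longleftrightarrow> inj_on b I \<and> mps.independent (b ` I) \<and> mps.span (b ` I) = V"


section \<open>\<open>m\<close>-symmetric Macdonald polynomials\<close>

definition p_norm :: "'a::field \<Rightarrow> 'a \<Rightarrow> mpart \<Rightarrow> 'a"
  where "p_norm q t \<Lambda> = (case \<Lambda> of (a, \<mu>) \<Rightarrow>
    q ^ sum_list a * t ^ Inv a * of_nat (z_coeff \<mu>) * (\<Prod>k\<in>#\<mu>. (1 - q ^ k) / (1 - t ^ k)))"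

definition mac_form :: "nat \<Rightarrow> 'a::field \<Rightarrow> 'a \<Rightarrow> 'a mps \<Rightarrow> 'a mps \<Rightarrow> 'a"
  where "mac_form m q t = diag_form (mparts m) (p_fun t) (p_norm q t)"

definition is_macdonald :: "nat \<Rightarrow> 'a::field \<Rightarrow> 'a \<Rightarrow> (mpart \<Rightarrow> 'a mps) \<Rightarrow> bool"
  where "is_macdonald m q t P \<longleftrightarrow>
    is_basis (mparts m) P (msym m) \<and>
    (\<forall>\<Lambda>\<in>mparts m. \<forall>\<Omega>\<in>mparts m. \<Lambda> \<noteq> \<Omega> \<longrightarrow> mac_form m q t (P \<Lambda>) (P \<Omega>) = 0) \<and>
    (\<forall>\<Lambda>\<in>mparts m. \<exists>d. P \<Lambda> = m_fun \<Lambda> +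
       (\<Sum>\<Omega> | \<Omega> \<in> mparts m \<and> mpart_less m \<Omega> \<Lambda>. mscale (d \<Omega>) (m_fun \<Omega>)))"

text \<open>The integral form \<open>J\<^sub>\<Lambda>\<close>, given the family \<open>P\<close> of Macdonald polynomials.\<close>

definition J_fun :: "'a::field \<Rightarrow> 'a \<Rightarrow> (mpart \<Rightarrow> 'a mps) \<Rightarrow> mpart \<Rightarrow> 'a mps"
  where "J_fun q t P \<Lambda> = mscale (c_coeff q t \<Lambda>) (P \<Lambda>)"

text \<open>\<open>f \<mapsto> f[X/(1-t)]\<close>, relative to the basis \<open>p\<^sub>\<Lambda>(x;t)\<close>.\<close>

definition pleth_t :: "nat \<Rightarrow> 'a::field \<Rightarrow> 'a mps \<Rightarrow> 'a mps"
  where "pleth_t m t = diag_map (mparts m) (p_fun t) (\<lambda>(a, \<mu>). 1 / (\<Prod>k\<in>#\<mu>. 1 - t ^ k))"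

text \<open>\<open>f \<mapsto> f[X/(1-q)]\<close>, relative to the basis \<open>x\<^sup>a p\<^sub>\<mu>(x)\<close>.\<close>

definition pleth_q :: "nat \<Rightarrow> 'a::field \<Rightarrow> 'a mps \<Rightarrow> 'a mps"
  where "pleth_q m q = diag_map (mparts m) xp_fun (\<lambda>(a, \<mu>). 1 / (\<Prod>k\<in>#\<mu>. 1 - q ^ k))"


section \<open>The functions \<open>h\<^sub>\<Lambda>\<close>\<close>

definition h_sym :: "nat \<Rightarrow> 'a::field mps"
  where "h_sym r = Abs_mps (\<lambda>\<alpha>. if mdeg \<alpha> = r then 1 else 0)"

definition h_fun :: "'a::field \<Rightarrow> mpart \<Rightarrow> 'a mps"
  where "h_fun q \<Lambda> = (case \<Lambda> of (a, \<mu>) \<Rightarrow>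
    (\<Prod>i<length a. \<Sum>c\<le>a ! i. mscale (inverse q ^ c) (X i ^ c * h_sym (a ! i - c))) *
    (\<Prod>r\<in>#\<mu>. h_sym r))"

text \<open>\<open>h\<^sub>r[X/(1-q)]\<close>: on \<open>R\<^sub>0\<close>, the ring of symmetric functions, with basis \<open>p\<^sub>\<mu>\<close>, the map
  \<open>pleth_q 0 q\<close> is the ring homomorphism \<open>p\<^sub>k \<mapsto> p\<^sub>k / (1 - q\<^sup>k)\<close>.\<close>

definition h_pleth :: "'a::field \<Rightarrow> nat \<Rightarrow> 'a mps"
  where "h_pleth q r = pleth_q 0 q (h_sym r)"

definition h_pleth_x :: "'a::field \<Rightarrow> nat \<Rightarrow> nat \<Rightarrow> 'a mps" \<comment> \<open>\<open>h\<^sub>r[x\<^bsub>i+1\<^esub> + qX/(1-q)]\<close>\<close>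
  where "h_pleth_x q i r = (\<Sum>c\<le>r. mscale (q ^ (r - c)) (X i ^ c * h_pleth q (r - c)))"

definition q_fact :: "'a::field \<Rightarrow> nat \<Rightarrow> 'a"
  where "q_fact q r = (\<Prod>k=1..r. 1 - q ^ k)"

definition q_fact_mpart :: "'a::field \<Rightarrow> mpart \<Rightarrow> 'a"
  where "q_fact_mpart q \<Lambda> = (case \<Lambda> of (a, \<mu>) \<Rightarrow>
    (\<Prod>i<length a. q_fact q (a ! i)) * (\<Prod>r\<in>#\<mu>. q_fact q r))"


section \<open>The field of coefficients and the limit \<open>t \<rightarrow> 1\<close>\<close>

text \<open>\<open>\<rat>(q)\<close>, and \<open>\<rat>(q,t)\<close> as the field of rational functions in \<open>t\<close> over \<open>\<rat>(q)\<close>.\<close>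

type_synonym Qq = "rat poly fract"
type_synonym Qqt = "Qq poly fract"

definition q_Qq :: Qq where "q_Qq = Fract [:0, 1:] 1"
definition q_Qqt :: Qqt where "q_Qqt = Fract [:q_Qq:] 1"
definition t_Qqt :: Qqt where "t_Qqt = Fract [:0, 1:] 1"

text \<open>A rational function in \<open>t\<close> has limit \<open>l\<close> at \<open>t = 1\<close> iff it has no pole there and takes the
  value \<open>l\<close>; limits of power series are taken coefficientwise.\<close>

definition has_limit_t1 :: "Qqt \<Rightarrow> Qq \<Rightarrow> bool"
  where "has_limit_t1 r l \<longleftrightarrow>
    (\<exists>n d. poly d 1 \<noteq> 0 \<and> r = Fract n d \<and> l = poly n 1 / poly d 1)"

definition mps_limit_t1 :: "Qqt mps \<Rightarrow> Qq mps \<Rightarrow> bool"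
  where "mps_limit_t1 F G \<longleftrightarrow> (\<forall>\<alpha>. has_limit_t1 (mcoeff F \<alpha>) (mcoeff G \<alpha>))"

end

theory Submission
  imports Defs
begin

text \<open>
  Write \<open>s = 1 - t\<close> and let the length of \<open>(a, \<mu>)\<close> be the number of parts of \<open>\<mu>\<close>. Since \<open>H\<^sub>a\<close>
  tends to \<open>x\<^sup>a\<close> as \<open>t \<rightarrow> 1\<close>, the basis \<open>p\<^sub>\<Lambda>(x;t)\<close> tends to \<open>x\<^sup>a p\<^sub>\<mu>(x)\<close>, and expressing \<open>m\<^sub>\<Lambda>\<close>
  in it only involves indices of smaller length, apart from \<open>\<Lambda>\<close> itself in the limit. The norm of
  \<open>p\<^sub>\<Lambda>(x;t)\<close> has a pole at \<open>t = 1\<close> whose order is the length, so after rescaling by powers of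
  \<open>s\<close> the Gram matrix of the \<open>m\<^sub>\<Lambda>\<close> becomes triangular at \<open>t = 1\<close>. As the length can only grow when one
  goes down in the order, orthogonality forces \<open>P\<^sub>\<Lambda> \<rightarrow> m\<^sub>\<Lambda>\<close>, and
  \<open>c\<^sub>\<Lambda> \<langle>P\<^sub>\<Lambda>, m\<^sub>\<Omega>\<rangle>\<close> tends to \<open>\<delta>\<^sub>\<Lambda>\<^sub>\<Omega> q\<^bsup>|a|\<^esup> (q;q)\<^sub>\<Lambda>\<close>. Now
  \<open>\<langle>P\<^sub>\<Lambda>, m\<^sub>\<Omega>\<rangle>\<close> is the pairing of \<open>P\<^sub>\<Lambda>[X/(1-t)]\<close> with \<open>m\<^sub>\<Omega>\<close> for a form that is
  regular and nondegenerate at \<open>t = 1\<close>, where the basis dual to the \<open>m\<^sub>\<Omega>\<close> consists of the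
  \<open>h\<^sub>\<Omega>[X/(1-q);q]\<close>. The duality follows from the recurrence
  \<open>r h\<^sub>r = \<Sum>\<^sub>k p\<^sub>k h\<^bsub>r-k\<^esub>\<close> and Euler's operator applied to products of power sums.
\<close>

section \<open>Limits at \<open>t = 1\<close>\<close>

text \<open>The obstacle is that the coefficients over \<rat>(q,t) are not known to be regular at
  \<open>t = 1\<close>: those of P_\<Lambda> on lower monomials, or of m_\<Lambda> in the power sum
  basis, might have poles, so limits cannot simply be passed through equations. Each family of
  unknowns is therefore described by a linear system whose limit matrix is injective, and regularity
  becomes a conclusion. This one device serves independence, changes of basis, P_\<Lambda> and
  J_\<Lambda>[X/(1-t)] alike. For the pairing of P_\<Lambda> with m_\<Omega> two bounds meet. If
  \<Lambda> \<le> \<Omega> fails, it vanishes exactly, by orthogonality. If \<Lambda> \<le> \<Omega>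
  holds, then \<Omega> has at most as many parts as \<Lambda>, so the pole has at most the order to
  which c_\<Lambda> vanishes: every row without circle has exactly one square of arm 0, and it
  supplies one factor that vanishes at \<open>t = 1\<close>. The duality comes from a transposed
  matrix: the coefficient of x^b p_\<nu> in h_\<Lambda> is a reciprocal norm times the coefficient
  of m_\<Lambda> in x^b p_\<nu>.\<close>

lemma has_limit_t1I: "poly d 1 \<noteq> 0 \<Longrightarrow> r = Fract n d \<Longrightarrow> l = poly n 1 / poly d 1 \<Longrightarrow> has_limit_t1 r l"
  unfolding has_limit_t1_def by blast

text \<open>The definition picks some fraction, not necessarily reduced; cross-multiplying and
  evaluating at 1 shows that the value does not depend on it.\<close>

lemma has_limit_t1_unique:
  assumes "has_limit_t1 r l" "has_limit_t1 r l'"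
  shows "l = l'"
proof -
  obtain n d where 1: "poly d 1 \<noteq> 0" "r = Fract n d" "l = poly n 1 / poly d 1"
    using assms(1) unfolding has_limit_t1_def by blast
  obtain n' d' where 2: "poly d' 1 \<noteq> 0" "r = Fract n' d'" "l' = poly n' 1 / poly d' 1"
    using assms(2) unfolding has_limit_t1_def by blast
  have "d \<noteq> 0" "d' \<noteq> 0" using 1 2 by auto
  then have "n * d' = n' * d"
    using 1(2) 2(2) by (simp add: eq_fract)
  then have "poly n 1 * poly d' 1 = poly n' 1 * poly d 1"
    by (metis poly_mult)
  then show ?thesis using 1 2 by (simp add: frac_eq_eq)
qed

lemma has_limit_t1_const: "has_limit_t1 (Fract [:c:] 1) c"
  by (rule has_limit_t1I[of 1 _ "[:c:]"]) auto

lemma has_limit_t1_0 [simp]: "has_limit_t1 0 0"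
  using has_limit_t1_const[of 0] by (simp add: fract_collapse)

lemma has_limit_t1_1 [simp]: "has_limit_t1 1 1"
  using has_limit_t1_const[of 1] by (simp add: fract_collapse flip: one_pCons)

lemma has_limit_t1_q: "has_limit_t1 q_Qqt q_Qq"
  unfolding q_Qqt_def by (rule has_limit_t1_const)

lemma has_limit_t1_t: "has_limit_t1 t_Qqt 1"
  unfolding t_Qqt_def by (rule has_limit_t1I[of 1 _ "[:0, 1:]"]) auto

lemma has_limit_t1_add:
  assumes "has_limit_t1 r l" "has_limit_t1 r' l'"
  shows "has_limit_t1 (r + r') (l + l')"
proof -
  obtain n d where 1: "poly d 1 \<noteq> 0" "r = Fract n d" "l = poly n 1 / poly d 1"
    using assms(1) unfolding has_limit_t1_def by blast
  obtain n' d' where 2: "poly d' 1 \<noteq> 0" "r' = Fract n' d'" "l' = poly n' 1 / poly d' 1"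
    using assms(2) unfolding has_limit_t1_def by blast
  have "d \<noteq> 0" "d' \<noteq> 0" using 1 2 by auto
  then show ?thesis using 1 2
    by (intro has_limit_t1I[of "d * d'" _ "n * d' + n' * d"]) (auto simp: add_frac_eq)
qed

lemma has_limit_t1_mult:
  assumes "has_limit_t1 r l" "has_limit_t1 r' l'"
  shows "has_limit_t1 (r * r') (l * l')"
proof -
  obtain n d where 1: "poly d 1 \<noteq> 0" "r = Fract n d" "l = poly n 1 / poly d 1"
    using assms(1) unfolding has_limit_t1_def by blast
  obtain n' d' where 2: "poly d' 1 \<noteq> 0" "r' = Fract n' d'" "l' = poly n' 1 / poly d' 1"
    using assms(2) unfolding has_limit_t1_def by blast
  show ?thesis using 1 2
    by (intro has_limit_t1I[of "d * d'" _ "n * n'"]) auto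
qed

lemma has_limit_t1_minus: "has_limit_t1 r l \<Longrightarrow> has_limit_t1 (- r) (- l)"
proof -
  have "Fract [:-1:] 1 = (- 1 :: Qqt)"
    unfolding One_fract_def[where 'a = "Qq poly"] minus_fract by (simp add: one_pCons)
  then show "has_limit_t1 r l \<Longrightarrow> has_limit_t1 (- r) (- l)"
    using has_limit_t1_mult[OF has_limit_t1_const[of "-1"], of r l] by simp
qed

lemma has_limit_t1_diff:
  "has_limit_t1 r l \<Longrightarrow> has_limit_t1 r' l' \<Longrightarrow> has_limit_t1 (r - r') (l - l')"
  using has_limit_t1_add[OF _ has_limit_t1_minus] by fastforce

lemma has_limit_t1_inverse:
  assumes "has_limit_t1 r l" "l \<noteq> 0"
  shows "has_limit_t1 (inverse r) (inverse l)"
proof -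
  obtain n d where 1: "poly d 1 \<noteq> 0" "r = Fract n d" "l = poly n 1 / poly d 1"
    using assms(1) unfolding has_limit_t1_def by blast
  show ?thesis using 1 assms(2)
    by (intro has_limit_t1I[of n _ d]) auto
qed

lemma has_limit_t1_divide:
  "has_limit_t1 r l \<Longrightarrow> has_limit_t1 r' l' \<Longrightarrow> l' \<noteq> 0 \<Longrightarrow> has_limit_t1 (r / r') (l / l')"
  unfolding divide_inverse by (intro has_limit_t1_mult has_limit_t1_inverse)

lemma has_limit_t1_power: "has_limit_t1 r l \<Longrightarrow> has_limit_t1 (r ^ k) (l ^ k)"
  by (induction k) (auto intro: has_limit_t1_mult)

lemma has_limit_t1_sum:
  "(\<And>i. i \<in> I \<Longrightarrow> has_limit_t1 (r i) (l i)) \<Longrightarrow> has_limit_t1 (sum r I) (sum l I)"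
  by (induction I rule: infinite_finite_induct) (auto intro: has_limit_t1_add)

lemma has_limit_t1_prod:
  "(\<And>i. i \<in> I \<Longrightarrow> has_limit_t1 (r i) (l i)) \<Longrightarrow> has_limit_t1 (prod r I) (prod l I)"
  by (induction I rule: infinite_finite_induct) (auto intro: has_limit_t1_mult)

lemma has_limit_t1_prod_mset:
  "(\<And>i. i \<in># M \<Longrightarrow> has_limit_t1 (r i) (l i)) \<Longrightarrow>
    has_limit_t1 (\<Prod>i\<in>#M. r i) (\<Prod>i\<in>#M. l i)"
  by (induction M) (auto intro: has_limit_t1_mult)

lemma has_limit_t1_of_nat: "has_limit_t1 (of_nat k) (of_nat k)"
  by (induction k) (auto intro: has_limit_t1_add)

section \<open>Zeros and poles at \<open>t = 1\<close>\<close>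

lemma one_minus_t: "1 - t_Qqt = Fract [:1, -1:] 1"
  by (simp add: t_Qqt_def One_fract_def[where 'a = "Qq poly"])
     (simp add: one_pCons)

lemma one_minus_t_nonzero [simp]: "1 - t_Qqt \<noteq> 0"
proof
  assume "1 - t_Qqt = 0"
  then have "[:1, -1:] * 1 = (0 :: Qq poly) * 1"
    unfolding one_minus_t Zero_fract_def[where 'a = "Qq poly"] by (subst (asm) eq_fract(1)) auto
  then show False by simp
qed

text \<open>A numerator with root 1 is divisible by \<open>[:-1, 1:]\<close>, and the cofactor over
  the same denominator is still regular. This is what lowers the scaling exponent by one in
  \<open>has_limit_t1_solution\<close>.\<close>

lemma has_limit_t1_0_factor:
  assumes "has_limit_t1 r 0"
  obtains r' l where "r = (1 - t_Qqt) * r'" "has_limit_t1 r' l"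
proof -
  obtain n d where 1: "poly d 1 \<noteq> 0" "r = Fract n d" "0 = poly n 1 / poly d 1"
    using assms(1) unfolding has_limit_t1_def by blast
  then have "poly n 1 = 0" by simp
  then obtain e where "n = [:-1, 1:] * e"
    using poly_eq_0_iff_dvd[of n 1] by (auto elim: dvdE)
  then have "n = [:1, -1:] * (- e)" by simp
  then have "r = (1 - t_Qqt) * Fract (- e) d"
    using 1 by (simp add: one_minus_t)
  moreover have "has_limit_t1 (Fract (- e) d) (poly (- e) 1 / poly d 1)"
    using 1 by (intro has_limit_t1I) auto
  ultimately show ?thesis using that by blast
qed

text \<open>The exponent is the multiplicity of the root 1 of the denominator, so poles at
  \<open>t = 1\<close> have finite order.\<close>

lemma ex_power_has_limit_t1: "\<exists>k l. has_limit_t1 ((1 - t_Qqt) ^ k * r) l"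
proof -
  obtain n d where r: "r = Fract n d" "d \<noteq> 0" by (cases r) auto
  obtain e where e: "d = [:-1, 1:] ^ order 1 d * e" "poly e 1 \<noteq> 0"
    using order_decomp[OF r(2), of 1] by (metis poly_eq_0_iff_dvd)
  define k where "k = order 1 d"
  \<comment> \<open>\<open>order\<close> splits off powers of t - 1, whereas the scaling uses 1 - t;
    the sign goes into the numerator.\<close>
  have "[:1, -1:] = - [:-1, 1 :: Qq:]" by simp
  then have p: "[:1, -1 :: Qq:] ^ k = (- 1) ^ k * [:-1, 1:] ^ k"
    by (metis power_minus)
  have pw: "(1 - t_Qqt) ^ k = Fract ([:1, -1:] ^ k) 1"
    unfolding one_minus_t by (induction k) (auto simp: One_fract_def)
  have "e \<noteq> 0" using e by auto
  have "(1 - t_Qqt) ^ k * r = Fract ([:1, -1:] ^ k * n) d"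
    by (simp add: pw r)
  also have "\<dots> = Fract ((- 1) ^ k * n) e"
    using r(2) \<open>e \<noteq> 0\<close> by (subst eq_fract(1)) (auto simp: p e(1)[folded k_def])
  finally show ?thesis using e(2) by (intro exI has_limit_t1I) auto
qed

lemma has_limit_t1_0_power:
  "has_limit_t1 r l \<Longrightarrow> k > 0 \<Longrightarrow> has_limit_t1 ((1 - t_Qqt) ^ k * r) 0"
  using has_limit_t1_mult[OF has_limit_t1_power[OF has_limit_t1_diff[OF has_limit_t1_1 has_limit_t1_t]], of r l k]
  by (simp add: power_0_left)

text \<open>
  Rescale the unknowns by the least power of \<open>1 - t\<close> making all of them regular; if that power
  were positive, the limit would be a nontrivial linear relation.
\<close>

lemma has_limit_t1_solution:
  assumes "finite I"
    and B: "\<And>i x. i \<in> I \<Longrightarrow> has_limit_t1 (B i x) (B' i x)"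
    and ind: "\<And>e. (\<And>x. (\<Sum>i\<in>I. e i * B' i x) = 0) \<Longrightarrow> (\<forall>i\<in>I. e i = 0)"
    and eq: "\<And>x. (\<Sum>i\<in>I. w i * B i x) = R x"
    and R: "\<And>x. has_limit_t1 (R x) (R' x)"
  obtains w' where "\<And>i. i \<in> I \<Longrightarrow> has_limit_t1 (w i) (w' i)"
    and "\<And>x. (\<Sum>i\<in>I. w' i * B' i x) = R' x"
proof -
  define s where "s = 1 - t_Qqt"
  define Q where "Q k \<longleftrightarrow> (\<forall>i\<in>I. \<exists>l. has_limit_t1 (s ^ k * w i) l)" for k
  have "\<exists>k. Q k"
  proof -
    have "\<forall>i. \<exists>k l. has_limit_t1 (s ^ k * w i) l"
      using ex_power_has_limit_t1 by (simp add: s_def)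
    then obtain f l where f: "\<And>i. has_limit_t1 (s ^ f i * w i) (l i)" by metis
    \<comment> \<open>The sum of the individual exponents serves all unknowns at once, since surplus
      factors of \<open>s\<close> keep regularity.\<close>
    have "\<exists>l. has_limit_t1 (s ^ (\<Sum>i\<in>I. f i) * w i) l" if "i \<in> I" for i
    proof -
      have "f i \<le> (\<Sum>i\<in>I. f i)" using assms(1) that by (intro member_le_sum) auto
      then have "s ^ (\<Sum>i\<in>I. f i) * w i = s ^ ((\<Sum>i\<in>I. f i) - f i) * (s ^ f i * w i)"
        by (simp add: mult.assoc[symmetric] power_add[symmetric])
      moreover have "has_limit_t1 (s ^ ((\<Sum>i\<in>I. f i) - f i)) (0 ^ ((\<Sum>i\<in>I. f i) - f i))"
        unfolding s_def
        using has_limit_t1_power[OF has_limit_t1_diff[OF has_limit_t1_1 has_limit_t1_t]] by simp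
      ultimately show ?thesis using has_limit_t1_mult f by metis
    qed
    then show ?thesis unfolding Q_def by blast
  qed
  then obtain k where k: "Q k" "\<And>k'. k' < k \<Longrightarrow> \<not> Q k'"
    using exists_least_iff[of Q] by auto
  then obtain e where e: "\<And>i. i \<in> I \<Longrightarrow> has_limit_t1 (s ^ k * w i) (e i)"
    unfolding Q_def by metis
  have lim: "has_limit_t1 (s ^ k * R x) (\<Sum>i\<in>I. e i * B' i x)" for x
  proof -
    have "s ^ k * R x = (\<Sum>i\<in>I. (s ^ k * w i) * B i x)"
      by (simp add: eq[symmetric] sum_distrib_left mult.assoc)
    then show ?thesis using e B by (auto intro!: has_limit_t1_sum has_limit_t1_mult)
  qed
  show ?thesis
  proof (cases "k = 0")
    case True
    then show ?thesis
      using that[of e] e lim R has_limit_t1_unique by fastforce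
  next
    case False
    have "(\<Sum>i\<in>I. e i * B' i x) = 0" for x
      using has_limit_t1_0_power[OF R, of k x] lim[of x] False has_limit_t1_unique
      by (auto simp: s_def)
    then have 0: "\<forall>i\<in>I. e i = 0" by (rule ind)
    have "Q (k - 1)"
      unfolding Q_def
    proof
      fix i assume "i \<in> I"
      then have "has_limit_t1 (s ^ k * w i) 0" using e 0 by fastforce
      then obtain r l where r: "s ^ k * w i = (1 - t_Qqt) * r" "has_limit_t1 r l"
        by (rule has_limit_t1_0_factor)
      have "s * (s ^ (k - 1) * w i) = s * r"
        using r(1) False by (simp add: s_def power_eq_if mult.assoc)
      then have "s ^ (k - 1) * w i = r"
        using one_minus_t_nonzero unfolding s_def by (metis mult_left_cancel)
      then show "\<exists>l. has_limit_t1 (s ^ (k - 1) * w i) l" using r by auto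
    qed
    then show ?thesis using k(2)[of "k - 1"] False by simp
  qed
qed

section \<open>Power series\<close>

abbreviation (input) lookup :: "(nat \<Rightarrow>\<^sub>0 nat) \<Rightarrow> nat \<Rightarrow> nat" where "lookup \<equiv> Poly_Mapping.lookup"
abbreviation (input) keys :: "(nat \<Rightarrow>\<^sub>0 nat) \<Rightarrow> nat set" where "keys \<equiv> Poly_Mapping.keys"
abbreviation (input) single :: "nat \<Rightarrow> nat \<Rightarrow> (nat \<Rightarrow>\<^sub>0 nat)" where "single \<equiv> Poly_Mapping.single"
abbreviation (input) map_key :: "(nat \<Rightarrow> nat) \<Rightarrow> (nat \<Rightarrow>\<^sub>0 nat) \<Rightarrow> (nat \<Rightarrow>\<^sub>0 nat)"
  where "map_key \<equiv> Poly_Mapping.map_key"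

lemma mcoeff_0 [simp]: "mcoeff 0 \<alpha> = 0"
  by (simp add: zero_mps_def)

lemma mcoeff_1: "mcoeff 1 \<alpha> = (if \<alpha> = 0 then 1 else 0)"
  by (simp add: one_mps_def)

lemma mcoeff_add [simp]: "mcoeff (f + g) \<alpha> = mcoeff f \<alpha> + mcoeff g \<alpha>"
  by (simp add: plus_mps_def)

lemma mcoeff_diff [simp]: "mcoeff (f - g) \<alpha> = mcoeff f \<alpha> - mcoeff g \<alpha>"
  by (simp add: minus_mps_def)

lemma mcoeff_mscale [simp]: "mcoeff (mscale c f) \<alpha> = c * mcoeff f \<alpha>"
  by (simp add: mscale_def)

lemma mcoeff_sum [simp]: "mcoeff (\<Sum>i\<in>I. f i) \<alpha> = (\<Sum>i\<in>I. mcoeff (f i) \<alpha>)"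
  by (induction I rule: infinite_finite_induct) auto

lemma mcoeff_mult: "mcoeff (f * g) \<alpha> = (\<Sum>(\<beta>, \<gamma>) | \<beta> + \<gamma> = \<alpha>. mcoeff f \<beta> * mcoeff g \<gamma>)"
  by (simp add: times_mps_def)

lemma mscale_mult_left: "mscale c f * g = mscale c (f * g)"
  by (rule mps_eqI) (simp add: mcoeff_mult sum_distrib_left case_prod_unfold mult.assoc)

lemma mscale_mult_right: "f * mscale c g = mscale c (f * g)"
  by (metis mscale_mult_left mult.commute)

lemma mscale_conv_mult: "mscale c f = mscale c 1 * f"
  by (simp add: mscale_mult_left)

lemma mscale_prod: "(\<Prod>i\<in>I. mscale (c i) (f i)) = mscale (\<Prod>i\<in>I. c i) (\<Prod>i\<in>I. f i)"
  by (induction I rule: infinite_finite_induct)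
     (auto simp: mscale_mult_left mscale_mult_right mult.commute)

definition monomial_mps :: "(nat \<Rightarrow>\<^sub>0 nat) \<Rightarrow> 'a::field mps"
  where "monomial_mps \<alpha> = Abs_mps (\<lambda>\<beta>. if \<beta> = \<alpha> then 1 else 0)"

lemma mcoeff_mono: "mcoeff (monomial_mps \<alpha>) \<beta> = (if \<beta> = \<alpha> then 1 else 0)"
  by (simp add: monomial_mps_def)

lemma mcoeff_mono_mult: "mcoeff (monomial_mps \<alpha> * f) (\<alpha> + \<beta>) = mcoeff f \<beta>"
proof -
  have "mcoeff (monomial_mps \<alpha> * f) (\<alpha> + \<beta>) =
      (\<Sum>p | fst p + snd p = \<alpha> + \<beta>. if p = (\<alpha>, \<beta>) then mcoeff f \<beta> else 0)"
    unfolding mcoeff_mult case_prod_unfold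
    by (rule sum.cong) (auto simp: mcoeff_mono prod_eq_iff)
  also have "\<dots> = mcoeff f \<beta>"
    using finite_add_eq[of "\<alpha> + \<beta>"] by (simp add: case_prod_unfold)
  finally show ?thesis .
qed

lemma mcoeff_mono_mult_0: "(\<And>\<beta>. \<gamma> \<noteq> \<alpha> + \<beta>) \<Longrightarrow> mcoeff (monomial_mps \<alpha> * f) \<gamma> = 0"
  unfolding mcoeff_mult case_prod_unfold
  by (rule sum.neutral) (force simp: mcoeff_mono)

lemma mono_0 [simp]: "monomial_mps 0 = 1"
  by (rule mps_eqI) (simp add: mcoeff_mono mcoeff_1)

lemma mono_add: "monomial_mps (\<alpha> + \<beta>) = monomial_mps \<alpha> * monomial_mps \<beta>"
proof (rule mps_eqI)
  fix \<gamma>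
  show "mcoeff (monomial_mps (\<alpha> + \<beta>)) \<gamma> = mcoeff (monomial_mps \<alpha> * monomial_mps \<beta> :: 'a mps) \<gamma>"
  proof (cases "\<exists>\<delta>. \<gamma> = \<alpha> + \<delta>")
    case True
    then show ?thesis by (auto simp: mcoeff_mono_mult) (auto simp: mcoeff_mono)
  next
    case False
    then show ?thesis by (subst mcoeff_mono_mult_0) (auto simp: mcoeff_mono)
  qed
qed

lemma X_conv_mono: "X i = monomial_mps (single i 1)"
  by (rule mps_eqI) (simp add: X_def mcoeff_mono)

lemma single_Suc: "single i (Suc k) = single i 1 + single i k"
  by (metis plus_1_eq_Suc single_add)

lemma X_power_conv_mono: "X i ^ k = monomial_mps (single i k)"
proof (induction k)
  case (Suc k)
  then show ?case unfolding single_Suc[of i k] by (simp add: X_conv_mono mono_add)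
qed simp

lemma lookup_map_key: "inj \<pi> \<Longrightarrow> lookup (map_key \<pi> \<alpha>) k = lookup \<alpha> (\<pi> k)"
  by (simp add: map_key.rep_eq)

lemma single_plus_diff:
  "l \<le> b \<Longrightarrow> \<alpha> + single j b - single j l = \<alpha> + single j (b - l)"
  by (rule poly_mapping_eqI) (auto simp: lookup_add lookup_minus lookup_single when_def)

lemma single_plus_minus: "k \<le> lookup \<alpha> i \<Longrightarrow> single i k + (\<alpha> - single i k) = \<alpha>"
  by (rule poly_mapping_eqI) (auto simp: lookup_add lookup_minus lookup_single when_def)

lemma poly_mapping_split: "\<exists>\<beta>. \<alpha> = \<beta> + single i (lookup \<alpha> i) \<and> lookup \<beta> i = 0"
  by (rule exI[of _ "\<alpha> - single i (lookup \<alpha> i)"])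
     (auto intro!: poly_mapping_eqI simp: lookup_add lookup_minus lookup_single when_def)

lemma poly_mapping_split2:
  assumes "i \<noteq> j"
  obtains \<beta> where "\<alpha> = \<beta> + single i (lookup \<alpha> i) + single j (lookup \<alpha> j)" "lookup \<beta> i = 0" "lookup \<beta> j = 0"
proof
  let ?\<beta> = "\<alpha> - (single i (lookup \<alpha> i) + single j (lookup \<alpha> j))"
  show "\<alpha> = ?\<beta> + single i (lookup \<alpha> i) + single j (lookup \<alpha> j)" "lookup ?\<beta> i = 0" "lookup ?\<beta> j = 0"
    using assms
    by (auto intro!: poly_mapping_eqI simp: lookup_add lookup_minus lookup_single when_def)
qed

lemma mdeg_add: "mdeg (\<alpha> + \<beta>) = mdeg \<alpha> + mdeg \<beta>"
proof -
  have *: "mdeg \<gamma> = (\<Sum>k\<in>keys \<alpha> \<union> keys \<beta>. lookup \<gamma> k)" if "keys \<gamma> \<subseteq> keys \<alpha> \<union> keys \<beta>" for \<gamma>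
    unfolding mdeg_def using that by (intro sum.mono_neutral_left) (auto simp: in_keys_iff)
  show ?thesis
    using Poly_Mapping.keys_add[of \<alpha> \<beta>] by (simp add: * sum.distrib lookup_add)
qed

lemma mdeg_single [simp]: "mdeg (single i k) = k"
  by (simp add: mdeg_def)

lemma keys_plus_nat: "keys (\<alpha> + \<beta>) = keys \<alpha> \<union> keys \<beta>"
  by (auto simp: in_keys_iff lookup_add)

text \<open>The coefficient of the product at \<open>single i 1 + \<alpha>\<close> relates the
  coefficient of \<open>f\<close> at \<alpha> to one in which the exponent of \<open>X j\<close> is
  smaller by one, or to none; hence induction on that exponent. Cancelling such differences is all
  the integrality that the Hecke computations use.\<close>

lemma X_diff_mult_eq_0D:
  fixes f :: "'a::field mps"
  assumes "i \<noteq> j" "(X i - X j) * f = 0"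
  shows "f = 0"
proof -
  have "mcoeff f \<alpha> = 0" for \<alpha>
  proof (induction "lookup \<alpha> j" arbitrary: \<alpha>)
    case 0
    have "single i 1 + \<alpha> \<noteq> single j 1 + \<beta>" for \<beta>
    proof
      assume "single i 1 + \<alpha> = single j 1 + \<beta>"
      then have "lookup (single i 1 + \<alpha>) j = lookup (single j 1 + \<beta>) j" by simp
      then show False using 0 assms(1) by (simp add: lookup_add lookup_single when_def)
    qed
    then have "mcoeff (X j * f) (single i 1 + \<alpha>) = 0"
      unfolding X_conv_mono by (intro mcoeff_mono_mult_0)
    moreover have "mcoeff (X i * f) (single i 1 + \<alpha>) = mcoeff f \<alpha>"
      unfolding X_conv_mono by (rule mcoeff_mono_mult)
    moreover have "mcoeff ((X i - X j) * f) (single i 1 + \<alpha>) = 0"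
      by (simp add: assms)
    ultimately show ?case by (simp add: left_diff_distrib)
  next
    case (Suc k)
    obtain \<beta> where b: "\<alpha> = \<beta> + single j (Suc k)" using poly_mapping_split[of \<alpha> j] Suc(2) by auto
    define \<gamma> where "\<gamma> = \<beta> + single j k"
    have a: "\<alpha> = single j 1 + \<gamma>"
      unfolding b \<gamma>_def by (metis add.commute add.left_commute plus_1_eq_Suc single_add)
    then have a2: "single i 1 + \<alpha> = single j 1 + (single i 1 + \<gamma>)" by (simp add: ac_simps)
    have "mcoeff (X j * f) (single i 1 + \<alpha>) = mcoeff f (single i 1 + \<gamma>)"
      unfolding X_conv_mono a2 by (rule mcoeff_mono_mult)
    moreover have "k = lookup (single i 1 + \<gamma>) j"
      using Suc(2) assms(1) unfolding a by (simp add: lookup_add lookup_single when_def)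
    then have "mcoeff f (single i 1 + \<gamma>) = 0" by (rule Suc(1))
    moreover have "mcoeff (X i * f) (single i 1 + \<alpha>) = mcoeff f \<alpha>"
      unfolding X_conv_mono by (rule mcoeff_mono_mult)
    moreover have "mcoeff ((X i - X j) * f) (single i 1 + \<alpha>) = 0"
      by (simp add: assms)
    ultimately show ?case by (simp add: left_diff_distrib)
  qed
  then show ?thesis by (intro mps_eqI) simp
qed

lemma X_diff_mult_cancel:
  fixes f g :: "'a::field mps"
  assumes "(X i - X j) * f = (X i - X j) * g" "i \<noteq> j"
  shows "f = g"
  using X_diff_mult_eq_0D[OF assms(2), of "f - g"] assms(1) by (simp add: algebra_simps)

section \<open>Permutations of the variables\<close>

text \<open>Precomposing exponents with \<pi> gives a left action that sends \<open>X i\<close> to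
  \<open>X (\<pi> i)\<close>.\<close>

definition perm :: "(nat \<Rightarrow> nat) \<Rightarrow> 'a mps \<Rightarrow> 'a::field mps"
  where "perm \<pi> f = Abs_mps (\<lambda>\<alpha>. mcoeff f (map_key \<pi> \<alpha>))"

lemma mcoeff_perm [simp]: "mcoeff (perm \<pi> f) \<alpha> = mcoeff f (map_key \<pi> \<alpha>)"
  by (simp add: perm_def)

lemma swap_vars_eq_perm: "swap_vars i j f = perm (Transposition.transpose i j) f"
  by (simp add: swap_vars_def perm_def)

lemma map_key_inv:
  assumes "bij \<pi>"
  shows "map_key \<pi> (map_key (inv \<pi>) \<alpha>) = \<alpha>" "map_key (inv \<pi>) (map_key \<pi> \<alpha>) = \<alpha>"
  using assms
  by (auto intro!: poly_mapping_eqI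
      simp: lookup_map_key bij_is_inj bij_imp_bij_inv inv_f_f surj_f_inv_f bij_is_surj)

lemma map_key_bij_eq_iff: "bij \<pi> \<Longrightarrow> map_key \<pi> \<alpha> = \<beta> \<longleftrightarrow> \<alpha> = map_key (inv \<pi>) \<beta>"
  using map_key_inv by metis

lemma perm_add: "perm \<pi> (f + g) = perm \<pi> f + perm \<pi> g"
  by (rule mps_eqI) simp

lemma perm_diff: "perm \<pi> (f - g) = perm \<pi> f - perm \<pi> g"
  by (rule mps_eqI) simp

lemma perm_mscale: "perm \<pi> (mscale c f) = mscale c (perm \<pi> f)"
  by (rule mps_eqI) simp

lemma perm_mult:
  assumes "bij \<pi>"
  shows "perm \<pi> (f * g) = perm \<pi> f * perm \<pi> g"
proof (rule mps_eqI)
  fix \<alpha>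
  note [simp] = bij_imp_bij_inv assms map_key_inv
  show "mcoeff (perm \<pi> (f * g)) \<alpha> = mcoeff (perm \<pi> f * perm \<pi> g) \<alpha>"
    unfolding mcoeff_perm mcoeff_mult
    by (rule sum.reindex_bij_witness
          [where i = "\<lambda>(\<beta>, \<gamma>). (map_key \<pi> \<beta>, map_key \<pi> \<gamma>)"
             and j = "\<lambda>(\<beta>, \<gamma>). (map_key (inv \<pi>) \<beta>, map_key (inv \<pi>) \<gamma>)"])
       (auto simp flip: map_key_plus[OF bij_is_inj])
qed

lemma perm_mono: "bij \<pi> \<Longrightarrow> perm \<pi> (monomial_mps \<alpha>) = monomial_mps (map_key (inv \<pi>) \<alpha>)"
  by (rule mps_eqI) (simp add: mcoeff_mono map_key_bij_eq_iff)

lemma perm_1: "bij \<pi> \<Longrightarrow> perm \<pi> 1 = 1"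
  using perm_mono[of \<pi> 0] by (simp add: bij_imp_bij_inv bij_is_inj)

lemma perm_mscale_1: "bij \<pi> \<Longrightarrow> perm \<pi> (mscale c 1) = mscale c 1"
  by (simp add: perm_mscale perm_1)

lemma perm_X:
  assumes "bij \<pi>"
  shows "perm \<pi> (X i) = X (\<pi> i)"
proof -
  have "map_key (inv \<pi>) (single (inv \<pi> (\<pi> i)) 1) = single (\<pi> i) 1"
    using assms by (intro map_key_single) (simp add: bij_imp_bij_inv bij_is_inj)
  then show ?thesis
    using assms unfolding X_conv_mono by (simp add: perm_mono bij_is_inj)
qed

lemma perm_power: "bij \<pi> \<Longrightarrow> perm \<pi> (f ^ k) = perm \<pi> f ^ k"
  by (induction k) (auto simp: perm_1 perm_mult)

lemma perm_prod: "bij \<pi> \<Longrightarrow> perm \<pi> (\<Prod>i\<in>I. f i) = (\<Prod>i\<in>I. perm \<pi> (f i))"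
  by (induction I rule: infinite_finite_induct) (auto simp: perm_1 perm_mult)

lemma perm_prod_mset: "bij \<pi> \<Longrightarrow> perm \<pi> (\<Prod>i\<in>#M. f i) = (\<Prod>i\<in>#M. perm \<pi> (f i))"
  by (induction M) (auto simp: perm_1 perm_mult)

lemma perm_comp: "bij \<pi> \<Longrightarrow> bij \<sigma> \<Longrightarrow> perm \<pi> (perm \<sigma> f) = perm (\<pi> \<circ> \<sigma>) f"
  by (rule mps_eqI) (simp add: map_key_compose bij_is_inj)

lemma perm_id: "perm (\<lambda>x. x) f = f"
  by (rule mps_eqI) (simp add: map_key_id)

section \<open>The Hecke operators\<close>

text \<open>A divided difference. With F for the numerator and (a, b) for the exponents of
  \<open>X i\<close> and \<open>X j\<close>, the quotient g must satisfy g(a, b) - g(a + 1, b - 1) =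
  F(a + 1, b). Unrolling this until b is used up gives a finite sum, so division works for power
  series as well.\<close>

definition ddiff :: "nat \<Rightarrow> nat \<Rightarrow> 'a::field mps \<Rightarrow> 'a mps"
  where "ddiff i j f = Abs_mps (\<lambda>\<alpha>. \<Sum>l\<le>lookup \<alpha> j.
    mcoeff (swap_vars i j f - f) (\<alpha> + single i (Suc l) - single j l))"

text \<open>For a positive exponent of \<open>X i\<close> the sums telescope. For exponent 0 the
  claim is that the numerator sums to zero along an antidiagonal, which holds because it changes
  sign under the exchange of the two variables.\<close>

lemma ddiff:
  fixes f :: "'a::field mps"
  assumes "i \<noteq> j"
  shows "(X i - X j) * ddiff i j f = swap_vars i j f - f"
proof (rule mps_eqI)
  fix \<alpha>
  obtain \<beta> where b: "\<alpha> = \<beta> + single i (lookup \<alpha> i) + single j (lookup \<alpha> j)"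
      "lookup \<beta> i = 0" "lookup \<beta> j = 0"
    using poly_mapping_split2[OF assms] .
  define U where "U a b = \<beta> + single i a + single j b" for a b
  define F where "F a b = mcoeff (swap_vars i j f - f) (U a b)" for a b
  have U: "lookup (U a b) i = a" "lookup (U a b) j = b" for a b
    using assms b by (auto simp: U_def lookup_add lookup_single when_def)
  have swap: "map_key (Transposition.transpose i j) (U a b) = U b a" for a b
    using assms b(2,3)
    by (intro poly_mapping_eqI)
       (auto simp: lookup_map_key U_def lookup_add lookup_single when_def Transposition.transpose_def)
  have F: "F a b = mcoeff f (U b a) - mcoeff f (U a b)" for a b
    by (simp add: F_def swap_vars_def swap)
  have dd: "mcoeff (ddiff i j f) (U a b) = (\<Sum>l\<le>b. F (a + Suc l) (b - l))" for a b
  proof -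
    have "U a b + single i (Suc l) - single j l = U (a + Suc l) (b - l)" if "l \<le> b" for l
    proof -
      have "single i (a + Suc l) = single i a + single i (Suc l)"
        by (rule single_add)
      then have "U a b + single i (Suc l) - single j l =
          (\<beta> + single i (a + Suc l)) + single j b - single j l"
        unfolding U_def by (simp only: ac_simps)
      then show ?thesis using that by (simp add: single_plus_diff U_def)
    qed
    then show ?thesis unfolding ddiff_def mcoeff_Abs_mps U F_def
      by (intro sum.cong) auto
  qed
  have Xi: "mcoeff (X i * g) (U a b) = (if a = 0 then 0 else mcoeff g (U (a - 1) b))" for a b and g :: "'a mps"
  proof (cases a)
    case 0
    then show ?thesis unfolding X_conv_mono using U(1)[of a b]
      by (auto intro!: mcoeff_mono_mult_0 simp: lookup_add)
  next
    case (Suc a')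
    then have "U a b = single i 1 + U a' b"
      unfolding U_def Suc single_Suc[of i a'] by (simp only: ac_simps)
    then show ?thesis using Suc unfolding X_conv_mono by (simp add: mcoeff_mono_mult del: One_nat_def)
  qed
  have Xj: "mcoeff (X j * g) (U a b) = (if b = 0 then 0 else mcoeff g (U a (b - 1)))" for a b and g :: "'a mps"
  proof (cases b)
    case 0
    then show ?thesis unfolding X_conv_mono using U(2)[of a b]
      by (auto intro!: mcoeff_mono_mult_0 simp: lookup_add)
  next
    case (Suc a')
    then have "U a b = single j 1 + U a a'"
      unfolding U_def Suc single_Suc[of j a'] by (simp only: ac_simps)
    then show ?thesis using Suc unfolding X_conv_mono by (simp add: mcoeff_mono_mult del: One_nat_def)
  qed
  have antisym: "(\<Sum>l\<le>b. F l (b - l)) = 0" for b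
  proof -
    have "(\<Sum>l\<le>b. mcoeff f (U l (b - l))) = (\<Sum>l\<le>b. mcoeff f (U (b - l) l))"
      by (rule sum.reindex_bij_witness[where i = "\<lambda>l. b - l" and j = "\<lambda>l. b - l"]) auto
    then show ?thesis by (simp add: F sum_subtractf)
  qed
  have *: "mcoeff ((X i - X j) * ddiff i j f) (U a b) = F a b" for a b
  proof (cases a; cases b)
    assume "a = 0" "b = 0"
    then show ?thesis by (simp add: left_diff_distrib Xi Xj F)
  next
    fix b' assume "a = 0" "b = Suc b'"
    then show ?thesis using antisym[of b]
      by (simp add: left_diff_distrib Xi Xj dd sum.atMost_Suc_shift del: sum.atMost_Suc)
         (metis add.commute add_eq_0_iff)
  next
    fix a' assume "a = Suc a'" "b = 0"
    then show ?thesis by (simp add: left_diff_distrib Xi Xj dd)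
  next
    fix a' b' assume "a = Suc a'" "b = Suc b'"
    then show ?thesis by (simp add: left_diff_distrib Xi Xj dd sum.atMost_Suc_shift del: sum.atMost_Suc)
  qed
  show "mcoeff ((X i - X j) * ddiff i j f) \<alpha> = mcoeff (swap_vars i j f - f) \<alpha>"
    using *[of "lookup \<alpha> i" "lookup \<alpha> j"] unfolding F_def U_def b(1)[symmetric] .
qed

section \<open>Hecke operators with denominators cleared, and their relations\<close>

lemma hecke_conv_ddiff:
  "hecke t i f = mscale t f + (mscale t (X i) - X (Suc i)) * ddiff i (Suc i) f"
proof -
  have *: "(X i - X (Suc i)) * ((mscale t (X i) - X (Suc i)) * ddiff i (Suc i) f) =
    (mscale t (X i) - X (Suc i)) * (swap_vars i (Suc i) f - f)"
    by (subst ddiff[symmetric]) (auto simp: ac_simps)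
  have "(THE g. (X i - X (Suc i)) * g = (mscale t (X i) - X (Suc i)) * (swap_vars i (Suc i) f - f)) =
    (mscale t (X i) - X (Suc i)) * ddiff i (Suc i) f"
    by (rule the_equality) (use * in \<open>metis X_diff_mult_cancel n_not_Suc_n\<close>)+
  then show ?thesis by (simp add: hecke_def)
qed

text \<open>Clearing the denominator writes \<open>hecke\<close> as a combination of the identity
  and the exchange with polynomial coefficients, so that relations between Hecke operators become
  identities between permuted copies of \<open>f\<close>.\<close>

lemma X_diff_mult_hecke:
  fixes f :: "'a::field mps" and t :: 'a
  defines "T \<equiv> mscale t (1 :: 'a mps)"
  shows "(X i - X (Suc i)) * hecke t i f =
    (1 - T) * X (Suc i) * f + (T * X i - X (Suc i)) * perm (Transposition.transpose i (Suc i)) f"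
proof -
  have "(X i - X (Suc i)) * hecke t i f =
      (X i - X (Suc i)) * (T * f) + (T * X i - X (Suc i)) * ((X i - X (Suc i)) * ddiff i (Suc i) f)"
    unfolding hecke_conv_ddiff T_def
    by (simp add: mscale_conv_mult[of t f] mscale_conv_mult[of t "X i"] distrib_left ac_simps)
  also have "(X i - X (Suc i)) * ddiff i (Suc i) f = perm (Transposition.transpose i (Suc i)) f - f"
    by (simp add: ddiff swap_vars_eq_perm)
  finally show ?thesis
    by (simp add: algebra_simps)
qed

lemma perm_transpose_hecke_eq:
  fixes f :: "'a::field mps" and t :: 'a
  assumes "bij \<pi>"
  defines "T \<equiv> mscale t (1 :: 'a mps)"
  shows "(X (\<pi> i) - X (\<pi> (Suc i))) * perm \<pi> (hecke t i f) =
    (1 - T) * X (\<pi> (Suc i)) * perm \<pi> f +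
    (T * X (\<pi> i) - X (\<pi> (Suc i))) * perm (\<pi> \<circ> Transposition.transpose i (Suc i)) f"
  using arg_cong[OF X_diff_mult_hecke[of i t f], of "perm \<pi>"] assms(1)
  by (simp add: perm_mult perm_diff perm_add perm_X perm_mscale_1 perm_1 perm_comp T_def)

text \<open>Let H1 and H2 be the two operators. Then \<open>A\<close>, \<open>C\<close>,
  \<open>E\<close> are H1 f, H2 H1 f, H1 H2 H1 f, and \<open>B\<close>, \<open>D\<close>,
  \<open>F\<close> the same with H1 and H2 exchanged; \<open>s12A\<close> or \<open>f12\<close> is
  an image under the permutation s1 s2. Each hypothesis is one application of an operator with its
  denominator cleared. One side divides twice by \<open>x - y\<close> and the other twice by
  \<open>y - z\<close>, whence the two repeated factors.\<close>

lemma braid_identity: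
  fixes x y z T :: "'a::comm_ring_1"
  assumes A: "(x - y) * A = (1 - T) * y * f + (T * x - y) * f1"
    and s2A: "(x - z) * s2A = (1 - T) * z * f2 + (T * x - z) * f21"
    and s1A: "(y - x) * s1A = (1 - T) * x * f1 + (T * y - x) * f"
    and s12A: "(y - z) * s12A = (1 - T) * z * f12 + (T * y - z) * f121"
    and C: "(y - z) * C = (1 - T) * z * A + (T * y - z) * s2A"
    and s1C: "(x - z) * s1C = (1 - T) * z * s1A + (T * x - z) * s12A"
    and E: "(x - y) * E = (1 - T) * y * C + (T * x - y) * s1C"
    and B: "(y - z) * B = (1 - T) * z * f + (T * y - z) * f2"
    and s1B: "(x - z) * s1B = (1 - T) * z * f1 + (T * x - z) * f12"
    and s2B: "(z - y) * s2B = (1 - T) * y * f2 + (T * z - y) * f"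
    and s21B: "(x - y) * s21B = (1 - T) * y * f21 + (T * x - y) * f121"
    and D: "(x - y) * D = (1 - T) * y * B + (T * x - y) * s1B"
    and s2D: "(x - z) * s2D = (1 - T) * z * s2B + (T * x - z) * s21B"
    and F: "(y - z) * F = (1 - T) * z * D + (T * y - z) * s2D"
  shows "(x - y) * ((x - y) * ((x - z) * ((y - z) * ((y - z) * (E - F))))) = 0"
proof -
  have 1: "(x - y) * ((x - z) * ((y - z) * ((x - y) * E))) =
      (1 - T) * y * ((1 - T) * z * (x - z) * ((x - y) * A) + (T * y - z) * (x - y) * ((x - z) * s2A)) +
      (T * x - y) * ((1 - T) * z * (z - y) * ((y - x) * s1A) + (T * x - z) * (x - y) * ((y - z) * s12A))"
    (is "?L = ?R")
  proof -
    have "?L = (1 - T) * y * ((x - y) * ((x - z) * ((y - z) * C))) +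
        (T * x - y) * ((x - y) * ((y - z) * ((x - z) * s1C)))"
      unfolding E by (simp add: algebra_simps)
    then show ?thesis unfolding C s1C by (simp add: algebra_simps)
  qed
  have 2: "(x - y) * ((x - z) * ((y - z) * ((y - z) * F))) =
      (1 - T) * z * ((1 - T) * y * (x - z) * ((y - z) * B) + (T * x - y) * (y - z) * ((x - z) * s1B)) +
      (T * y - z) * ((1 - T) * z * (y - x) * ((z - y) * s2B) + (T * x - z) * (y - z) * ((x - y) * s21B))"
    (is "?L = ?R")
  proof -
    have "?L = (1 - T) * z * ((x - z) * ((y - z) * ((x - y) * D))) +
        (T * y - z) * ((x - y) * ((y - z) * ((x - z) * s2D)))"
      unfolding F by (simp add: algebra_simps)
    then show ?thesis unfolding D s2D by (simp add: algebra_simps)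
  qed
  have "(x - y) * ((x - y) * ((x - z) * ((y - z) * ((y - z) * (E - F))))) =
      (y - z) * ((x - y) * ((x - z) * ((y - z) * ((x - y) * E)))) -
      (x - y) * ((x - y) * ((x - z) * ((y - z) * ((y - z) * F))))"
    by (simp add: algebra_simps)
  also have "(y - z) * ((x - y) * ((x - z) * ((y - z) * ((x - y) * E)))) =
      (x - y) * ((x - y) * ((x - z) * ((y - z) * ((y - z) * F))))"
    unfolding 1 2 A s2A s1A s12A B s1B s2B s21B by (simp add: algebra_simps)
  finally show ?thesis by simp
qed

abbreviation adj :: "nat \<Rightarrow> nat \<Rightarrow> nat" where "adj i \<equiv> Transposition.transpose i (Suc i)"

lemma bij_adj: "bij (adj i)"
  by simp

lemma hecke_braid:
  fixes f :: "'a::field mps"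
  shows "hecke t i (hecke t (Suc i) (hecke t i f)) = hecke t (Suc i) (hecke t i (hecke t (Suc i) f))"
proof -
  define s1 where "s1 = adj i"
  define s2 where "s2 = adj (Suc i)"
  have b: "bij s1" "bij s2" "bij (s1 \<circ> s2)" "bij (s2 \<circ> s1)"
    by (auto simp: s1_def s2_def bij_comp)
  have v1: "s1 i = Suc i" "s1 (Suc i) = i" "s1 (Suc (Suc i)) = Suc (Suc i)"
    by (auto simp: s1_def transpose_def)
  have v2: "s2 i = i" "s2 (Suc i) = Suc (Suc i)" "s2 (Suc (Suc i)) = Suc i"
    by (auto simp: s2_def transpose_def)
  have v12: "(s1 \<circ> s2) i = Suc i" "(s1 \<circ> s2) (Suc i) = Suc (Suc i)"
    and v21: "(s2 \<circ> s1) (Suc i) = i" "(s2 \<circ> s1) (Suc (Suc i)) = Suc i"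
    by (auto simp: v1 v2)
  have 22: "perm (s2 \<circ> s2) g = g" for g :: "'a mps"
    by (simp add: s2_def o_def perm_id)
  have 11: "perm (s1 \<circ> s1) g = g" for g :: "'a mps"
    by (simp add: s1_def o_def perm_id)
  \<comment> \<open>The braid relation of the permutations makes both sides end in the same series
    \<open>f121\<close>.\<close>
  have 121: "s2 \<circ> s1 \<circ> s2 = s1 \<circ> s2 \<circ> s1"
    by (auto simp: fun_eq_iff s1_def s2_def transpose_def)
  note h1 = X_diff_mult_hecke[of i t, folded s1_def]
  note h2 = X_diff_mult_hecke[of "Suc i" t, folded s2_def]
  note p1 = perm_transpose_hecke_eq[where i = i and t = t, folded s1_def]
  note p2 = perm_transpose_hecke_eq[where i = "Suc i" and t = t, folded s2_def]
  let ?A = "hecke t i f" and ?B = "hecke t (Suc i) f"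
  let ?C = "hecke t (Suc i) ?A" and ?D = "hecke t i ?B"
  let ?x = "X i :: 'a mps" and ?y = "X (Suc i) :: 'a mps" and ?z = "X (Suc (Suc i)) :: 'a mps"
  have "(?x - ?y) * ((?x - ?y) * ((?x - ?z) * ((?y - ?z) * ((?y - ?z) * (hecke t i ?C - hecke t (Suc i) ?D))))) = 0"
    by (rule braid_identity[OF h1 p1[OF b(2), of f, unfolded v2] p1[OF b(1), of f, unfolded v1 11]
          p1[OF b(3), of f, unfolded v12] h2 p2[OF b(1), of ?A, unfolded v1] h1
          h2 p2[OF b(1), of f, unfolded v1] p2[OF b(2), of f, unfolded v2 22]
          p2[OF b(4), of f, unfolded v21 121] h1 p1[OF b(2), of ?B, unfolded v2] h2])
  then have "hecke t i ?C - hecke t (Suc i) ?D = 0"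
    by (auto dest!: X_diff_mult_eq_0D[rotated])
  then show ?thesis by simp
qed

lemma hecke_commute:
  fixes f :: "'a::field mps"
  assumes "Suc i < j"
  shows "hecke t i (hecke t j f) = hecke t j (hecke t i f)"
proof -
  have v: "adj i j = j" "adj i (Suc j) = Suc j" "adj j i = i" "adj j (Suc i) = Suc i"
    using assms by (auto simp: transpose_def)
  have c: "adj j \<circ> adj i = adj i \<circ> adj j"
    using assms by (auto simp: fun_eq_iff transpose_def)
  note p = perm_transpose_hecke_eq[OF bij_adj, where f = f and t = t]
  define T where "T = mscale t (1 :: 'a mps)"
  let ?x = "X i :: 'a mps" and ?y = "X (Suc i) :: 'a mps"
  let ?u = "X j :: 'a mps" and ?v = "X (Suc j) :: 'a mps"
  have "(?x - ?y) * ((?u - ?v) * hecke t i (hecke t j f)) =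
      (?u - ?v) * ((?x - ?y) * hecke t i (hecke t j f))"
    by (simp only: ac_simps)
  also have "\<dots> = (1 - T) * ?y * ((?u - ?v) * hecke t j f) +
      (T * ?x - ?y) * ((?u - ?v) * perm (adj i) (hecke t j f))"
    unfolding X_diff_mult_hecke[of i t "hecke t j f"] T_def[symmetric]
    by (simp add: algebra_simps)
  also have "\<dots> = (1 - T) * ?v * ((?x - ?y) * hecke t i f) +
      (T * ?u - ?v) * ((?x - ?y) * perm (adj j) (hecke t i f))"
    unfolding X_diff_mult_hecke[where f = f] p[of i j, unfolded v] p[of j i, unfolded v c] T_def
    by (simp add: algebra_simps)
  also have "\<dots> = (?x - ?y) * ((?u - ?v) * hecke t j (hecke t i f))"
    unfolding X_diff_mult_hecke[of j t "hecke t i f"] T_def[symmetric]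
    by (simp add: algebra_simps)
  finally show ?thesis
    by (auto dest!: X_diff_mult_cancel)
qed

section \<open>Independence of \<open>H_fun\<close> from the chosen sequence of exchanges\<close>

definition swap_adj :: "nat list \<Rightarrow> nat \<Rightarrow> nat list"
  where "swap_adj a i = a[i := a ! Suc i, Suc i := a ! i]"

lemma length_swap_adj [simp]: "length (swap_adj a i) = length a"
  by (simp add: swap_adj_def)

lemma nth_swap_adj: "Suc i < length a \<Longrightarrow> k < length a \<Longrightarrow> swap_adj a i ! k = a ! adj i k"
  by (auto simp: swap_adj_def nth_list_update transpose_def)

lemma adj_less: "Suc i < n \<Longrightarrow> k < n \<Longrightarrow> adj i k < n"
  by (auto simp: transpose_def)

lemma swap_adj_swap_adj: "Suc i < length a \<Longrightarrow> swap_adj (swap_adj a i) i = a"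
  by (rule nth_equalityI) (auto simp: nth_swap_adj adj_less)

text \<open>The introduction rules read backwards: the last exchange leading to \<open>a\<close>
  sits at an ascent of \<open>a\<close>, and undoing it sorts that ascent.\<close>

lemma is_H_iff:
  "is_H t a f \<longleftrightarrow> (dominant a \<and> f = x_pow a) \<or>
    (\<exists>i g. Suc i < length a \<and> a ! i < a ! Suc i \<and> is_H t (swap_adj a i) g \<and> f = hecke t i g)"
  (is "?L \<longleftrightarrow> ?D \<or> ?R")
proof
  assume ?L
  then show "?D \<or> ?R"
  proof cases
    case (hecke b g i)
    have [simp]: "swap_adj (b[i := b ! Suc i, Suc i := b ! i]) i = b"
      using swap_adj_swap_adj[of i b] hecke by (simp add: swap_adj_def)
    show ?thesis using hecke
      by (intro disjI2 exI[of _ i] exI[of _ g]) auto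
  qed auto
next
  assume "?D \<or> ?R"
  then show ?L
  proof
    assume ?R
    then obtain i g where *: "Suc i < length a" "a ! i < a ! Suc i" "is_H t (swap_adj a i) g" "f = hecke t i g"
      by blast
    show ?L
      using is_H.hecke[OF *(3), of i, folded swap_adj_def] * swap_adj_swap_adj[OF *(1)]
      by (simp add: nth_swap_adj)
  qed (auto intro: is_H.dominant)
qed

lemma is_H_step:
  "Suc i < length a \<Longrightarrow> a ! i < a ! Suc i \<Longrightarrow> is_H t (swap_adj a i) g \<Longrightarrow> is_H t a (hecke t i g)"
  by (subst is_H_iff) blast

text \<open>Termination measure: sorting an ascent moves the larger entry to the smaller
  weight.\<close>

definition list_moment :: "nat list \<Rightarrow> nat"
  where "list_moment a = (\<Sum>k<length a. k * a ! k)"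

lemma list_moment_swap_adj:
  assumes "Suc i < length a" "a ! i < a ! Suc i"
  shows "list_moment (swap_adj a i) < list_moment a"
proof -
  let ?I = "{..<length a} - {i, Suc i}"
  have *: "list_moment b = (\<Sum>k\<in>?I. k * b ! k) + (i * b ! i + Suc i * b ! Suc i)"
    if "length b = length a" for b
  proof -
    have "{..<length a} = ?I \<union> {i, Suc i}" using assms by auto
    then have "list_moment b = (\<Sum>k\<in>?I \<union> {i, Suc i}. k * b ! k)"
      unfolding list_moment_def that by simp
    also have "\<dots> = (\<Sum>k\<in>?I. k * b ! k) + (\<Sum>k\<in>{i, Suc i}. k * b ! k)"
      by (rule sum.union_disjoint) auto
    finally show ?thesis by simp
  qed
  have "(\<Sum>k\<in>?I. k * swap_adj a i ! k) = (\<Sum>k\<in>?I. k * a ! k)"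
    using assms by (intro sum.cong) (auto simp: nth_swap_adj transpose_def)
  then show ?thesis
    using assms by (simp add: * nth_swap_adj)
qed

lemma dominant_iff: "dominant a \<longleftrightarrow> (\<forall>i. Suc i < length a \<longrightarrow> a ! Suc i \<le> a ! i)"
  unfolding dominant_def by (subst sorted_wrt_iff_nth_Suc_transp) (auto simp: transp_def)

lemma is_H_exists: "\<exists>f. is_H t a f"
proof (induction "list_moment a" arbitrary: a rule: less_induct)
  case less
  show ?case
  proof (cases "dominant a")
    case False
    then obtain i where "Suc i < length a" "a ! i < a ! Suc i"
      by (auto simp: dominant_iff not_le)
    then show ?thesis using less[of "swap_adj a i"] is_H_step list_moment_swap_adj by blast
  qed (auto intro: is_H.dominant)
qed

text \<open>
  By induction it suffices to compare two different last steps \<open>i < j\<close>. Their predecessors have a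
  common ancestor, two or three steps above \<open>a\<close>, and the two ways down agree by the braid relations.
\<close>

lemma is_H_unique: "is_H t a f \<Longrightarrow> is_H t a f' \<Longrightarrow> f = f'"
proof (induction "list_moment a" arbitrary: a f f' rule: less_induct)
  case less
  have IH: "g = g'" if "is_H t (swap_adj a i) g" "is_H t (swap_adj a i) g'"
    "Suc i < length a" "a ! i < a ! Suc i" for i g g'
    using less.hyps list_moment_swap_adj that by blast
  have key: "hecke t i g = hecke t j g'"
    if i: "Suc i < length a" "a ! i < a ! Suc i" "is_H t (swap_adj a i) g"
    and j: "Suc j < length a" "a ! j < a ! Suc j" "is_H t (swap_adj a j) g'"
    and ij: "i < j" for i j g g'
  proof (cases "j = Suc i")
    case True
    define b where "b = swap_adj (swap_adj (swap_adj a i) (Suc i)) i"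
    have b': "b = swap_adj (swap_adj (swap_adj a (Suc i)) i) (Suc i)"
      using i j True unfolding b_def
      by (intro nth_equalityI) (auto simp: nth_swap_adj adj_less, auto simp: transpose_def)
    obtain h where h: "is_H t b h" using is_H_exists by blast
    have "is_H t (swap_adj a i) (hecke t (Suc i) (hecke t i h))"
      using h i j True unfolding b_def
      by (intro is_H_step) (auto simp: nth_swap_adj transpose_def)
    then have g: "g = hecke t (Suc i) (hecke t i h)" using IH i by blast
    have "is_H t (swap_adj a j) (hecke t i (hecke t (Suc i) h))"
      using h i j unfolding b' True
      by (intro is_H_step) (auto simp: nth_swap_adj transpose_def)
    then have g': "g' = hecke t i (hecke t (Suc i) h)" using IH j by blast
    show ?thesis unfolding g g' True by (rule hecke_braid)
  next
    case False
    then have ij': "Suc i < j" using ij by simp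
    define b where "b = swap_adj (swap_adj a i) j"
    have b': "b = swap_adj (swap_adj a j) i"
      using i j ij' unfolding b_def
      by (intro nth_equalityI) (auto simp: nth_swap_adj adj_less, auto simp: transpose_def)
    obtain h where h: "is_H t b h" using is_H_exists by blast
    have "is_H t (swap_adj a i) (hecke t j h)"
      using h i j ij' unfolding b_def
      by (intro is_H_step) (auto simp: nth_swap_adj transpose_def)
    then have g: "g = hecke t j h" using IH i by blast
    have "is_H t (swap_adj a j) (hecke t i h)"
      using h i j ij' unfolding b'
      by (intro is_H_step) (auto simp: nth_swap_adj transpose_def)
    then have g': "g' = hecke t i h" using IH j by blast
    show ?thesis unfolding g g' by (rule hecke_commute[OF ij'])
  qed
  show ?case
  proof (cases "dominant a")
    case True
    then show ?thesis using less.prems by (subst (asm) (1 2) is_H_iff) (auto simp: dominant_iff not_le)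
  next
    case False
    then obtain i j g g' where *:
      "Suc i < length a" "a ! i < a ! Suc i" "is_H t (swap_adj a i) g" "f = hecke t i g"
      "Suc j < length a" "a ! j < a ! Suc j" "is_H t (swap_adj a j) g'" "f' = hecke t j g'"
      using less.prems by (subst (asm) (1 2) is_H_iff) blast
    then show ?thesis
      using key[of i g j g'] key[of j g' i g] IH[of i g g'] by (metis linorder_less_linear)
  qed
qed

lemma is_H_H_fun: "is_H t a (H_fun t a)"
  unfolding H_fun_def by (rule theI') (use is_H_exists is_H_unique in blast)

section \<open>Coefficientwise limits of power series\<close>

lemma mps_limit_t1I: "(\<And>\<alpha>. has_limit_t1 (mcoeff F \<alpha>) (mcoeff G \<alpha>)) \<Longrightarrow> mps_limit_t1 F G"
  by (simp add: mps_limit_t1_def)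

lemma mps_limit_t1D: "mps_limit_t1 F G \<Longrightarrow> has_limit_t1 (mcoeff F \<alpha>) (mcoeff G \<alpha>)"
  by (simp add: mps_limit_t1_def)

lemma mps_limit_t1_add: "mps_limit_t1 F F' \<Longrightarrow> mps_limit_t1 G G' \<Longrightarrow> mps_limit_t1 (F + G) (F' + G')"
  by (simp add: mps_limit_t1_def has_limit_t1_add)

lemma mps_limit_t1_diff: "mps_limit_t1 F F' \<Longrightarrow> mps_limit_t1 G G' \<Longrightarrow> mps_limit_t1 (F - G) (F' - G')"
  by (simp add: mps_limit_t1_def has_limit_t1_diff)

lemma mps_limit_t1_mscale: "has_limit_t1 c c' \<Longrightarrow> mps_limit_t1 F F' \<Longrightarrow> mps_limit_t1 (mscale c F) (mscale c' F')"
  by (simp add: mps_limit_t1_def has_limit_t1_mult)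

lemma mps_limit_t1_mult: "mps_limit_t1 F F' \<Longrightarrow> mps_limit_t1 G G' \<Longrightarrow> mps_limit_t1 (F * G) (F' * G')"
  by (auto simp: mps_limit_t1_def mcoeff_mult case_prod_unfold intro!: has_limit_t1_sum has_limit_t1_mult)

lemma mps_limit_t1_sum:
  "(\<And>i. i \<in> I \<Longrightarrow> mps_limit_t1 (F i) (F' i)) \<Longrightarrow> mps_limit_t1 (\<Sum>i\<in>I. F i) (\<Sum>i\<in>I. F' i)"
  by (auto simp: mps_limit_t1_def intro!: has_limit_t1_sum)

lemma mps_limit_t1_mono: "mps_limit_t1 (monomial_mps \<alpha>) (monomial_mps \<alpha>)"
  by (simp add: mps_limit_t1_def mcoeff_mono)

lemma mps_limit_t1_1: "mps_limit_t1 1 1"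
  using mps_limit_t1_mono[of 0] by simp

lemma mps_limit_t1_prod:
  "(\<And>i. i \<in> I \<Longrightarrow> mps_limit_t1 (F i) (F' i)) \<Longrightarrow> mps_limit_t1 (\<Prod>i\<in>I. F i) (\<Prod>i\<in>I. F' i)"
  by (induction I rule: infinite_finite_induct) (auto intro: mps_limit_t1_1 mps_limit_t1_mult)

lemma mps_limit_t1_prod_mset:
  "(\<And>i. i \<in># M \<Longrightarrow> mps_limit_t1 (F i) (F' i)) \<Longrightarrow> mps_limit_t1 (\<Prod>i\<in>#M. F i) (\<Prod>i\<in>#M. F' i)"
  by (induction M) (auto intro: mps_limit_t1_1 mps_limit_t1_mult)

lemma mps_limit_t1_x_pow: "mps_limit_t1 (x_pow a) (x_pow a)"
  unfolding x_pow_def X_power_conv_mono by (intro mps_limit_t1_prod mps_limit_t1_mono)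

lemma mps_limit_t1_p_sym: "mps_limit_t1 (p_sym \<mu>) (p_sym \<mu>)"
  unfolding p_sym_def
  by (intro mps_limit_t1_prod_mset) (simp add: mps_limit_t1_def power_sum_def)

text \<open>At \<open>t = 1\<close> the factor in front of \<open>ddiff\<close> becomes its own
  denominator, so the operator degenerates to the exchange of variables. The limit passes through
  \<open>ddiff\<close> because each of its coefficients is a finite sum.\<close>

lemma mps_limit_t1_hecke:
  assumes "mps_limit_t1 F G"
  shows "mps_limit_t1 (hecke t_Qqt i F) (perm (adj i) G)"
proof -
  have swap: "mps_limit_t1 (swap_vars i (Suc i) F) (swap_vars i (Suc i) G)"
    using assms by (simp add: mps_limit_t1_def swap_vars_def)
  have dd: "mps_limit_t1 (ddiff i (Suc i) F) (ddiff i (Suc i) G)"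
    unfolding mps_limit_t1_def ddiff_def mcoeff_Abs_mps
    using mps_limit_t1D[OF mps_limit_t1_diff[OF swap assms]] by (auto intro: has_limit_t1_sum)
  have "mps_limit_t1 (hecke t_Qqt i F)
      (mscale 1 G + (mscale 1 (X i) - X (Suc i)) * ddiff i (Suc i) G)"
    unfolding hecke_conv_ddiff X_conv_mono
    by (intro mps_limit_t1_add mps_limit_t1_mult mps_limit_t1_diff mps_limit_t1_mscale
        mps_limit_t1_mono has_limit_t1_t dd assms)
  then show ?thesis
    by (simp add: ddiff swap_vars_eq_perm)
qed

section \<open>Linear independence and coordinates\<close>

text \<open>Stated for families, so that a repeated member counts as a relation; injectivity, which
  \<open>coord\<close> relies on, thereby comes for free.\<close>

definition indep_fam :: "'i set \<Rightarrow> ('i \<Rightarrow> 'a::field mps) \<Rightarrow> bool"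
  where "indep_fam I b \<longleftrightarrow>
    (\<forall>J e. finite J \<longrightarrow> J \<subseteq> I \<longrightarrow> (\<Sum>i\<in>J. mscale (e i) (b i)) = 0 \<longrightarrow> (\<forall>i\<in>J. e i = 0))"

lemma indep_famD:
  "indep_fam I b \<Longrightarrow> finite J \<Longrightarrow> J \<subseteq> I \<Longrightarrow> (\<Sum>i\<in>J. mscale (e i) (b i)) = 0 \<Longrightarrow> i \<in> J \<Longrightarrow> e i = 0"
  unfolding indep_fam_def by blast

lemma indep_fam_subset: "indep_fam I b \<Longrightarrow> I' \<subseteq> I \<Longrightarrow> indep_fam I' b"
  unfolding indep_fam_def by (meson order_trans)

lemma indep_fam_inj: 
  assumes "indep_fam I b"
  shows "inj_on b I"
proof (rule inj_onI, rule ccontr)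
  fix i j assume *: "i \<in> I" "j \<in> I" "b i = b j" "i \<noteq> j"
  have "(\<Sum>k\<in>{i, j}. mscale (if k = i then 1 else -1) (b k)) = 0"
    using * by (auto simp: mps_eq_iff)
  from indep_famD[OF assms _ _ this, of i] * show False by simp
qed

lemma indep_fam_eqD:
  assumes "indep_fam I b" "finite J" "J \<subseteq> I"
    and "(\<Sum>i\<in>J. mscale (v i) (b i)) = (\<Sum>i\<in>J. mscale (w i) (b i))" "i \<in> J"
  shows "v i = w i"
proof -
  have "(\<Sum>i\<in>J. mscale (v i - w i) (b i)) = 0"
    using assms(4) by (simp add: mps.scale_left_diff_distrib sum_subtractf)
  then show ?thesis using indep_famD[OF assms(1-3) _ assms(5), of "\<lambda>i. v i - w i"] by simp
qed

lemma indep_fam_independent: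
  assumes "indep_fam I b"
  shows "mps.independent (b ` I)"
proof
  assume "mps.dependent (b ` I)"
  then obtain T u v where *: "finite T" "T \<subseteq> b ` I" "(\<Sum>v\<in>T. mscale (u v) v) = 0" "v \<in> T" "u v \<noteq> 0"
    unfolding mps.dependent_explicit by blast
  obtain J where J: "J \<subseteq> I" "finite J" "T = b ` J"
    using *(1,2) by (meson finite_subset_image)
  have "inj_on b J"
    using indep_fam_inj[OF assms] J inj_on_subset by blast
  then have "(\<Sum>i\<in>J. mscale (u (b i)) (b i)) = 0"
    using *(3) J by (simp add: sum.reindex)
  then show False
    using indep_famD[OF assms J(2,1), of "\<lambda>i. u (b i)"] *(4,5) J by auto
qed

text \<open>By independence any finite expansion may stand in for the canonical one of
  \<open>representation\<close>, so later computations with \<open>diag_map\<close> and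
  \<open>diag_form\<close> only handle explicit expansions.\<close>

lemma coord_eq:
  assumes "indep_fam I b" "finite J" "J \<subseteq> I" "i \<in> I" "f = (\<Sum>i\<in>J. mscale (w i) (b i))"
  shows "coord I b f i = (if i \<in> J then w i else 0)"
proof -
  note ind = indep_fam_independent[OF assms(1)]
  have inj: "inj_on b I" by (rule indep_fam_inj[OF assms(1)])
  have bs: "b j \<in> mps.span (b ` I)" if "j \<in> J" for j
    using that assms(3) by (auto intro: mps.span_base)
  have "coord I b f i = (\<Sum>j\<in>J. mps.representation (b ` I) (mscale (w j) (b j)) (b i))"
    unfolding coord_def assms(5)
    by (subst mps.representation_sum[OF ind]) (auto intro: mps.span_scale bs)
  also have "\<dots> = (\<Sum>j\<in>J. if j = i then w j else 0)"
  proof (rule sum.cong)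
    fix j assume "j \<in> J"
    then have "b i = b j \<longleftrightarrow> i = j" using inj assms(3,4) by (auto dest: inj_onD)
    then show "mps.representation (b ` I) (mscale (w j) (b j)) (b i) = (if j = i then w j else 0)"
      using \<open>j \<in> J\<close> assms(3) by (subst mps.representation_scale[OF ind bs])
        (auto simp: mps.representation_basis[OF ind])
  qed auto
  also have "\<dots> = (if i \<in> J then w i else 0)"
    using assms(2) by simp
  finally show ?thesis .
qed

lemma diag_map_eq:
  assumes "indep_fam I b" "finite J" "J \<subseteq> I"
  shows "diag_map I b v (\<Sum>i\<in>J. mscale (w i) (b i)) = (\<Sum>i\<in>J. mscale (w i * v i) (b i))"
proof -
  have "diag_map I b v (\<Sum>i\<in>J. mscale (w i) (b i)) =
      (\<Sum>i | i \<in> I \<and> (if i \<in> J then w i else 0) \<noteq> 0. mscale ((if i \<in> J then w i else 0) * v i) (b i))"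
    unfolding diag_map_def using coord_eq[OF assms(1-3) _ refl, of _ w]
    by (intro sum.cong) (auto split: if_splits)
  also have "\<dots> = (\<Sum>i\<in>J. mscale (w i * v i) (b i))"
    using assms(2,3) by (intro sum.mono_neutral_cong_left) (auto split: if_splits)
  finally show ?thesis .
qed

lemma diag_form_eq:
  assumes "indep_fam I b" "finite J" "J \<subseteq> I"
  shows "diag_form I b v (\<Sum>i\<in>J. mscale (w i) (b i)) (\<Sum>i\<in>J. mscale (w' i) (b i)) =
    (\<Sum>i\<in>J. w i * w' i * v i)"
proof -
  have "diag_form I b v (\<Sum>i\<in>J. mscale (w i) (b i)) (\<Sum>i\<in>J. mscale (w' i) (b i)) =
      (\<Sum>i | i \<in> I \<and> (if i \<in> J then w i else 0) \<noteq> 0.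
        (if i \<in> J then w i else 0) * (if i \<in> J then w' i else 0) * v i)"
    unfolding diag_form_def
    using coord_eq[OF assms(1-3) _ refl, of _ w] coord_eq[OF assms(1-3) _ refl, of _ w']
    by (intro sum.cong) (auto split: if_splits)
  also have "\<dots> = (\<Sum>i\<in>J. w i * w' i * v i)"
    using assms(2,3) by (intro sum.mono_neutral_cong_left) (auto split: if_splits)
  finally show ?thesis .
qed

lemma sum_mscale_in_span: "(\<And>i. i \<in> J \<Longrightarrow> b i \<in> mps.span S) \<Longrightarrow> (\<Sum>i\<in>J. mscale (w i) (b i)) \<in> mps.span S"
  by (intro mps.span_sum mps.span_scale) auto

lemma span_image_explicit:
  assumes "finite I" "f \<in> mps.span (b ` I)"
  obtains w where "f = (\<Sum>i\<in>I. mscale (w i) (b i))"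
proof -
  have "\<exists>w. f = (\<Sum>i\<in>I. mscale (w i) (b i))"
    using assms(2)
  proof (induction rule: mps.span_induct_alt)
    case base
    show ?case by (rule exI[of _ "\<lambda>_. 0"]) simp
  next
    case (step c x y)
    then obtain i w where i: "i \<in> I" "x = b i" and w: "y = (\<Sum>i\<in>I. mscale (w i) (b i))" by auto
    have "mscale c x = (\<Sum>j\<in>I. mscale (if j = i then c else 0) (b j))"
      using i assms(1) by (simp add: if_distrib[of "\<lambda>c. mscale c _"] cong: if_cong)
    then show ?case unfolding w
      by (intro exI[of _ "\<lambda>j. (if j = i then c else 0) + w j"])
         (simp add: mps.scale_left_distrib sum.distrib)
  qed
  then show ?thesis using that by blast
qed

text \<open>Inverts a change of basis by counting: if some \<open>c j\<close> were outside the span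
  of the \<open>b i\<close>, adjoining it would give more independent vectors than the span of the
  \<open>c i\<close> can hold.\<close>

lemma indep_fam_span_exchange:
  assumes "finite I" "indep_fam I b" "\<And>i. i \<in> I \<Longrightarrow> b i \<in> mps.span (c ` I)" "j \<in> I"
  shows "c j \<in> mps.span (b ` I)"
proof (rule ccontr)
  assume "c j \<notin> mps.span (b ` I)"
  then have "mps.independent (insert (c j) (b ` I))" "c j \<notin> b ` I"
    using indep_fam_independent[OF assms(2)] by (auto simp: mps.independent_insert mps.span_base)
  moreover have "insert (c j) (b ` I) \<subseteq> mps.span (c ` I)"
    using assms(3,4) by (auto intro: mps.span_base)
  ultimately have "card (insert (c j) (b ` I)) \<le> card (c ` I)"
    using mps.independent_span_bound[of "c ` I"] assms(1) by blast
  moreover have "card (insert (c j) (b ` I)) = Suc (card I)"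
    using assms(1) \<open>c j \<notin> b ` I\<close> by (simp add: card_image[OF indep_fam_inj[OF assms(2)]])
  moreover have "card (c ` I) \<le> card I" by (rule card_image_le[OF assms(1)])
  ultimately show False by simp
qed

text \<open>By \<open>has_limit_t1_solution\<close>, the coefficients of any multiple of a relation
  tend to those of a relation of the limit family, hence to 0. A nonzero coefficient cannot do so
  for all its multiples, since one of them is 1.\<close>

lemma indep_fam_limit:
  assumes "\<And>i. i \<in> I \<Longrightarrow> mps_limit_t1 (b i) (b' i)" "indep_fam I b'"
  shows "indep_fam I b"
  unfolding indep_fam_def
proof (intro allI impI)
  fix J and e :: "'a \<Rightarrow> Qqt"
  assume J: "finite J" "J \<subseteq> I" and 0: "(\<Sum>i\<in>J. mscale (e i) (b i)) = 0"
  show "\<forall>i\<in>J. e i = 0"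
  proof (rule ccontr)
    assume "\<not> (\<forall>i\<in>J. e i = 0)"
    then obtain i0 where i0: "i0 \<in> J" "e i0 \<noteq> 0" by blast
    have lim: "\<forall>i\<in>J. has_limit_t1 (r * e i) 0" for r
    proof -
      have "\<forall>i\<in>J. w i = 0" if "\<And>\<alpha>. (\<Sum>i\<in>J. w i * mcoeff (b' i) \<alpha>) = 0" for w
        using indep_famD[OF assms(2) J, of w] that by (auto simp: mps_eq_iff)
      moreover have "(\<Sum>i\<in>J. r * e i * mcoeff (b i) \<alpha>) = 0" for \<alpha>
        using arg_cong[OF 0, of "\<lambda>f. r * mcoeff f \<alpha>"] by (simp add: sum_distrib_left mult.assoc)
      ultimately obtain w' where w': "\<And>i. i \<in> J \<Longrightarrow> has_limit_t1 (r * e i) (w' i)"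
          "\<And>\<alpha>. (\<Sum>i\<in>J. w' i * mcoeff (b' i) \<alpha>) = 0"
        using has_limit_t1_solution[of J "\<lambda>i. mcoeff (b i)" "\<lambda>i. mcoeff (b' i)" "\<lambda>i. r * e i" "\<lambda>_. 0" "\<lambda>_. 0",
            OF J(1) mps_limit_t1D[OF assms(1)[OF subsetD[OF J(2)]]] _ _ has_limit_t1_0] by blast
      have "(\<Sum>i\<in>J. mscale (w' i) (b' i)) = 0"
        using w'(2) by (auto simp: mps_eq_iff)
      then have "\<forall>i\<in>J. w' i = 0" using indep_famD[OF assms(2) J] by blast
      then show ?thesis using w'(1) by fastforce
    qed
    from lim[of "inverse (e i0)"] i0 have "has_limit_t1 1 0" by auto
    then show False using has_limit_t1_unique[OF has_limit_t1_1] by fastforce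
  qed
qed

text \<open>Here \<open>has_limit_t1_solution\<close> is applied with one equation for each
  exponent.\<close>

lemma coeffs_limit:
  assumes "finite J" "\<And>i. i \<in> J \<Longrightarrow> mps_limit_t1 (b i) (b' i)" "indep_fam J b'"
    and "mps_limit_t1 (\<Sum>i\<in>J. mscale (w i) (b i)) F"
  obtains w' where "\<And>i. i \<in> J \<Longrightarrow> has_limit_t1 (w i) (w' i)" "F = (\<Sum>i\<in>J. mscale (w' i) (b' i))"
proof -
  have ind: "\<forall>i\<in>J. w i = 0" if "\<And>\<alpha>. (\<Sum>i\<in>J. w i * mcoeff (b' i) \<alpha>) = 0" for w
    using indep_famD[OF assms(3,1), of w] that by (auto simp: mps_eq_iff)
  obtain w' where w': "\<And>i. i \<in> J \<Longrightarrow> has_limit_t1 (w i) (w' i)"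
      "\<And>\<alpha>. (\<Sum>i\<in>J. w' i * mcoeff (b' i) \<alpha>) = mcoeff F \<alpha>"
    using has_limit_t1_solution[of J "\<lambda>i. mcoeff (b i)" "\<lambda>i. mcoeff (b' i)" w
        "mcoeff (\<Sum>i\<in>J. mscale (w i) (b i))" "mcoeff F",
        OF assms(1) mps_limit_t1D[OF assms(2)] ind _ mps_limit_t1D[OF assms(4)]] by auto
  then show ?thesis using that[of w'] by (simp add: mps_eq_iff)
qed

section \<open>Nonsymmetric Hall-Littlewood polynomials\<close>

definition expo :: "nat list \<Rightarrow> (nat \<Rightarrow>\<^sub>0 nat)"
  where "expo a = (\<Sum>i<length a. single i (a ! i))"

lemma lookup_expo: "lookup (expo a) k = (if k < length a then a ! k else 0)"
  by (simp add: expo_def lookup_sum lookup_single when_def)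

lemma x_pow_conv_mono: "x_pow a = monomial_mps (expo a)"
proof -
  have "(\<Prod>i<n. X i ^ (a ! i)) = monomial_mps (\<Sum>i<n. single i (a ! i))" for n
    by (induction n) (auto simp: mono_add X_power_conv_mono mult.commute)
  then show ?thesis by (simp add: x_pow_def expo_def)
qed

lemma mdeg_0 [simp]: "mdeg 0 = 0"
  by (simp add: mdeg_def)

lemma mdeg_expo: "mdeg (expo a) = sum_list a"
proof -
  have "mdeg (\<Sum>i<n. single i (a ! i)) = (\<Sum>i<n. a ! i)" for n
    by (induction n) (auto simp: mdeg_add)
  then show ?thesis by (simp add: expo_def sum_list_sum_nth lessThan_atLeast0)
qed

lemma expo_eqI: "keys \<alpha> \<subseteq> {..<m} \<Longrightarrow> \<alpha> = expo (map (lookup \<alpha>) [0..<m])"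
  by (rule poly_mapping_eqI) (auto simp: lookup_expo in_keys_iff subset_iff)

lemma expo_inject: "length a = length b \<Longrightarrow> expo a = expo b \<longleftrightarrow> a = b"
proof
  assume "length a = length b" "expo a = expo b"
  then show "a = b" using lookup_expo[of a] lookup_expo[of b]
    by (intro nth_equalityI) (metis (no_types))+
qed auto

text \<open>With \<open>A = {..<m}\<close> these are forms in the distinguished variables, a space
  of finite dimension; with \<open>A = UNIV\<close> only the degree is controlled.\<close>

definition homog :: "nat set \<Rightarrow> nat \<Rightarrow> 'a::field mps \<Rightarrow> bool"
  where "homog A n f \<longleftrightarrow> (\<forall>\<alpha>. mcoeff f \<alpha> \<noteq> 0 \<longrightarrow> keys \<alpha> \<subseteq> A \<and> mdeg \<alpha> = n)"

lemma homog_add: "homog A n f \<Longrightarrow> homog A n g \<Longrightarrow> homog A n (f + g)"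
  unfolding homog_def by (metis add.right_neutral mcoeff_add)

lemma homog_diff: "homog A n f \<Longrightarrow> homog A n g \<Longrightarrow> homog A n (f - g)"
  unfolding homog_def by (metis diff_0_right mcoeff_diff)

lemma homog_mscale: "homog A n f \<Longrightarrow> homog A n (mscale c f)"
  unfolding homog_def by auto

lemma homog_mult:
  assumes "homog A n f" "homog A k g"
  shows "homog A (n + k) (f * g)"
  unfolding homog_def
proof (intro allI impI)
  fix \<alpha> assume "mcoeff (f * g) \<alpha> \<noteq> 0"
  then obtain p where p: "p \<in> {(\<beta>, \<gamma>). \<beta> + \<gamma> = \<alpha>}" "(case p of (\<beta>, \<gamma>) \<Rightarrow> mcoeff f \<beta> * mcoeff g \<gamma>) \<noteq> 0"
    unfolding mcoeff_mult by (meson sum.not_neutral_contains_not_neutral)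
  then show "keys \<alpha> \<subseteq> A \<and> mdeg \<alpha> = n + k"
    using assms unfolding homog_def by (fastforce simp: mdeg_add keys_plus_nat)
qed

lemma homog_mono: "homog A n (monomial_mps \<alpha>) \<longleftrightarrow> keys \<alpha> \<subseteq> A \<and> mdeg \<alpha> = n"
  by (auto simp: homog_def mcoeff_mono)

lemma homog_x_pow: "homog {..<length a} (sum_list a) (x_pow a)"
  unfolding x_pow_conv_mono homog_mono by (auto simp: mdeg_expo in_keys_iff lookup_expo split: if_splits)

lemma homog_perm:
  assumes "bij \<pi>" "\<And>i. \<pi> i \<in> A \<longleftrightarrow> i \<in> A" "homog A n f"
  shows "homog A n (perm \<pi> f)"
  unfolding homog_def mcoeff_perm
proof (intro allI impI)
  fix \<alpha> assume *: "mcoeff f (map_key \<pi> \<alpha>) \<noteq> 0"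
  have inj: "inj \<pi>" using assms(1) by (rule bij_is_inj)
  have k: "keys (map_key \<pi> \<alpha>) = \<pi> -` keys \<alpha>" by (rule keys_map_key[OF inj])
  have "bij_betw \<pi> (\<pi> -` keys \<alpha>) (keys \<alpha>)"
    using assms(1) by (auto simp: bij_betw_def surj_image_vimage_eq inj_on_def bij_def)
  then have "mdeg (map_key \<pi> \<alpha>) = mdeg \<alpha>"
    unfolding mdeg_def k lookup_map_key[OF inj] by (rule sum.reindex_bij_betw)
  moreover have "keys \<alpha> \<subseteq> A"
  proof
    fix i assume "i \<in> keys \<alpha>"
    obtain j where "i = \<pi> j" using assms(1) bij_pointE by metis
    then have "j \<in> keys (map_key \<pi> \<alpha>)" using k \<open>i \<in> keys \<alpha>\<close> by simp
    moreover have "keys (map_key \<pi> \<alpha>) \<subseteq> A" using * assms(3) by (simp add: homog_def)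
    ultimately show "i \<in> A" using assms(2) \<open>i = \<pi> j\<close> by blast
  qed
  ultimately show "keys \<alpha> \<subseteq> A \<and> mdeg \<alpha> = n"
    using * assms(3) by (auto simp: homog_def)
qed

text \<open>\<open>ddiff\<close> lowers the degree by one and the linear factor in front of it
  restores it; no variables appear besides those of \<open>f\<close> and the two exchanged
  ones.\<close>

lemma homog_hecke:
  assumes "homog A n f" "i \<in> A" "Suc i \<in> A"
  shows "homog A n (hecke t i f)"
proof -
  have sw: "homog A n (swap_vars i (Suc i) f - f)"
    unfolding swap_vars_eq_perm using assms
    by (intro homog_diff homog_perm) (auto simp: transpose_def)
  have dd: "keys \<alpha> \<subseteq> A \<and> mdeg \<alpha> + 1 = n" if "mcoeff (ddiff i (Suc i) f) \<alpha> \<noteq> 0" for \<alpha>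
  proof -
    have "\<exists>l\<in>{..lookup \<alpha> (Suc i)}.
        mcoeff (swap_vars i (Suc i) f - f) (\<alpha> + single i (Suc l) - single (Suc i) l) \<noteq> 0"
    proof (rule ccontr)
      assume "\<not> ?thesis"
      then have "mcoeff (ddiff i (Suc i) f) \<alpha> = 0"
        unfolding ddiff_def mcoeff_Abs_mps by (intro sum.neutral) blast
      then show False using that by simp
    qed
    then obtain l where l: "l \<le> lookup \<alpha> (Suc i)" and l0:
      "mcoeff (swap_vars i (Suc i) f - f) (\<alpha> + single i (Suc l) - single (Suc i) l) \<noteq> 0"
      by blast
    define \<beta> where "\<beta> = \<alpha> + single i (Suc l) - single (Suc i) l"
    have eq: "\<beta> + single (Suc i) l = \<alpha> + single i (Suc l)"
      using l by (auto intro!: poly_mapping_eqI simp: \<beta>_def lookup_add lookup_minus lookup_single when_def)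
    have \<beta>: "keys \<beta> \<subseteq> A" "mdeg \<beta> = n"
      using sw l0 unfolding homog_def \<beta>_def by blast+
    have "mdeg \<beta> + l = mdeg \<alpha> + Suc l"
      using arg_cong[OF eq, of mdeg] by (simp add: mdeg_add)
    moreover have "keys \<alpha> \<subseteq> keys (\<beta> + single (Suc i) l)"
      unfolding eq keys_plus_nat by blast
    then have "keys \<alpha> \<subseteq> A"
      using \<beta>(1) assms(3) unfolding keys_plus_nat by (auto split: if_splits)
    ultimately show ?thesis using \<beta> by simp
  qed
  have X: "homog A n (X k * ddiff i (Suc i) f)" if "k \<in> A" for k
    unfolding homog_def
  proof (intro allI impI)
    fix \<alpha> assume *: "mcoeff (X k * ddiff i (Suc i) f) \<alpha> \<noteq> 0"
    then obtain \<beta> where \<beta>: "\<alpha> = single k 1 + \<beta>"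
      unfolding X_conv_mono using mcoeff_mono_mult_0 by blast
    then have "mcoeff (ddiff i (Suc i) f) \<beta> \<noteq> 0"
      using * unfolding X_conv_mono by (simp add: mcoeff_mono_mult del: One_nat_def)
    then show "keys \<alpha> \<subseteq> A \<and> mdeg \<alpha> = n"
      using dd[of \<beta>] that unfolding \<beta> by (auto simp: mdeg_add keys_plus_nat)
  qed
  show ?thesis
    unfolding hecke_conv_ddiff left_diff_distrib mscale_mult_left
    by (intro homog_add homog_diff homog_mscale X assms)
qed

definition comps :: "nat \<Rightarrow> nat \<Rightarrow> nat list set"
  where "comps m n = {a. length a = m \<and> sum_list a = n}"

lemma finite_comps: "finite (comps m n)"
proof (rule finite_subset)
  show "comps m n \<subseteq> {a. set a \<subseteq> {..n} \<and> length a = m}"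
    by (auto simp: comps_def member_le_sum_list)
qed (rule finite_lists_length_eq, simp)

lemma homog_expansion:
  assumes "homog {..<m} n f"
  shows "f = (\<Sum>b\<in>comps m n. mscale (mcoeff f (expo b)) (x_pow b))"
proof (rule mps_eqI)
  fix \<alpha>
  have R: "mcoeff (\<Sum>b\<in>comps m n. mscale (mcoeff f (expo b)) (x_pow b)) \<alpha> =
      (\<Sum>b\<in>comps m n. mcoeff f (expo b) * (if \<alpha> = expo b then 1 else 0))"
    by (simp add: x_pow_conv_mono mcoeff_mono)
  show "mcoeff f \<alpha> = mcoeff (\<Sum>b\<in>comps m n. mscale (mcoeff f (expo b)) (x_pow b)) \<alpha>"
  proof (cases "keys \<alpha> \<subseteq> {..<m} \<and> mdeg \<alpha> = n")
    case True
    define b where "b = map (lookup \<alpha>) [0..<m]"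
    have \<alpha>: "\<alpha> = expo b" using True expo_eqI b_def by blast
    then have b: "b \<in> comps m n" using True mdeg_expo[of b] by (simp add: comps_def b_def)
    have "(\<Sum>b'\<in>comps m n. mcoeff f (expo b') * (if \<alpha> = expo b' then 1 else 0)) =
        (\<Sum>b'\<in>comps m n. if b' = b then mcoeff f (expo b) else 0)"
      unfolding \<alpha> using b by (intro sum.cong) (auto simp: comps_def expo_inject)
    then show ?thesis unfolding R using b finite_comps by (simp add: \<alpha>)
  next
    case False
    then have "mcoeff f \<alpha> = 0" using assms by (auto simp: homog_def)
    moreover have "\<alpha> \<noteq> expo b" if "b \<in> comps m n" for b
      using False that homog_x_pow[of b] unfolding x_pow_conv_mono homog_mono by (auto simp: comps_def)
    ultimately show ?thesis unfolding R by (auto intro!: sum.neutral[symmetric])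
  qed
qed

lemma perm_x_pow:
  assumes "Suc i < length a"
  shows "perm (adj i) (x_pow a) = x_pow (swap_adj a i)"
proof -
  have "map_key (adj i) (expo a) = expo (swap_adj a i)"
    using assms
    by (intro poly_mapping_eqI)
       (auto simp: lookup_map_key lookup_expo nth_swap_adj, auto simp: transpose_def split: if_splits)
  then show ?thesis by (simp add: x_pow_conv_mono perm_mono)
qed

lemma sum_list_swap_adj: "Suc i < length a \<Longrightarrow> sum_list (swap_adj a i) = sum_list a"
  unfolding swap_adj_def using mset_swap[of i a "Suc i"]
  by (metis Suc_lessD list_update_swap n_not_Suc_n sum_mset_sum_list)

lemma homog_H: "homog {..<length a} (sum_list a) (H_fun t a)"
proof -
  have "is_H t a f \<Longrightarrow> homog {..<length a} (sum_list a) f" for f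
  proof (induction rule: is_H.induct)
    case (hecke a f i)
    then show ?case
      using homog_hecke[of "{..<length a}" "sum_list a" f i t] sum_list_swap_adj[of i a]
      by (simp add: swap_adj_def)
  qed (rule homog_x_pow)
  then show ?thesis using is_H_H_fun by blast
qed

lemma mps_limit_t1_H: "mps_limit_t1 (H_fun t_Qqt a) (x_pow a)"
proof -
  have "is_H t_Qqt a f \<Longrightarrow> mps_limit_t1 f (x_pow a)" for f
  proof (induction rule: is_H.induct)
    case (hecke a f i)
    then show ?case
      using mps_limit_t1_hecke[of f "x_pow a" i] by (simp add: perm_x_pow flip: swap_adj_def)
  qed (rule mps_limit_t1_x_pow)
  then show ?thesis using is_H_H_fun by blast
qed

lemma indep_fam_x_pow: "indep_fam {a. length a = m} x_pow"
  unfolding indep_fam_def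
proof (intro allI impI ballI)
  fix J e b assume J: "finite J" "J \<subseteq> {a. length a = m}" "(\<Sum>i\<in>J. mscale (e i) (x_pow i)) = (0 :: 'a mps)" "b \<in> J"
  have "(\<Sum>i\<in>J. if i = b then e i else 0) = (\<Sum>i\<in>J. e i * mcoeff (x_pow i) (expo b))"
    using J(2,4) by (intro sum.cong) (auto simp: x_pow_conv_mono mcoeff_mono expo_inject subset_iff)
  also have "\<dots> = 0"
    using arg_cong[OF J(3), of "\<lambda>f. mcoeff f (expo b)"] by simp
  finally have "(\<Sum>i\<in>J. if i = b then e i else 0) = 0" .
  then show "e b = 0" using J by simp
qed

text \<open>The H_a of one degree are expanded in equally many monomials, and they are independent
  because their limits are these monomials; so the expansion can be inverted.\<close>

lemma x_pow_in_span_H: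
  assumes "b \<in> comps m n"
  shows "x_pow b \<in> mps.span (H_fun t_Qqt ` comps m n)"
proof (rule indep_fam_span_exchange[where b = "H_fun t_Qqt" and c = x_pow, OF finite_comps _ _ assms])
  have "indep_fam (comps m n) (x_pow :: nat list \<Rightarrow> Qq mps)"
    by (rule indep_fam_subset[OF indep_fam_x_pow[of m]]) (auto simp: comps_def)
  then show "indep_fam (comps m n) (H_fun t_Qqt)"
    by (intro indep_fam_limit[where b' = x_pow] mps_limit_t1_H)
  fix a assume "a \<in> comps m n"
  then have "homog {..<m} n (H_fun t_Qqt a)"
    using homog_H[of a t_Qqt] by (simp add: comps_def)
  then show "H_fun t_Qqt a \<in> mps.span (x_pow ` comps m n)"
    by (subst homog_expansion[of m n "H_fun t_Qqt a"])
       (assumption, rule sum_mscale_in_span, rule mps.span_base, rule imageI)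
qed

section \<open>Power sums and monomials\<close>

definition head :: "nat \<Rightarrow> (nat \<Rightarrow>\<^sub>0 nat) \<Rightarrow> nat list"
  where "head m \<alpha> = map (lookup \<alpha>) [0..<m]"

definition tail :: "nat \<Rightarrow> (nat \<Rightarrow>\<^sub>0 nat) \<Rightarrow> nat multiset"
  where "tail m \<alpha> = image_mset (lookup \<alpha>) (mset_set (keys \<alpha> \<inter> {m..}))"

text \<open>The index of the unique m_\<Lambda> that contains the given monomial.\<close>

definition mtype :: "nat \<Rightarrow> (nat \<Rightarrow>\<^sub>0 nat) \<Rightarrow> mpart"
  where "mtype m \<alpha> = (head m \<alpha>, tail m \<alpha>)"

text \<open>One chosen monomial of m_\<Lambda>: the coefficient there is the m_\<Lambda>-coordinate
  of an m-symmetric series.\<close>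

definition mexp :: "mpart \<Rightarrow> (nat \<Rightarrow>\<^sub>0 nat)"
  where "mexp \<Lambda> = expo (fst \<Lambda> @ parts_desc (snd \<Lambda>))"

definition pdeg :: "mpart \<Rightarrow> nat"
  where "pdeg \<Lambda> = sum_list (fst \<Lambda>) + sum_mset (snd \<Lambda>)"

abbreviation len :: "mpart \<Rightarrow> nat" where "len \<Lambda> \<equiv> size (snd \<Lambda>)"

lemma head_eq_iff: "length a = m \<Longrightarrow> head m \<alpha> = a \<longleftrightarrow> (\<forall>i<m. lookup \<alpha> i = a ! i)"
  by (auto simp: head_def list_eq_iff_nth_eq)

lemma size_tail: "size (tail m \<alpha>) = card (keys \<alpha> \<inter> {m..})"
  by (simp add: tail_def)

lemma tail_cong: "(\<And>k. m \<le> k \<Longrightarrow> lookup \<alpha> k = lookup \<beta> k) \<Longrightarrow> tail m \<alpha> = tail m \<beta>"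
proof -
  assume *: "\<And>k. m \<le> k \<Longrightarrow> lookup \<alpha> k = lookup \<beta> k"
  then have k: "keys \<alpha> \<inter> {m..} = keys \<beta> \<inter> {m..}" by (auto simp: in_keys_iff)
  show ?thesis unfolding tail_def k by (rule image_mset_cong) (auto simp: *)
qed

lemma mtype_in_mparts: "mtype m \<alpha> \<in> mparts m"
  by (auto simp: mtype_def mparts_def head_def tail_def in_keys_iff)

lemma mdeg_eq_pdeg: "mdeg \<alpha> = pdeg (mtype m \<alpha>)"
proof -
  have "mdeg \<alpha> = (\<Sum>k\<in>{..<m} \<union> (keys \<alpha> \<inter> {m..}). lookup \<alpha> k)"
    unfolding mdeg_def by (rule sum.mono_neutral_left) (auto simp: in_keys_iff)
  also have "\<dots> = (\<Sum>k<m. lookup \<alpha> k) + (\<Sum>k\<in>keys \<alpha> \<inter> {m..}. lookup \<alpha> k)"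
    by (rule sum.union_disjoint) auto
  also have "(\<Sum>k<m. lookup \<alpha> k) = sum_list (head m \<alpha>)"
    by (simp add: head_def sum_list_sum_nth lessThan_atLeast0)
  finally show ?thesis by (simp add: pdeg_def mtype_def tail_def sum_unfold_sum_mset)
qed

lemma mset_parts_desc [simp]: "mset (parts_desc M) = M"
  by (simp add: parts_desc_def)

lemma mtype_mexp:
  assumes "\<Lambda> \<in> mparts m"
  shows "mtype m (mexp \<Lambda>) = \<Lambda>"
proof -
  obtain a \<mu> where L: "\<Lambda> = (a, \<mu>)" by (cases \<Lambda>)
  let ?p = "parts_desc \<mu>"
  have a: "length a = m" and "0 \<notin># \<mu>" using assms L by (auto simp: mparts_def)
  then have p0: "0 \<notin> set ?p" by (metis mset_parts_desc set_mset_mset)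
  have lk: "lookup (mexp \<Lambda>) = (\<lambda>k. if k < m + length ?p then (a @ ?p) ! k else 0)"
    by (auto simp: fun_eq_iff mexp_def L lookup_expo a)
  have hd: "head m (mexp \<Lambda>) = a"
    using a by (simp add: head_eq_iff lk nth_append)
  have "keys (mexp \<Lambda>) \<inter> {m..} = {m..<m + length ?p}"
  proof -
    have "?p ! j \<noteq> 0" if "j < length ?p" for j using p0 that by (metis nth_mem)
    then show ?thesis by (auto simp: in_keys_iff lk nth_append a split: if_splits)
  qed
  then have "tail m (mexp \<Lambda>) = mset (map (lookup (mexp \<Lambda>)) [m..<m + length ?p])"
    by (simp add: tail_def)
  also have "map (lookup (mexp \<Lambda>)) [m..<m + length ?p] = ?p"
    by (rule nth_equalityI) (auto simp: lk nth_append a)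
  finally show ?thesis using hd by (simp add: mtype_def L)
qed

lemma mcoeff_m_fun:
  assumes "\<Lambda> \<in> mparts m"
  shows "mcoeff (m_fun \<Lambda>) \<alpha> = (if mtype m \<alpha> = \<Lambda> then 1 else 0)"
proof -
  obtain a \<mu> where L: "\<Lambda> = (a, \<mu>)" "length a = m" using assms by (auto simp: mparts_def)
  have eq: "m_fun \<Lambda> = monomial_mps (expo a) * mono_sym m \<mu>"
    by (simp add: m_fun_def L x_pow_conv_mono)
  show ?thesis
  proof (cases "head m \<alpha> = a")
    case True
    then have h: "\<And>i. i < m \<Longrightarrow> lookup \<alpha> i = a ! i" using L by (auto simp: head_eq_iff)
    define \<beta> where "\<beta> = \<alpha> - expo a"
    have lb: "lookup \<beta> k = (if k < m then 0 else lookup \<alpha> k)" for k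
      using h L by (simp add: \<beta>_def lookup_minus lookup_expo)
    have \<alpha>: "\<alpha> = expo a + \<beta>"
      using h L by (auto intro!: poly_mapping_eqI simp: lookup_add lb lookup_expo)
    have k: "keys \<beta> = keys \<alpha> \<inter> {m..}" by (auto simp: in_keys_iff lb split: if_splits)
    have "image_mset (lookup \<beta>) (mset_set (keys \<beta>)) = tail m \<alpha>"
      unfolding k tail_def by (rule image_mset_cong) (auto simp: lb)
    moreover have "mcoeff (m_fun \<Lambda>) \<alpha> = mcoeff (mono_sym m \<mu>) \<beta>"
      unfolding eq \<alpha> by (rule mcoeff_mono_mult)
    ultimately show ?thesis
      using True k by (auto simp: mono_sym_def mtype_def L(1))
  next
    case False
    have "mcoeff (monomial_mps (expo a) * mono_sym m \<mu>) \<alpha> = 0"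
    proof (rule ccontr)
      assume nz: "\<not> ?thesis"
      then obtain \<beta> where b: "\<alpha> = expo a + \<beta>" using mcoeff_mono_mult_0 by blast
      have "keys \<beta> \<subseteq> {m..}"
        using nz unfolding b mcoeff_mono_mult by (auto simp: mono_sym_def split: if_splits)
      then have "\<forall>i<m. lookup \<beta> i = 0" by (auto simp: in_keys_iff subset_iff)
      then have "head m \<alpha> = a"
        using L by (auto simp: b head_eq_iff lookup_add lookup_expo)
      then show False using False by simp
    qed
    then show ?thesis unfolding eq using False by (simp add: mtype_def L(1))
  qed
qed

text \<open>One takes a factor x_i^k out of the monomial in all possible ways. For
  \<open>k = 0\<close> all the x_i^k coincide, and summing over \<open>i\<close> would count the
  same term repeatedly.\<close>

lemma mcoeff_power_sum_mult:
  assumes "k > 0"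
  shows "mcoeff (power_sum k * f) \<alpha> =
    (\<Sum>i | i \<in> keys \<alpha> \<and> k \<le> lookup \<alpha> i. mcoeff f (\<alpha> - single i k))"
proof -
  let ?I = "{i. i \<in> keys \<alpha> \<and> k \<le> lookup \<alpha> i}"
  let ?S = "{p. fst p + snd p = \<alpha>}"
  have fin: "finite ?I" by simp
  have *: "single i k + (\<alpha> - single i k) = \<alpha>" if "i \<in> ?I" for i
    using that by (simp add: single_plus_minus)
  have inj: "inj_on (\<lambda>i. (single i k, \<alpha> - single i k)) ?I"
    using assms by (auto intro!: inj_onI) (metis keys_single neq0_conv singleton_inject)
  have "mcoeff (power_sum k * f) \<alpha> = (\<Sum>p\<in>?S. mcoeff (power_sum k) (fst p) * mcoeff f (snd p))"
    by (simp add: mcoeff_mult case_prod_unfold)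
  also have "\<dots> = (\<Sum>p\<in>(\<lambda>i. (single i k, \<alpha> - single i k)) ` ?I. mcoeff (power_sum k) (fst p) * mcoeff f (snd p))"
  proof (rule sum.mono_neutral_right)
    show "finite ?S" using finite_add_eq[of \<alpha>] by (simp add: case_prod_unfold)
    show "\<forall>p\<in>?S - (\<lambda>i. (single i k, \<alpha> - single i k)) ` ?I.
        mcoeff (power_sum k) (fst p) * mcoeff f (snd p) = 0"
    proof
      fix p assume p: "p \<in> ?S - (\<lambda>i. (single i k, \<alpha> - single i k)) ` ?I"
      have "fst p \<noteq> single i k" for i
      proof
        assume i: "fst p = single i k"
        then have \<alpha>: "\<alpha> = single i k + snd p" using p by auto
        then have "i \<in> ?I" "snd p = \<alpha> - single i k"
          using assms by (auto simp: in_keys_iff lookup_add)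
        then show False using p i by (metis (no_types, lifting) DiffD2 image_eqI prod.collapse)
      qed
      then show "mcoeff (power_sum k) (fst p) * mcoeff f (snd p) = 0"
        by (simp add: power_sum_def)
    qed
  qed (use * in auto)
  also have "\<dots> = (\<Sum>i\<in>?I. mcoeff f (\<alpha> - single i k))"
    by (subst sum.reindex[OF inj]) (auto simp: power_sum_def intro!: sum.cong)
  finally show ?thesis .
qed

section \<open>Leading coefficients of products of power sums\<close>

lemma p_sym_empty [simp]: "p_sym {#} = 1"
  by (simp add: p_sym_def)

lemma p_sym_add [simp]: "p_sym (add_mset k \<nu>) = power_sum k * p_sym \<nu>"
  by (simp add: p_sym_def)

text \<open>The coefficient of m_\<nu> in p_\<nu>, and z_\<nu> without the product of the
  parts.\<close>

definition aut :: "nat multiset \<Rightarrow> nat"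
  where "aut \<nu> = (\<Prod>i\<in>set_mset \<nu>. fact (count \<nu> i))"

lemma aut_add: "aut (add_mset k \<nu>) = Suc (count \<nu> k) * aut \<nu>"
proof -
  have *: "aut \<rho> = fact (count \<rho> k) * (\<Prod>i\<in>set_mset \<rho> - {k}. fact (count \<rho> i))" for \<rho>
    unfolding aut_def by (cases "k \<in># \<rho>") (auto simp: prod.remove not_in_iff)
  have "(\<Prod>i\<in>set_mset (add_mset k \<nu>) - {k}. fact (count (add_mset k \<nu>) i)) =
      (\<Prod>i\<in>set_mset \<nu> - {k}. fact (count \<nu> i) :: nat)"
    by (intro prod.cong) auto
  then show ?thesis by (simp add: *[of \<nu>] *[of "add_mset k \<nu>"] algebra_simps del: set_mset_add_mset_insert)
qed

lemma aut_pos: "aut \<nu> > 0"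
  by (simp add: aut_def prod_pos)

lemma tail_add_single:
  assumes "k > 0"
  shows "i < m \<Longrightarrow> tail m (\<beta> + single i k) = tail m \<beta>"
    and "m \<le> i \<Longrightarrow> lookup \<beta> i = 0 \<Longrightarrow> tail m (\<beta> + single i k) = add_mset k (tail m \<beta>)"
    and "size (tail m (\<beta> + single i k)) \<le> Suc (size (tail m \<beta>))"
    and "lookup \<beta> i \<noteq> 0 \<Longrightarrow> size (tail m (\<beta> + single i k)) = size (tail m \<beta>)"
proof -
  show "i < m \<Longrightarrow> tail m (\<beta> + single i k) = tail m \<beta>"
    by (rule tail_cong) (auto simp: lookup_add lookup_single when_def)
  show "tail m (\<beta> + single i k) = add_mset k (tail m \<beta>)" if *: "m \<le> i" "lookup \<beta> i = 0"
  proof -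
    have k: "keys (\<beta> + single i k) \<inter> {m..} = insert i (keys \<beta> \<inter> {m..})"
      using assms that by (auto simp: keys_plus_nat)
    have "i \<notin> keys \<beta>" using * by (simp add: in_keys_iff)
    then show ?thesis unfolding tail_def k using *
      by (auto simp: lookup_add lookup_single when_def intro!: image_mset_cong)
  qed
  show "size (tail m (\<beta> + single i k)) \<le> Suc (size (tail m \<beta>))"
  proof -
    have "keys (\<beta> + single i k) \<inter> {m..} \<subseteq> insert i (keys \<beta> \<inter> {m..})"
      using assms by (auto simp: keys_plus_nat)
    then have "card (keys (\<beta> + single i k) \<inter> {m..}) \<le> card (insert i (keys \<beta> \<inter> {m..}))"
      by (intro card_mono) auto
    also have "\<dots> \<le> Suc (card (keys \<beta> \<inter> {m..}))"
      by (simp add: card_insert_if)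
    finally show ?thesis by (simp add: size_tail)
  qed
  show "size (tail m (\<beta> + single i k)) = size (tail m \<beta>)" if "lookup \<beta> i \<noteq> 0"
  proof -
    have "keys (\<beta> + single i k) = keys \<beta>"
      using that assms by (auto simp: keys_plus_nat in_keys_iff)
    then show ?thesis by (simp add: size_tail)
  qed
qed

text \<open>Expanding p_\<nu> assigns each part to a variable. Parts on the same variable merge and
  parts on the first \<open>m\<close> variables are lost from the tail, so the length is preserved
  only if all parts go to different late variables.\<close>

lemma p_sym_coeff_nonzero:
  assumes "0 \<notin># \<nu>" "mcoeff (p_sym \<nu> :: 'a::field mps) \<alpha> \<noteq> 0"
  shows "size (tail m \<alpha>) \<le> size \<nu> \<and> (size (tail m \<alpha>) = size \<nu> \<longrightarrow> keys \<alpha> \<subseteq> {m..} \<and> tail m \<alpha> = \<nu>)"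
  using assms
proof (induction \<nu> arbitrary: \<alpha>)
  case empty
  then have "\<alpha> = 0" by (simp add: mcoeff_1 split: if_splits)
  then show ?case by (simp add: tail_def)
next
  case (add k \<nu>)
  then have k: "k > 0" by (metis gr0I union_single_eq_member)
  obtain i where i: "i \<in> keys \<alpha>" "k \<le> lookup \<alpha> i" "mcoeff (p_sym \<nu> :: 'a mps) (\<alpha> - single i k) \<noteq> 0"
    using add.prems(2) unfolding p_sym_add mcoeff_power_sum_mult[OF k]
    by (metis (mono_tags, lifting) mem_Collect_eq sum.not_neutral_contains_not_neutral)
  define \<beta> where "\<beta> = \<alpha> - single i k"
  have \<alpha>: "\<alpha> = \<beta> + single i k"
    using single_plus_minus[OF i(2)] by (simp add: \<beta>_def add.commute)
  have IH: "size (tail m \<beta>) \<le> size \<nu>" "size (tail m \<beta>) = size \<nu> \<Longrightarrow> keys \<beta> \<subseteq> {m..} \<and> tail m \<beta> = \<nu>"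
    using add.IH[of \<beta>] add.prems(1) i(3) by (auto simp: \<beta>_def)
  note t = tail_add_single[OF k, where i = i and m = m and \<beta> = \<beta>, folded \<alpha>]
  show ?case
  proof (intro conjI impI)
    show "size (tail m \<alpha>) \<le> size (add_mset k \<nu>)" using t(3) IH(1) by simp
    assume eq: "size (tail m \<alpha>) = size (add_mset k \<nu>)"
    then have "size (tail m \<beta>) = size \<nu>" using t(3) IH(1) by simp
    note IH2 = IH(2)[OF this]
    have "m \<le> i" "lookup \<beta> i = 0"
      using eq t(1,4) IH(1) by (fastforce simp: not_less[symmetric])+
    then show "keys \<alpha> \<subseteq> {m..}" "tail m \<alpha> = add_mset k \<nu>"
      using IH2 t(2) unfolding \<alpha> keys_plus_nat by auto
  qed
qed

text \<open>After removal of a part \<open>k\<close>, only variables with exponent exactly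
  \<open>k\<close> contribute: elsewhere the remaining monomial still has as many late variables as
  before, one more than the remaining partition has parts. The number of such variables is the
  factor in \<open>aut_add\<close>.\<close>

lemma p_sym_coeff_diag:
  assumes "0 \<notin># \<nu>" "keys \<alpha> \<subseteq> {m..}" "tail m \<alpha> = \<nu>"
  shows "mcoeff (p_sym \<nu> :: 'a::field mps) \<alpha> = of_nat (aut \<nu>)"
  using assms
proof (induction \<nu> arbitrary: \<alpha>)
  case empty
  then have "\<alpha> = 0" by (auto simp: tail_def mset_set_empty_iff Int_absorb2)
  then show ?case by (simp add: mcoeff_1 aut_def)
next
  case (add k \<nu>)
  then have k: "k > 0" by (metis gr0I union_single_eq_member)
  let ?I = "{i. i \<in> keys \<alpha> \<and> k \<le> lookup \<alpha> i}"
  have "mcoeff (p_sym \<nu> :: 'a mps) (\<alpha> - single i k) = (if lookup \<alpha> i = k then of_nat (aut \<nu>) else 0)"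
    if i: "i \<in> ?I" for i
  proof -
    define \<beta> where "\<beta> = \<alpha> - single i k"
    have \<alpha>: "\<alpha> = \<beta> + single i k"
      using i single_plus_minus[of k \<alpha> i] by (simp add: \<beta>_def add.commute)
    have lb: "lookup \<beta> i = lookup \<alpha> i - k" by (simp add: \<beta>_def lookup_minus)
    note t = tail_add_single[OF k, where i = i and m = m and \<beta> = \<beta>, folded \<alpha>]
    have mi: "m \<le> i" using i add.prems(2) by auto
    have kb: "keys \<beta> \<subseteq> {m..}"
      using add.prems(2) unfolding \<alpha> keys_plus_nat by auto
    show ?thesis
    proof (cases "lookup \<alpha> i = k")
      case True
      then have "tail m \<beta> = \<nu>" using t(2) mi lb add.prems(3) by simp
      then show ?thesis using True add.IH[of \<beta>] add.prems(1) kb by (simp add: \<beta>_def)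
    next
      case False
      then have "size (tail m \<beta>) = Suc (size \<nu>)" using t(4) lb i add.prems(3) by simp
      then have "mcoeff (p_sym \<nu> :: 'a mps) \<beta> = 0"
        using p_sym_coeff_nonzero[of \<nu> \<beta> m] add.prems(1) by fastforce
      then show ?thesis using False by (simp add: \<beta>_def)
    qed
  qed
  then have "mcoeff (p_sym (add_mset k \<nu>) :: 'a mps) \<alpha> =
      (\<Sum>i\<in>?I. if lookup \<alpha> i = k then of_nat (aut \<nu>) else 0)"
    unfolding p_sym_add mcoeff_power_sum_mult[OF k] by (intro sum.cong) auto
  also have "\<dots> = (\<Sum>i\<in>{i\<in>?I. lookup \<alpha> i = k}. of_nat (aut \<nu>))"
    by (rule sum.inter_filter[symmetric]) simp
  also have "\<dots> = of_nat (card {i\<in>?I. lookup \<alpha> i = k}) * of_nat (aut \<nu>)"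
    by simp
  also have "{i\<in>?I. lookup \<alpha> i = k} = {i\<in>keys \<alpha>. lookup \<alpha> i = k}" by auto
  also have "card \<dots> = count (tail m \<alpha>) k"
  proof -
    have "count (tail m \<alpha>) k = (\<Sum>i\<in>lookup \<alpha> -` {k} \<inter> keys \<alpha>. count (mset_set (keys \<alpha>)) i)"
      using add.prems(2) by (simp add: tail_def Int_absorb2 count_image_mset)
    also have "\<dots> = (\<Sum>i\<in>lookup \<alpha> -` {k} \<inter> keys \<alpha>. 1)"
      by (rule sum.cong) auto
    also have "\<dots> = card {i \<in> keys \<alpha>. lookup \<alpha> i = k}"
      by (simp add: vimage_def Int_def conj_commute)
    finally show ?thesis by simp
  qed
  also have "\<dots> = Suc (count \<nu> k)" using add.prems(3) by simp
  finally show ?case by (simp add: aut_add distrib_right)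
qed

lemma xp_fun_coeff:
  assumes "\<Gamma> \<in> mparts m"
  shows "mcoeff (xp_fun \<Gamma> :: 'a::field mps) \<alpha> \<noteq> 0 \<Longrightarrow> size (tail m \<alpha>) \<le> len \<Gamma>"
    and "mcoeff (xp_fun \<Gamma> :: 'a::field mps) \<alpha> \<noteq> 0 \<Longrightarrow> size (tail m \<alpha>) = len \<Gamma> \<Longrightarrow> mtype m \<alpha> = \<Gamma>"
    and "mtype m \<alpha> = \<Gamma> \<Longrightarrow> mcoeff (xp_fun \<Gamma> :: 'a::field mps) \<alpha> = of_nat (aut (snd \<Gamma>))"
proof -
  obtain b \<nu> where G: "\<Gamma> = (b, \<nu>)" "length b = m" "0 \<notin># \<nu>" using assms by (auto simp: mparts_def)
  have xp: "xp_fun \<Gamma> = monomial_mps (expo b) * (p_sym \<nu> :: 'a mps)"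
    by (simp add: xp_fun_def G x_pow_conv_mono)
  have tb: "tail m (expo b + \<beta>) = tail m \<beta>" for \<beta>
    by (rule tail_cong) (auto simp: lookup_add lookup_expo G)
  show "size (tail m \<alpha>) \<le> len \<Gamma>" if nz: "mcoeff (xp_fun \<Gamma> :: 'a mps) \<alpha> \<noteq> 0"
  proof -
    obtain \<beta> where b: "\<alpha> = expo b + \<beta>" using nz mcoeff_mono_mult_0 unfolding xp by blast
    then show ?thesis
      using nz[unfolded xp b mcoeff_mono_mult] p_sym_coeff_nonzero[OF G(3), of \<beta> m, where 'a = 'a]
      by (simp add: G tb)
  qed
  show "mtype m \<alpha> = \<Gamma>" if nz: "mcoeff (xp_fun \<Gamma> :: 'a mps) \<alpha> \<noteq> 0" "size (tail m \<alpha>) = len \<Gamma>"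
  proof -
    obtain \<beta> where b: "\<alpha> = expo b + \<beta>" using nz mcoeff_mono_mult_0 unfolding xp by blast
    then have *: "keys \<beta> \<subseteq> {m..}" "tail m \<beta> = \<nu>"
      using nz(1)[unfolded xp b mcoeff_mono_mult] nz(2) p_sym_coeff_nonzero[OF G(3), of \<beta> m, where 'a = 'a]
      by (auto simp: G tb)
    then have "\<forall>i<m. lookup \<beta> i = 0" by (auto simp: in_keys_iff subset_iff)
    then have "head m \<alpha> = b" using G by (auto simp: b head_eq_iff lookup_add lookup_expo)
    then show ?thesis using * by (simp add: mtype_def G b tb)
  qed
  show "mcoeff (xp_fun \<Gamma> :: 'a mps) \<alpha> = of_nat (aut (snd \<Gamma>))" if t: "mtype m \<alpha> = \<Gamma>"
  proof -
    have h: "\<And>i. i < m \<Longrightarrow> lookup \<alpha> i = b ! i" "tail m \<alpha> = \<nu>"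
      using t G head_eq_iff[of b m \<alpha>] by (auto simp: mtype_def)
    define \<beta> where "\<beta> = \<alpha> - expo b"
    have lb: "lookup \<beta> k = (if k < m then 0 else lookup \<alpha> k)" for k
      using h G by (simp add: \<beta>_def lookup_minus lookup_expo)
    have \<alpha>: "\<alpha> = expo b + \<beta>"
      using h G by (auto intro!: poly_mapping_eqI simp: lookup_add lb lookup_expo)
    have "keys \<beta> \<subseteq> {m..}" by (auto simp: in_keys_iff lb split: if_splits)
    moreover have "tail m \<beta> = \<nu>" using h(2) tb[of \<beta>] \<alpha> by simp
    ultimately show ?thesis
      using p_sym_coeff_diag[OF G(3), of \<beta> m] unfolding xp \<alpha> mcoeff_mono_mult by (simp add: G)
  qed
qed

text \<open>Triangularity with respect to length: a nonzero coefficient needs \<Gamma> to be at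
  least as long as \<Lambda>, and at equal length only the diagonal survives.\<close>

lemma xp_fun_coeff_mexp:
  assumes "\<Gamma> \<in> mparts m" "\<Lambda> \<in> mparts m" "len \<Gamma> \<le> len \<Lambda>"
  shows "mcoeff (xp_fun \<Gamma> :: 'a::field mps) (mexp \<Lambda>) = (if \<Gamma> = \<Lambda> then of_nat (aut (snd \<Lambda>)) else 0)"
proof -
  have t: "mtype m (mexp \<Lambda>) = \<Lambda>" by (rule mtype_mexp[OF assms(2)])
  then have s: "size (tail m (mexp \<Lambda>)) = len \<Lambda>" by (metis mtype_def snd_conv)
  show ?thesis
  proof (cases "\<Gamma> = \<Lambda>")
    case True
    then show ?thesis using xp_fun_coeff(3)[OF assms(1), of "mexp \<Lambda>"] t by simp
  next
    case False
    have "mcoeff (xp_fun \<Gamma> :: 'a mps) (mexp \<Lambda>) = 0"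
    proof (rule ccontr)
      assume nz: "\<not> ?thesis"
      have "len \<Lambda> = len \<Gamma>" using xp_fun_coeff(1)[OF assms(1) nz] s assms(3) by simp
      then show False using xp_fun_coeff(2)[OF assms(1) nz] s t False by simp
    qed
    then show ?thesis using False by simp
  qed
qed

lemma obtain_max_such:
  fixes f :: "'b \<Rightarrow> nat"
  assumes "finite J" "\<exists>j\<in>J. Q j"
  obtains j where "j \<in> J" "Q j" "\<And>i. i \<in> J \<Longrightarrow> Q i \<Longrightarrow> f i \<le> f j"
proof -
  have fin: "finite (f ` {j\<in>J. Q j})" using assms(1) by simp
  moreover have "f ` {j\<in>J. Q j} \<noteq> {}" using assms(2) by blast
  ultimately have "Max (f ` {j\<in>J. Q j}) \<in> f ` {j\<in>J. Q j}" by (rule Max_in)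
  then obtain j where "j \<in> J" "Q j" "f j = Max (f ` {j\<in>J. Q j})" by auto
  then show ?thesis using that[of j] Max_ge[OF fin] by auto
qed

text \<open>In a relation take \<Lambda> of maximal length with nonzero coefficient; evaluating at
  \<open>mexp \<Lambda>\<close> isolates that coefficient, multiplied by \<open>aut\<close>, which
  is nonzero in characteristic 0.\<close>

lemma indep_fam_xp: "indep_fam (mparts m) (xp_fun :: mpart \<Rightarrow> 'a::field_char_0 mps)"
  unfolding indep_fam_def
proof (intro allI impI, rule ccontr)
  fix J and e :: "mpart \<Rightarrow> 'a"
  assume J: "finite J" "J \<subseteq> mparts m" and 0: "(\<Sum>i\<in>J. mscale (e i) (xp_fun i)) = 0"
    and "\<not> (\<forall>i\<in>J. e i = 0)"
  then obtain \<Lambda> where L: "\<Lambda> \<in> J" "e \<Lambda> \<noteq> 0" and max: "\<And>\<Gamma>. \<Gamma> \<in> J \<Longrightarrow> e \<Gamma> \<noteq> 0 \<Longrightarrow> len \<Gamma> \<le> len \<Lambda>"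
    using obtain_max_such[of J "\<lambda>\<Gamma>. e \<Gamma> \<noteq> 0" len] by blast
  have "e \<Gamma> * mcoeff (xp_fun \<Gamma>) (mexp \<Lambda>) = (if \<Gamma> = \<Lambda> then e \<Lambda> * of_nat (aut (snd \<Lambda>)) else 0)"
    if "\<Gamma> \<in> J" for \<Gamma>
  proof (cases "e \<Gamma> = 0")
    case False
    then show ?thesis
      using xp_fun_coeff_mexp[OF subsetD[OF J(2) that] subsetD[OF J(2) L(1)] max[OF that False], where 'a = 'a]
      by simp
  qed (use L in auto)
  then have "(\<Sum>\<Gamma>\<in>J. e \<Gamma> * mcoeff (xp_fun \<Gamma>) (mexp \<Lambda>)) = e \<Lambda> * of_nat (aut (snd \<Lambda>))"
    using L(1) J(1) by simp
  moreover have "(\<Sum>\<Gamma>\<in>J. e \<Gamma> * mcoeff (xp_fun \<Gamma>) (mexp \<Lambda>)) = 0"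
    using arg_cong[OF 0, of "\<lambda>f. mcoeff f (mexp \<Lambda>)"] by simp
  ultimately show False using L(2) aut_pos[of "snd \<Lambda>"] by simp
qed

text \<open>Homogeneity splits all expansions into these finite pieces, on which finite linear
  algebra is available.\<close>

definition mparts_deg :: "nat \<Rightarrow> nat \<Rightarrow> mpart set"
  where "mparts_deg m n = {\<Lambda> \<in> mparts m. pdeg \<Lambda> = n}"

lemma mparts_deg_subset: "mparts_deg m n \<subseteq> mparts m"
  by (auto simp: mparts_deg_def)

lemma finite_mparts_deg: "finite (mparts_deg m n)"
proof -
  define L where "L = {xs. set xs \<subseteq> {..n} \<and> length xs \<le> m + n}"
  have "finite L"
    unfolding L_def by (rule finite_lists_length_le) simp
  have size_le: "size \<mu> \<le> sum_mset \<mu>" if "0 \<notin># \<mu>" for \<mu> :: "nat multiset"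
    using that by (induction \<mu>) auto
  have le: "set xs \<subseteq> {..n}" if "sum_list xs \<le> n" for xs :: "nat list"
    using that by (auto intro: order_trans[OF member_le_sum_list])
  have "mparts_deg m n \<subseteq> (\<lambda>(xs, ys). (xs, mset ys)) ` (L \<times> L)"
  proof
    fix \<Lambda> assume "\<Lambda> \<in> mparts_deg m n"
    then obtain a \<mu> where *: "\<Lambda> = (a, \<mu>)" "length a = m" "0 \<notin># \<mu>" "sum_list a + sum_mset \<mu> = n"
      by (auto simp: mparts_deg_def mparts_def pdeg_def)
    then have "a \<in> L" using le[of a] by (simp add: L_def)
    moreover have "parts_desc \<mu> \<in> L"
      using * le[of "parts_desc \<mu>"] size_le[of \<mu>]
      by (simp add: L_def flip: size_mset sum_mset_sum_list)
    ultimately show "\<Lambda> \<in> (\<lambda>(xs, ys). (xs, mset ys)) ` (L \<times> L)"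
      using * by (intro image_eqI[where x = "(a, parts_desc \<mu>)"]) auto
  qed
  then show ?thesis
    by (rule finite_subset) (intro finite_imageI finite_cartesian_product \<open>finite L\<close>)
qed

section \<open>Transition between power sums and monomials in a fixed degree\<close>

lemma perm_power_sum:
  assumes "bij \<pi>"
  shows "perm \<pi> (power_sum k) = power_sum k"
proof -
  have "(\<exists>i. map_key \<pi> \<alpha> = single i k) \<longleftrightarrow> (\<exists>i. \<alpha> = single i k)" for \<alpha>
  proof
    assume "\<exists>i. map_key \<pi> \<alpha> = single i k"
    then obtain i where "\<alpha> = map_key (inv \<pi>) (single i k)"
      using map_key_bij_eq_iff[OF assms] by blast
    also have "\<dots> = single (\<pi> i) k"
      using map_key_single[of "inv \<pi>" "\<pi> i" k] assms
      by (simp add: bij_imp_bij_inv bij_is_inj)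
    finally show "\<exists>i. \<alpha> = single i k" by blast
  next
    assume "\<exists>i. \<alpha> = single i k"
    then obtain i where "\<alpha> = single (\<pi> i) k" using assms bij_pointE by metis
    then show "\<exists>i. map_key \<pi> \<alpha> = single i k" using assms by (auto simp: bij_is_inj)
  qed
  then show ?thesis by (intro mps_eqI) (simp add: power_sum_def)
qed

lemma perm_xp_fun:
  assumes "\<pi> permutes {m..}" "\<Gamma> \<in> mparts m"
  shows "perm \<pi> (xp_fun \<Gamma>) = (xp_fun \<Gamma> :: 'a::field mps)"
proof -
  have b: "bij \<pi>" using assms(1) by (rule permutes_bij)
  obtain a \<nu> where G: "\<Gamma> = (a, \<nu>)" "length a = m" using assms(2) by (auto simp: mparts_def)
  have "perm \<pi> (x_pow a) = (x_pow a :: 'a mps)"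
    unfolding x_pow_def perm_prod[OF b] perm_power[OF b] perm_X[OF b]
    using permutes_not_in[OF assms(1)] G(2) by (intro prod.cong) auto
  then show ?thesis
    by (simp add: xp_fun_def G p_sym_def perm_mult[OF b] perm_prod_mset[OF b] perm_power_sum[OF b])
qed

lemma mtype_eq_permutes:
  assumes "mtype m \<alpha> = mtype m \<beta>"
  obtains \<pi> where "\<pi> permutes {m..}" "\<alpha> = map_key \<pi> \<beta>"
proof -
  define A where "A = (keys \<alpha> \<union> keys \<beta>) \<inter> {m..}"
  have "finite A" by (simp add: A_def)
  \<comment> \<open>On the common finite set \<open>A\<close> the tails are padded by zeros, so
    equal tails give equal multisets of values, which is what yields a permutation of
    \<open>A\<close>.\<close>
  have *: "image_mset (lookup \<gamma>) (mset_set A) = tail m \<gamma> + replicate_mset (card A - size (tail m \<gamma>)) 0"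
    if "keys \<gamma> \<inter> {m..} \<subseteq> A" for \<gamma>
  proof -
    let ?K = "keys \<gamma> \<inter> {m..}"
    have "mset_set A = mset_set (?K \<union> (A - ?K))" using that by (simp add: Un_absorb1)
    also have "\<dots> = mset_set ?K + mset_set (A - ?K)"
      using \<open>finite A\<close> by (intro mset_set_Union) auto
    finally have "image_mset (lookup \<gamma>) (mset_set A) = tail m \<gamma> + image_mset (lookup \<gamma>) (mset_set (A - ?K))"
      by (simp add: tail_def)
    also have "image_mset (lookup \<gamma>) (mset_set (A - ?K)) = image_mset (\<lambda>_. 0) (mset_set (A - ?K))"
      using \<open>finite A\<close> by (intro image_mset_cong) (auto simp: A_def in_keys_iff)
    also have "\<dots> = replicate_mset (card A - size (tail m \<gamma>)) 0"
      using that \<open>finite A\<close> by (simp add: image_mset_const_eq size_tail card_Diff_subset)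
    finally show ?thesis .
  qed
  have "image_mset (lookup \<alpha>) (mset_set A) = image_mset (lookup \<beta>) (mset_set A)"
    using assms by (subst (1 2) *) (auto simp: A_def mtype_def)
  from image_mset_eq_implies_permutes[OF \<open>finite A\<close> this]
  obtain p where p: "p permutes A" "\<forall>x\<in>A. lookup \<alpha> x = lookup \<beta> (p x)" by blast
  have "lookup \<alpha> k = lookup \<beta> (p k)" for k
  proof (cases "k \<in> A")
    case False
    then have "lookup \<alpha> k = lookup \<beta> k"
      using assms by (cases "k < m") (auto simp: A_def mtype_def head_def in_keys_iff)
    then show ?thesis using permutes_not_in[OF p(1) False] by simp
  qed (use p in auto)
  then have "\<alpha> = map_key p \<beta>"
    using permutes_inj[OF p(1)] by (intro poly_mapping_eqI) (simp add: lookup_map_key)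
  moreover have "p permutes {m..}"
    using permutes_subset[OF p(1)] by (auto simp: A_def)
  ultimately show ?thesis using that by blast
qed

lemma xp_fun_coeff_mtype:
  assumes "\<Gamma> \<in> mparts m" "mtype m \<alpha> = mtype m \<beta>"
  shows "mcoeff (xp_fun \<Gamma>) \<alpha> = mcoeff (xp_fun \<Gamma>) \<beta>"
  using mtype_eq_permutes[OF assms(2)] perm_xp_fun[OF _ assms(1)] by (metis mcoeff_perm)

lemma homog_p_sym: "homog UNIV (sum_mset \<nu>) (p_sym \<nu>)"
proof (induction \<nu>)
  case empty
  then show ?case using homog_mono[of UNIV 0 0] by simp
next
  case (add k \<nu>)
  have "homog UNIV k (power_sum k)" by (auto simp: homog_def power_sum_def split: if_splits)
  from homog_mult[OF this add] show ?case by simp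
qed

lemma homog_xp_fun: "homog UNIV (pdeg \<Gamma>) (xp_fun \<Gamma>)"
proof -
  have "homog UNIV (sum_list a) (x_pow a)" for a
    by (simp add: x_pow_conv_mono homog_mono mdeg_expo)
  from homog_mult[OF this homog_p_sym] show ?thesis
    by (cases \<Gamma>) (simp add: pdeg_def xp_fun_def)
qed

lemma mcoeff_sum_m_fun:
  "mcoeff (\<Sum>\<Lambda>\<in>mparts_deg m n. mscale (c \<Lambda>) (m_fun \<Lambda>)) \<alpha> = (if mdeg \<alpha> = n then c (mtype m \<alpha>) else 0)"
proof -
  have "mcoeff (\<Sum>\<Lambda>\<in>mparts_deg m n. mscale (c \<Lambda>) (m_fun \<Lambda>)) \<alpha> =
      (\<Sum>\<Lambda>\<in>mparts_deg m n. if mtype m \<alpha> = \<Lambda> then c \<Lambda> else 0)"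
    by (auto simp: mcoeff_m_fun[OF subsetD[OF mparts_deg_subset[of m n]]] intro!: sum.cong)
  also have "\<dots> = (if mdeg \<alpha> = n then c (mtype m \<alpha>) else 0)"
    using finite_mparts_deg[of m n] mtype_in_mparts[of m \<alpha>] by (simp add: mparts_deg_def mdeg_eq_pdeg[of \<alpha> m])
  finally show ?thesis .
qed

text \<open>Coefficients are constant on orbits of permutations of the late variables, so one
  monomial per orbit suffices.\<close>

lemma xp_fun_expansion:
  assumes "\<Gamma> \<in> mparts_deg m n"
  shows "xp_fun \<Gamma> = (\<Sum>\<Lambda>\<in>mparts_deg m n. mscale (mcoeff (xp_fun \<Gamma>) (mexp \<Lambda>)) (m_fun \<Lambda>))"
proof (rule mps_eqI)
  fix \<alpha>
  have G: "\<Gamma> \<in> mparts m" "pdeg \<Gamma> = n" using assms by (auto simp: mparts_deg_def)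
  have "mcoeff (xp_fun \<Gamma>) \<alpha> = (if mdeg \<alpha> = n then mcoeff (xp_fun \<Gamma>) (mexp (mtype m \<alpha>)) else 0)"
    using homog_xp_fun[of \<Gamma>] xp_fun_coeff_mtype[OF G(1), of \<alpha> "mexp (mtype m \<alpha>)"]
    unfolding mtype_mexp[OF mtype_in_mparts] G by (auto simp: homog_def)
  then show "mcoeff (xp_fun \<Gamma>) \<alpha> =
      mcoeff (\<Sum>\<Lambda>\<in>mparts_deg m n. mscale (mcoeff (xp_fun \<Gamma>) (mexp \<Lambda>)) (m_fun \<Lambda>)) \<alpha>"
    unfolding mcoeff_sum_m_fun .
qed

text \<open>The matrix in \<open>xp_fun_expansion\<close> is triangular with respect to \<open>len\<close>; invert it by induction.\<close>

lemma m_fun_expansion: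
  assumes "\<Lambda> \<in> mparts_deg m n"
  shows "\<exists>U. m_fun \<Lambda> = (\<Sum>\<Gamma>\<in>mparts_deg m n. mscale (U \<Gamma>) (xp_fun \<Gamma> :: 'a::field_char_0 mps)) \<and>
    U \<Lambda> = 1 / of_nat (aut (snd \<Lambda>)) \<and> (\<forall>\<Gamma>. len \<Lambda> \<le> len \<Gamma> \<longrightarrow> \<Gamma> \<noteq> \<Lambda> \<longrightarrow> U \<Gamma> = 0)"
  using assms
proof (induction "len \<Lambda>" arbitrary: \<Lambda> rule: less_induct)
  case less
  let ?I = "mparts_deg m n"
  let ?V = "\<lambda>\<Omega>. mcoeff (xp_fun \<Lambda> :: 'a mps) (mexp \<Omega>)"
  let ?A = "of_nat (aut (snd \<Lambda>)) :: 'a"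
  have L: "\<Lambda> \<in> mparts m" using less.prems by (simp add: mparts_deg_def)
  have A: "?A \<noteq> 0" using aut_pos[of "snd \<Lambda>"] by simp
  define S where "S = {\<Omega>\<in>?I. len \<Omega> < len \<Lambda>}"
  have finS: "finite S" using finite_mparts_deg by (simp add: S_def)
  have "\<forall>\<Omega>\<in>S. \<exists>U. m_fun \<Omega> = (\<Sum>\<Gamma>\<in>?I. mscale (U \<Gamma>) (xp_fun \<Gamma> :: 'a mps)) \<and>
      (\<forall>\<Gamma>. len \<Omega> \<le> len \<Gamma> \<longrightarrow> \<Gamma> \<noteq> \<Omega> \<longrightarrow> U \<Gamma> = 0)"
    using less.hyps unfolding S_def by blast
  then obtain U where "\<forall>\<Omega>\<in>S. m_fun \<Omega> = (\<Sum>\<Gamma>\<in>?I. mscale (U \<Omega> \<Gamma>) (xp_fun \<Gamma> :: 'a mps)) \<and>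
      (\<forall>\<Gamma>. len \<Omega> \<le> len \<Gamma> \<longrightarrow> \<Gamma> \<noteq> \<Omega> \<longrightarrow> U \<Omega> \<Gamma> = 0)"
    by (rule bchoice[THEN exE])
  then have U: "\<And>\<Omega>. \<Omega> \<in> S \<Longrightarrow> m_fun \<Omega> = (\<Sum>\<Gamma>\<in>?I. mscale (U \<Omega> \<Gamma>) (xp_fun \<Gamma> :: 'a mps))"
      "\<And>\<Omega> \<Gamma>. \<Omega> \<in> S \<Longrightarrow> len \<Omega> \<le> len \<Gamma> \<Longrightarrow> \<Gamma> \<noteq> \<Omega> \<Longrightarrow> U \<Omega> \<Gamma> = 0"
    by blast+
  \<comment> \<open>Outside \<open>S\<close> the indices are at least as long as \<Lambda>, where
    only the diagonal coefficient is left; the rest is covered by the induction hypothesis.\<close>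
  have V: "?V \<Omega> = (if \<Omega> = \<Lambda> then ?A else 0)" if "\<Omega> \<in> ?I - S" for \<Omega>
    using that xp_fun_coeff_mexp[OF L, of \<Omega>, where 'a = 'a] by (auto simp: S_def mparts_deg_def)
  have "xp_fun \<Lambda> = (\<Sum>\<Omega>\<in>?I. mscale (?V \<Omega>) (m_fun \<Omega>))"
    by (rule xp_fun_expansion[OF less.prems])
  also have "\<dots> = (\<Sum>\<Omega>\<in>?I - S. mscale (?V \<Omega>) (m_fun \<Omega>)) + (\<Sum>\<Omega>\<in>S. mscale (?V \<Omega>) (m_fun \<Omega>))"
    using finite_mparts_deg by (intro sum.subset_diff) (auto simp: S_def)
  also have "(\<Sum>\<Omega>\<in>?I - S. mscale (?V \<Omega>) (m_fun \<Omega>)) = (\<Sum>\<Omega>\<in>?I - S. if \<Omega> = \<Lambda> then mscale ?A (m_fun \<Lambda>) else 0)"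
    by (rule sum.cong) (auto simp: V)
  also have "\<dots> = mscale ?A (m_fun \<Lambda>)"
    using less.prems finite_mparts_deg by (simp add: S_def)
  finally have "mscale ?A (m_fun \<Lambda>) = xp_fun \<Lambda> - (\<Sum>\<Omega>\<in>S. mscale (?V \<Omega>) (m_fun \<Omega>))"
    by (simp only: eq_diff_eq)
  also have "\<dots> = (\<Sum>\<Gamma>\<in>?I. mscale (if \<Gamma> = \<Lambda> then 1 else 0) (xp_fun \<Gamma>)) -
      (\<Sum>\<Gamma>\<in>?I. mscale (\<Sum>\<Omega>\<in>S. ?V \<Omega> * U \<Omega> \<Gamma>) (xp_fun \<Gamma>))"
  proof -
    have "(\<Sum>\<Gamma>\<in>?I. mscale (if \<Gamma> = \<Lambda> then 1 else 0) (xp_fun \<Gamma>)) = (\<Sum>\<Gamma>\<in>?I. if \<Gamma> = \<Lambda> then xp_fun \<Lambda> else (0 :: 'a mps))"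
      by (rule sum.cong) auto
    also have "\<dots> = xp_fun \<Lambda>"
      using less.prems finite_mparts_deg by simp
    moreover have "(\<Sum>\<Omega>\<in>S. mscale (?V \<Omega>) (m_fun \<Omega>)) = (\<Sum>\<Omega>\<in>S. \<Sum>\<Gamma>\<in>?I. mscale (?V \<Omega> * U \<Omega> \<Gamma>) (xp_fun \<Gamma>))"
      by (rule sum.cong) (auto simp: U(1) mps.scale_sum_right)
    then have "(\<Sum>\<Omega>\<in>S. mscale (?V \<Omega>) (m_fun \<Omega>)) = (\<Sum>\<Gamma>\<in>?I. mscale (\<Sum>\<Omega>\<in>S. ?V \<Omega> * U \<Omega> \<Gamma>) (xp_fun \<Gamma>))"
      by (subst (asm) sum.swap) (simp add: mps.scale_sum_left)
    ultimately show ?thesis by simp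
  qed
  also have "\<dots> = (\<Sum>\<Gamma>\<in>?I. mscale ((if \<Gamma> = \<Lambda> then 1 else 0) - (\<Sum>\<Omega>\<in>S. ?V \<Omega> * U \<Omega> \<Gamma>)) (xp_fun \<Gamma>))"
    by (simp add: sum_subtractf mps.scale_left_diff_distrib)
  finally have "mscale (1 / ?A) (mscale ?A (m_fun \<Lambda>)) = mscale (1 / ?A)
      (\<Sum>\<Gamma>\<in>?I. mscale ((if \<Gamma> = \<Lambda> then 1 else 0) - (\<Sum>\<Omega>\<in>S. ?V \<Omega> * U \<Omega> \<Gamma>)) (xp_fun \<Gamma>))"
    by simp
  then have eq: "m_fun \<Lambda> = (\<Sum>\<Gamma>\<in>?I. mscale (((if \<Gamma> = \<Lambda> then 1 else 0) - (\<Sum>\<Omega>\<in>S. ?V \<Omega> * U \<Omega> \<Gamma>)) / ?A) (xp_fun \<Gamma>))"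
    using A by (simp add: mps.scale_sum_right)
  have 0: "(\<Sum>\<Omega>\<in>S. ?V \<Omega> * U \<Omega> \<Gamma>) = 0" if "len \<Lambda> \<le> len \<Gamma>" for \<Gamma>
    using that by (intro sum.neutral) (auto simp: S_def intro!: U(2))
  show ?case
    by (rule exI, rule conjI[OF eq]) (simp add: 0)
qed

section \<open>Complete homogeneous symmetric functions\<close>

text \<open>Euler's operator x_j d/dx_j.\<close>

definition theta :: "nat \<Rightarrow> 'a::field mps \<Rightarrow> 'a mps"
  where "theta j f = Abs_mps (\<lambda>\<alpha>. of_nat (lookup \<alpha> j) * mcoeff f \<alpha>)"

lemma mcoeff_theta [simp]: "mcoeff (theta j f) \<alpha> = of_nat (lookup \<alpha> j) * mcoeff f \<alpha>"
  by (simp add: theta_def)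

lemma theta_mult: "theta j (f * g) = theta j f * g + f * theta j g"
proof (rule mps_eqI)
  fix \<alpha>
  have "mcoeff (theta j (f * g)) \<alpha> = (\<Sum>(\<beta>, \<gamma>) | \<beta> + \<gamma> = \<alpha>.
      of_nat (lookup \<alpha> j) * (mcoeff f \<beta> * mcoeff g \<gamma>))"
    by (simp add: mcoeff_mult sum_distrib_left case_prod_unfold)
  also have "\<dots> = (\<Sum>(\<beta>, \<gamma>) | \<beta> + \<gamma> = \<alpha>. mcoeff (theta j f) \<beta> * mcoeff g \<gamma> + mcoeff f \<beta> * mcoeff (theta j g) \<gamma>)"
    by (rule sum.cong) (auto simp: lookup_add algebra_simps)
  also have "\<dots> = mcoeff (theta j f * g + f * theta j g) \<alpha>"
    by (simp add: mcoeff_mult case_prod_unfold sum.distrib)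
  finally show "mcoeff (theta j (f * g)) \<alpha> = mcoeff (theta j f * g + f * theta j g) \<alpha>" .
qed

lemma theta_power_sum: "theta j (power_sum k) = mscale (of_nat k) (monomial_mps (single j k))"
proof (rule mps_eqI)
  fix \<alpha>
  show "mcoeff (theta j (power_sum k)) \<alpha> = mcoeff (mscale (of_nat k) (monomial_mps (single j k))) \<alpha>"
    by (cases "k = 0"; cases "\<alpha> = single j k")
       (auto simp: power_sum_def mcoeff_mono lookup_single when_def)
qed

lemma theta_p_sym:
  "theta j (p_sym \<nu>) = (\<Sum>k\<in>#\<nu>. mscale (of_nat k) (monomial_mps (single j k) * p_sym (\<nu> - {#k#})))"
proof (induction \<nu>)
  case empty
  show ?case by (rule mps_eqI) (auto simp: mcoeff_1)
next
  case (add x \<nu>)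
  have "theta j (p_sym (add_mset x \<nu>) :: 'a mps) = mscale (of_nat x) (monomial_mps (single j x) * p_sym \<nu>) +
      (\<Sum>k\<in>#\<nu>. power_sum x * mscale (of_nat k) (monomial_mps (single j k) * p_sym (\<nu> - {#k#})))"
    by (simp add: theta_mult theta_power_sum add mscale_mult_left sum_mset_distrib_left)
  also have "(\<Sum>k\<in>#\<nu>. power_sum x * mscale (of_nat k) (monomial_mps (single j k) * p_sym (\<nu> - {#k#}))) =
      (\<Sum>k\<in>#\<nu>. mscale (of_nat k) (monomial_mps (single j k) * p_sym (add_mset x \<nu> - {#k#})) :: 'a mps)"
  proof (intro arg_cong[where f = sum_mset] image_mset_cong)
    fix k assume "k \<in># \<nu>"
    then have "add_mset x \<nu> - {#k#} = add_mset x (\<nu> - {#k#})" by simp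
    then show "power_sum x * mscale (of_nat k) (monomial_mps (single j k) * p_sym (\<nu> - {#k#})) =
        mscale (of_nat k) (monomial_mps (single j k) * p_sym (add_mset x \<nu> - {#k#}) :: 'a mps)"
      by (simp add: mscale_mult_right ac_simps)
  qed
  finally show ?case by simp
qed

lemma sum_mset_conv_sum: "(\<Sum>k\<in>#\<nu>. f k) = (\<Sum>k\<in>set_mset \<nu>. of_nat (count \<nu> k) * (f k :: 'a::comm_semiring_1))"
proof (induction \<nu>)
  case (add x \<nu>)
  have "(\<Sum>k\<in>set_mset (add_mset x \<nu>). of_nat (count (add_mset x \<nu>) k) * f k) =
      (\<Sum>k\<in>set_mset (add_mset x \<nu>). of_nat (count \<nu> k) * f k + (if k = x then f x else 0))"
    by (rule sum.cong) (auto simp: algebra_simps)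
  also have "\<dots> = (\<Sum>k\<in>set_mset (add_mset x \<nu>). of_nat (count \<nu> k) * f k) + f x"
    by (simp add: sum.distrib)
  also have "(\<Sum>k\<in>set_mset (add_mset x \<nu>). of_nat (count \<nu> k) * f k) = (\<Sum>k\<in>set_mset \<nu>. of_nat (count \<nu> k) * f k)"
    by (rule sum.mono_neutral_right) (auto simp: not_in_iff)
  finally show ?case using add by (simp add: add.commute)
qed simp

lemma mcoeff_mono_single_mult:
  "mcoeff (monomial_mps (single j k) * f) \<beta> = (if k \<le> lookup \<beta> j then mcoeff f (\<beta> - single j k) else 0)"
proof (cases "k \<le> lookup \<beta> j")
  case True
  then have "\<beta> = single j k + (\<beta> - single j k)" by (simp add: single_plus_minus)
  then show ?thesis using True mcoeff_mono_mult by metis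
next
  case False
  have "\<beta> \<noteq> single j k + \<gamma>" for \<gamma>
  proof
    assume "\<beta> = single j k + \<gamma>"
    then have "lookup \<beta> j = k + lookup \<gamma> j" by (simp add: lookup_add)
    then show False using False by simp
  qed
  then show ?thesis using False by (simp add: mcoeff_mono_mult_0)
qed

text \<open>The coefficients of \<open>theta_p_sym\<close>, with equal parts collected.\<close>

lemma lookup_mult_mcoeff_p_sym:
  "of_nat (lookup \<beta> j) * mcoeff (p_sym \<nu> :: 'a::field mps) \<beta> = (\<Sum>k\<in>set_mset \<nu>.
    if k \<le> lookup \<beta> j then of_nat (count \<nu> k * k) * mcoeff (p_sym (\<nu> - {#k#})) (\<beta> - single j k) else 0)"
proof -
  have ms: "mcoeff (\<Sum>k\<in>#\<nu>. f k) \<beta> = (\<Sum>k\<in>#\<nu>. mcoeff (f k) \<beta>)" for f :: "nat \<Rightarrow> 'a mps"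
    by (induction \<nu>) auto
  have "of_nat (lookup \<beta> j) * mcoeff (p_sym \<nu> :: 'a mps) \<beta> = mcoeff (theta j (p_sym \<nu>)) \<beta>"
    by simp
  also have "\<dots> = (\<Sum>k\<in>set_mset \<nu>. of_nat (count \<nu> k) *
      (of_nat k * (if k \<le> lookup \<beta> j then mcoeff (p_sym (\<nu> - {#k#})) (\<beta> - single j k) else 0)))"
    unfolding theta_p_sym ms mcoeff_mscale mcoeff_mono_single_mult by (rule sum_mset_conv_sum)
  finally show ?thesis by (auto intro!: sum.cong)
qed

section \<open>Weighted complete functions as coefficients of a Cauchy kernel\<close>

definition parts_of :: "nat \<Rightarrow> nat multiset set"
  where "parts_of n = {\<nu>. 0 \<notin># \<nu> \<and> sum_mset \<nu> = n}"

lemma finite_parts_of: "finite (parts_of n)"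
proof (rule finite_surj)
  show "finite (mparts_deg 0 n)" by (rule finite_mparts_deg)
  show "parts_of n \<subseteq> snd ` mparts_deg 0 n"
    by (auto simp: parts_of_def mparts_deg_def mparts_def pdeg_def image_iff)
qed

lemma z_coeff_add: "z_coeff (add_mset k \<nu>) = k * Suc (count \<nu> k) * z_coeff \<nu>"
proof -
  let ?f = "\<lambda>\<rho> i. i ^ count \<rho> i * fact (count \<rho> i) :: nat"
  have *: "z_coeff \<rho> = ?f \<rho> k * (\<Prod>i\<in>set_mset \<rho> - {k}. ?f \<rho> i)" for \<rho>
    unfolding z_coeff_def by (cases "k \<in># \<rho>") (auto simp: prod.remove not_in_iff)
  have "(\<Prod>i\<in>set_mset (add_mset k \<nu>) - {k}. ?f (add_mset k \<nu>) i) = (\<Prod>i\<in>set_mset \<nu> - {k}. ?f \<nu> i)"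
    by (intro prod.cong) auto
  then show ?thesis by (simp add: *[of \<nu>] *[of "add_mset k \<nu>"] algebra_simps del: set_mset_add_mset_insert)
qed

lemma z_coeff_pos: "0 \<notin># \<nu> \<Longrightarrow> z_coeff \<nu> > 0"
  unfolding z_coeff_def by (rule prod_pos) (auto intro!: Nat.gr0I)

text \<open>
  The following weighted versions of \<open>h\<^sub>r\<close> and of products of them specialise both to the \<open>h\<^sub>r\<close>
  (\<open>w k = 1\<close>) and to the \<open>h\<^sub>r[X/(1-q)]\<close> (\<open>w k = 1/(1-q\<^sup>k)\<close>).
\<close>

definition p_weight :: "(nat \<Rightarrow> 'a::field) \<Rightarrow> nat multiset \<Rightarrow> 'a"
  where "p_weight w \<nu> = (\<Prod>k\<in>#\<nu>. w k) / of_nat (z_coeff \<nu>)"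

definition hw :: "(nat \<Rightarrow> 'a::field) \<Rightarrow> nat \<Rightarrow> 'a mps"
  where "hw w r = (\<Sum>\<nu>\<in>parts_of r. mscale (p_weight w \<nu>) (p_sym \<nu>))"

text \<open>The coefficient of y^\<beta> in the Cauchy kernel, the sum over \<nu> of
  \<open>p_weight w \<nu>\<close> times p_\<nu>(x) p_\<nu>(y).\<close>

definition hw_mono :: "(nat \<Rightarrow> 'a::field) \<Rightarrow> (nat \<Rightarrow>\<^sub>0 nat) \<Rightarrow> 'a mps"
  where "hw_mono w \<beta> = (\<Sum>\<nu>\<in>parts_of (mdeg \<beta>). mscale (p_weight w \<nu> * mcoeff (p_sym \<nu>) \<beta>) (p_sym \<nu>))"

lemma p_weight_diff:
  fixes w :: "nat \<Rightarrow> 'a::field_char_0"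
  assumes "k \<in># \<nu>" "0 \<notin># \<nu>"
  shows "p_weight w \<nu> * of_nat (count \<nu> k * k) = w k * p_weight w (\<nu> - {#k#})"
proof -
  obtain \<rho> where \<rho>: "\<nu> = add_mset k \<rho>" using assms(1) by (metis insert_DiffM)
  have "of_nat (z_coeff \<rho>) \<noteq> (0 :: 'a)" "of_nat k \<noteq> (0 :: 'a)" "of_nat (Suc (count \<rho> k)) \<noteq> (0 :: 'a)"
    using z_coeff_pos[of \<rho>] assms(2) unfolding \<rho> of_nat_eq_0_iff by auto
  then show ?thesis
    unfolding \<rho> p_weight_def z_coeff_add of_nat_mult
    by (simp add: divide_simps del: of_nat_Suc)
qed

lemma mdeg_minus_single: "k \<le> lookup \<beta> j \<Longrightarrow> mdeg (\<beta> - single j k) = mdeg \<beta> - k"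
proof -
  assume "k \<le> lookup \<beta> j"
  then have "\<beta> = single j k + (\<beta> - single j k)" by (simp add: single_plus_minus)
  then have "mdeg \<beta> = k + mdeg (\<beta> - single j k)" by (metis mdeg_add mdeg_single)
  then show ?thesis by simp
qed

lemma lookup_le_mdeg: "lookup \<beta> j \<le> mdeg \<beta>"
  using mdeg_minus_single[of "lookup \<beta> j" \<beta> j]
  by (metis le_add2 lookup_add lookup_single_eq mdeg_add mdeg_single poly_mapping_split)

text \<open>Euler's operator in y_j multiplies the kernel's coefficient by the exponent of y_j and
  turns p_\<nu>(y) into a sum over removed parts \<open>k\<close>. By \<open>p_weight_diff\<close>
  the multiplicity factors cancel, and the removed part stays behind as \<open>w k\<close> times
  p_k(x).\<close>

lemma hw_mono_rec:
  fixes w :: "nat \<Rightarrow> 'a::field_char_0"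
  shows "mscale (of_nat (lookup \<beta> j)) (hw_mono w \<beta>) =
    (\<Sum>k=1..lookup \<beta> j. mscale (w k) (power_sum k * hw_mono w (\<beta> - single j k)))"
proof -
  let ?b = "lookup \<beta> j" and ?n = "mdeg \<beta>"
  let ?F = "\<lambda>k \<nu>. mscale (w k * (p_weight w \<nu> * mcoeff (p_sym \<nu>) (\<beta> - single j k))) (power_sum k * p_sym \<nu> :: 'a mps)"
  have "mscale (of_nat ?b) (hw_mono w \<beta>) =
      (\<Sum>\<nu>\<in>parts_of ?n. mscale (p_weight w \<nu> * (of_nat ?b * mcoeff (p_sym \<nu>) \<beta>)) (p_sym \<nu>))"
    by (simp add: hw_mono_def mps.scale_sum_right ac_simps)
  also have "\<dots> = (\<Sum>\<nu>\<in>parts_of ?n. \<Sum>k | k \<in># \<nu> \<and> k \<le> ?b. ?F k (\<nu> - {#k#}))"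
  proof (rule sum.cong)
    fix \<nu> assume "\<nu> \<in> parts_of ?n"
    then have \<nu>: "0 \<notin># \<nu>" by (simp add: parts_of_def)
    let ?g = "\<lambda>k. of_nat (count \<nu> k * k) * mcoeff (p_sym (\<nu> - {#k#})) (\<beta> - single j k)"
    have "of_nat ?b * mcoeff (p_sym \<nu> :: 'a mps) \<beta> = (\<Sum>k | k \<in># \<nu> \<and> k \<le> ?b. ?g k)"
      unfolding lookup_mult_mcoeff_p_sym by (subst sum.inter_filter) auto
    then have "mscale (p_weight w \<nu> * (of_nat ?b * mcoeff (p_sym \<nu>) \<beta>)) (p_sym \<nu>) =
        (\<Sum>k | k \<in># \<nu> \<and> k \<le> ?b. mscale (p_weight w \<nu> * ?g k) (p_sym \<nu>))"
      by (simp add: sum_distrib_left mps.scale_sum_left)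
    also have "\<dots> = (\<Sum>k | k \<in># \<nu> \<and> k \<le> ?b. ?F k (\<nu> - {#k#}))"
    proof (rule sum.cong)
      fix k assume "k \<in> {k. k \<in># \<nu> \<and> k \<le> ?b}"
      then have k: "k \<in># \<nu>" by simp
      have "p_sym \<nu> = power_sum k * (p_sym (\<nu> - {#k#}) :: 'a mps)"
        using k by (metis insert_DiffM p_sym_add)
      moreover have "p_weight w \<nu> * ?g k = w k * (p_weight w (\<nu> - {#k#}) * mcoeff (p_sym (\<nu> - {#k#})) (\<beta> - single j k))"
        using p_weight_diff[OF k \<nu>, of w] by (metis mult.assoc)
      ultimately show "mscale (p_weight w \<nu> * ?g k) (p_sym \<nu>) = ?F k (\<nu> - {#k#})" by simp
    qed simp
    finally show "mscale (p_weight w \<nu> * (of_nat ?b * mcoeff (p_sym \<nu>) \<beta>)) (p_sym \<nu>) =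
        (\<Sum>k | k \<in># \<nu> \<and> k \<le> ?b. ?F k (\<nu> - {#k#}))" .
  qed simp
  also have "\<dots> = (\<Sum>(\<nu>, k)\<in>(SIGMA \<nu>:parts_of ?n. {k. k \<in># \<nu> \<and> k \<le> ?b}). ?F k (\<nu> - {#k#}))"
    using finite_parts_of by (intro sum.Sigma) auto
  \<comment> \<open>A partition with a marked part \<open>k\<close> corresponds to \<open>k\<close>
    and the partition without it. The exponent of one variable is at most the degree, so
    \<open>?n - k\<close> is a true difference.\<close>
  also have "\<dots> = (\<Sum>(k, \<nu>)\<in>(SIGMA k:{1..?b}. parts_of (?n - k)). ?F k \<nu>)"
    by (rule sum.reindex_bij_witness[where j = "\<lambda>(\<nu>, k). (k, \<nu> - {#k#})" and i = "\<lambda>(k, \<nu>). (add_mset k \<nu>, k)"])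
       (use lookup_le_mdeg[of \<beta> j] in \<open>auto simp: parts_of_def sum_mset.remove Suc_le_eq in_diff_count intro: Nat.gr0I dest: in_diffD\<close>)
  also have "\<dots> = (\<Sum>k=1..?b. \<Sum>\<nu>\<in>parts_of (?n - k). ?F k \<nu>)"
    using finite_parts_of by (intro sum.Sigma[symmetric]) auto
  also have "\<dots> = (\<Sum>k=1..?b. mscale (w k) (power_sum k * hw_mono w (\<beta> - single j k)))"
    by (intro sum.cong)
       (auto simp: hw_mono_def mdeg_minus_single sum_distrib_left mps.scale_sum_right mscale_mult_right)
  finally show ?thesis .
qed

text \<open>Every factor must contribute its power of the same variable. So \<open>hw\<close> is the
  kernel restricted to one variable y_j.\<close>

lemma mcoeff_p_sym_single: "mcoeff (p_sym \<nu>) (single j (sum_mset \<nu>)) = (1 :: 'a::field)" if "0 \<notin># \<nu>"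
  using that
proof (induction \<nu>)
  case empty
  then show ?case by (simp add: mcoeff_1)
next
  case (add k \<nu>)
  then have k: "k > 0" by (metis gr0I union_single_eq_member)
  let ?\<beta> = "single j (k + sum_mset \<nu>)"
  have "{i. i \<in> keys ?\<beta> \<and> k \<le> lookup ?\<beta> i} = {j}" using k by (auto simp: lookup_single when_def)
  moreover have "?\<beta> - single j k = single j (sum_mset \<nu>)"
    by (metis add_diff_cancel_left' single_add)
  ultimately show ?case using add by (simp add: mcoeff_power_sum_mult[OF k])
qed

lemma hw_mono_single: "hw_mono w (single j r) = hw w r"
  unfolding hw_mono_def hw_def mdeg_single
  by (rule sum.cong) (auto simp: parts_of_def mcoeff_p_sym_single)

lemma parts_of_0: "parts_of 0 = {{#}}"
  unfolding parts_of_def by (auto simp: sum_mset_0_iff) (metis multiset_nonemptyE)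

lemma hw_0 [simp]: "hw w 0 = 1"
  by (simp add: hw_def parts_of_0 p_weight_def z_coeff_def)

lemma hw_mono_0: "hw_mono w 0 = 1"
  using hw_mono_single[of w 0 0] by simp

lemma hw_rec:
  fixes w :: "nat \<Rightarrow> 'a::field_char_0"
  shows "mscale (of_nat r) (hw w r) = (\<Sum>k=1..r. mscale (w k) (power_sum k * hw w (r - k)))"
proof -
  have "single 0 r - single 0 k = single 0 (r - k)" for k :: nat by (rule single_diff[symmetric])
  then show ?thesis
    using hw_mono_rec[of "single 0 r" 0 w] by (simp add: hw_mono_single)
qed

lemma mscale_of_nat_cancel:
  fixes f :: "'a::field_char_0 mps"
  shows "mscale (of_nat r) f = mscale (of_nat r) g \<Longrightarrow> r > 0 \<Longrightarrow> f = g"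
  by (auto simp: mps_eq_iff)

text \<open>Both sides satisfy the same recurrence in a variable \<open>j\<close> that occurs,
  because on the right only the factor of \<open>j\<close> changes, by \<open>hw_rec\<close>.
  Cancelling the exponent of \<open>j\<close> uses characteristic 0. The set \<open>A\<close> may
  exceed the support since \<open>hw w 0 = 1\<close>.\<close>

lemma hw_mono_eq_prod:
  fixes w :: "nat \<Rightarrow> 'a::field_char_0"
  assumes "finite A" "keys \<beta> \<subseteq> A"
  shows "hw_mono w \<beta> = (\<Prod>j\<in>A. hw w (lookup \<beta> j))"
  using assms(2)
proof (induction "mdeg \<beta>" arbitrary: \<beta> rule: less_induct)
  case less
  show ?case
  proof (cases "\<beta> = 0")
    case True
    then show ?thesis by (simp add: hw_mono_0)
  next
    case False
    then obtain j where j: "j \<in> keys \<beta>" by (metis ex_in_conv keys_eq_empty)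
    let ?b = "lookup \<beta> j"
    let ?R = "\<Prod>i\<in>A - {j}. hw w (lookup \<beta> i)"
    have b: "?b > 0" using j by (simp add: in_keys_iff)
    have jA: "j \<in> A" using j less.prems by auto
    have "mscale (of_nat ?b) (hw_mono w \<beta>) =
        (\<Sum>k=1..?b. mscale (w k) (power_sum k * (hw w (?b - k) * ?R)))"
      unfolding hw_mono_rec
    proof (rule sum.cong)
      fix k assume k: "k \<in> {1..?b}"
      let ?\<gamma> = "\<beta> - single j k"
      have "mdeg ?\<gamma> < mdeg \<beta>" using k lookup_le_mdeg[of \<beta> j] by (auto simp: mdeg_minus_single)
      moreover have "keys ?\<gamma> \<subseteq> A"
        using less.prems by (auto simp: in_keys_iff lookup_minus)
      ultimately have "hw_mono w ?\<gamma> = (\<Prod>i\<in>A. hw w (lookup ?\<gamma> i))" by (rule less.hyps)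
      also have "\<dots> = hw w (lookup ?\<gamma> j) * (\<Prod>i\<in>A - {j}. hw w (lookup ?\<gamma> i))"
        using jA assms(1) by (rule prod.remove[rotated])
      also have "(\<Prod>i\<in>A - {j}. hw w (lookup ?\<gamma> i)) = ?R"
        by (rule prod.cong) (auto simp: lookup_minus lookup_single when_def)
      finally show "mscale (w k) (power_sum k * hw_mono w ?\<gamma>) = mscale (w k) (power_sum k * (hw w (?b - k) * ?R))"
        by (simp add: lookup_minus)
    qed simp
    also have "\<dots> = mscale (of_nat ?b) (hw w ?b * ?R)"
      unfolding mscale_mult_left[symmetric] hw_rec
      by (simp add: sum_distrib_right mscale_mult_left mult.assoc)
    also have "hw w ?b * ?R = (\<Prod>j\<in>A. hw w (lookup \<beta> j))"
      using jA assms(1) by (simp add: prod.remove)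
    finally show ?thesis using b by (rule mscale_of_nat_cancel)
  qed
qed

lemma h_sym_0: "h_sym 0 = 1"
proof (rule mps_eqI)
  fix \<alpha>
  have "mdeg \<alpha> = 0 \<longleftrightarrow> \<alpha> = 0"
    using lookup_le_mdeg[of \<alpha>] by (auto intro!: poly_mapping_eqI)
  then show "mcoeff (h_sym 0) \<alpha> = mcoeff 1 \<alpha>" by (simp add: h_sym_def mcoeff_1)
qed

text \<open>At a monomial of degree \<open>r\<close> the right-hand side counts the pairs of a
  variable \<open>i\<close> and a \<open>k\<close> between 1 and its exponent, and there are
  \<open>r\<close> of them.\<close>

lemma h_sym_rec: "mscale (of_nat r) (h_sym r) = (\<Sum>k=1..r. power_sum k * h_sym (r - k) :: 'a::field mps)"
proof (rule mps_eqI)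
  fix \<alpha>
  have *: "mcoeff (power_sum k * h_sym (r - k)) \<alpha> =
      (\<Sum>i\<in>keys \<alpha>. if k \<le> lookup \<alpha> i \<and> mdeg \<alpha> = r then 1 else 0 :: 'a)" if k: "k \<in> {1..r}" for k
  proof -
    have c: "mcoeff (h_sym (r - k)) (\<alpha> - single i k) = (if mdeg \<alpha> = r then 1 else 0 :: 'a)"
      if "k \<le> lookup \<alpha> i" for i
      using k that lookup_le_mdeg[of \<alpha> i] by (auto simp: h_sym_def mdeg_minus_single)
    have "k > 0" using k by simp
    then have "mcoeff (power_sum k * h_sym (r - k)) \<alpha> =
        (\<Sum>i | i \<in> keys \<alpha> \<and> k \<le> lookup \<alpha> i. if mdeg \<alpha> = r then 1 else 0 :: 'a)"
      by (simp add: mcoeff_power_sum_mult c)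
    also have "\<dots> = (\<Sum>i\<in>keys \<alpha>. if k \<le> lookup \<alpha> i then if mdeg \<alpha> = r then 1 else 0 else 0)"
      by (rule sum.inter_filter) simp
    finally show ?thesis by (auto intro!: sum.cong)
  qed
  have **: "(\<Sum>k=1..r. if k \<le> lookup \<alpha> i \<and> mdeg \<alpha> = r then 1 else 0 :: 'a) =
      (if mdeg \<alpha> = r then of_nat (lookup \<alpha> i) else 0)" for i
  proof (cases "mdeg \<alpha> = r")
    case True
    then have "{1..r} \<inter> {k. k \<le> lookup \<alpha> i} = {1..lookup \<alpha> i}" using lookup_le_mdeg[of \<alpha> i] by auto
    then show ?thesis using True by (simp add: sum.If_cases)
  qed simp
  have "mcoeff (\<Sum>k=1..r. power_sum k * h_sym (r - k)) \<alpha> =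
      (\<Sum>k=1..r. \<Sum>i\<in>keys \<alpha>. if k \<le> lookup \<alpha> i \<and> mdeg \<alpha> = r then 1 else 0 :: 'a)"
    unfolding mcoeff_sum by (rule sum.cong) (auto simp: *)
  also have "\<dots> = (\<Sum>i\<in>keys \<alpha>. if mdeg \<alpha> = r then of_nat (lookup \<alpha> i) else 0)"
    by (subst sum.swap) (simp only: **)
  also have "\<dots> = mcoeff (mscale (of_nat r) (h_sym r)) \<alpha>"
    by (auto simp: h_sym_def mdeg_def)
  finally show "mcoeff (mscale (of_nat r) (h_sym r)) \<alpha> = mcoeff (\<Sum>k=1..r. power_sum k * h_sym (r - k) :: 'a mps) \<alpha>" ..
qed

lemma h_sym_eq_hw: "h_sym r = (hw (\<lambda>_. 1) r :: 'a::field_char_0 mps)"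
proof (induction r rule: less_induct)
  case (less r)
  show ?case
  proof (cases "r = 0")
    case False
    have "mscale (of_nat r) (h_sym r) = mscale (of_nat r) (hw (\<lambda>_. 1) r :: 'a mps)"
      unfolding h_sym_rec hw_rec using less.IH False by (intro sum.cong) auto
    then show ?thesis by (rule mscale_of_nat_cancel) (use False in simp)
  qed (simp add: h_sym_0)
qed

section \<open>The functions h_\<Lambda> in the basis x^b p_\<nu>\<close>

lemma prod_nth_conv_prod_mset: "(\<Prod>i=0..<length xs. f (xs ! i)) = (\<Prod>x\<in>#mset xs. f x)"
proof -
  have "(\<Prod>i<length xs. f (xs ! i)) = (\<Prod>x\<in>#mset xs. f x)"
    by (induction xs) (simp_all add: prod.lessThan_Suc_shift del: prod.lessThan_Suc)
  then show ?thesis by (simp only: lessThan_atLeast0)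
qed

lemma prod_lessThan_add:
  fixes m l :: nat
  shows
  "(\<Prod>i<m + l. g i) = (\<Prod>i<m. g i) * (\<Prod>i=0..<l. g (i + m) :: 'a::comm_monoid_mult)"
  by (induction l) (simp_all add: mult.assoc add.commute)

lemma prod_sum_lists:
  fixes F :: "nat \<Rightarrow> nat \<Rightarrow> 'b::comm_semiring_1"
  assumes "length a = m"
  shows "(\<Prod>i<m. \<Sum>c\<le>a ! i. F i c) = (\<Sum>b | length b = m \<and> (\<forall>i<m. b ! i \<le> a ! i). \<Prod>i<m. F i (b ! i))"
proof -
  have "(\<Prod>i<m. \<Sum>c\<le>a ! i. F i c) = (\<Sum>g\<in>PiE {..<m} (\<lambda>i. {..a ! i}). \<Prod>i<m. F i (g i))"
    by (rule prod_sum_PiE) auto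
  also have "\<dots> = (\<Sum>b | length b = m \<and> (\<forall>i<m. b ! i \<le> a ! i). \<Prod>i<m. F i (b ! i))"
  proof (rule sum.reindex_bij_witness
      [where i = "\<lambda>b. restrict ((!) b) {..<m}" and j = "\<lambda>g. map g [0..<m]"])
    fix g assume g: "g \<in> PiE {..<m} (\<lambda>i. {..a ! i})"
    show "restrict ((!) (map g [0..<m])) {..<m} = g"
      by (rule extensionalityI[of _ "{..<m}"]) (use g in \<open>auto simp: PiE_def\<close>)
    show "map g [0..<m] \<in> {b. length b = m \<and> (\<forall>i<m. b ! i \<le> a ! i)}"
      using g by (auto simp: PiE_iff)
    show "(\<Prod>i<m. F i (map g [0..<m] ! i)) = (\<Prod>i<m. F i (g i))"
      by (rule prod.cong) auto
  next
    fix b assume b: "b \<in> {b. length b = m \<and> (\<forall>i<m. b ! i \<le> a ! i)}"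
    show "map (restrict ((!) b) {..<m}) [0..<m] = b"
      using b by (intro nth_equalityI) auto
    show "restrict ((!) b) {..<m} \<in> PiE {..<m} (\<lambda>i. {..a ! i})"
      using b by auto
  qed
  finally show ?thesis .
qed

text \<open>With \<open>u = 1/q\<close>, the weights \<open>w k = 1\<close> give h_\<Lambda>(x;q),
  and \<open>w k = 1/(1-q^k)\<close> gives h_\<Lambda>[X/(1-q);q].\<close>

definition hwx :: "(nat \<Rightarrow> 'a::field) \<Rightarrow> 'a \<Rightarrow> mpart \<Rightarrow> 'a mps"
  where "hwx w u \<Lambda> = (case \<Lambda> of (a, \<mu>) \<Rightarrow>
    (\<Prod>i<length a. \<Sum>c\<le>a ! i. mscale (u ^ c) (X i ^ c * hw w (a ! i - c))) * (\<Prod>r\<in>#\<mu>. hw w r))"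

text \<open>Taking the power \<open>b ! i\<close> of \<open>X i\<close> from each factor leaves a
  product of \<open>hw\<close> whose indices are the exponents of
  \<open>mexp \<Lambda> - expo b\<close>, that is, a coefficient of the kernel. The matrix that
  results is, up to weights, the transpose of that in \<open>xp_fun_expansion\<close>; the duality
  with the monomials rests on this.\<close>

lemma hwx_expansion:
  fixes w :: "nat \<Rightarrow> 'a::field_char_0"
  assumes "\<Lambda> \<in> mparts_deg m n"
  shows "hwx w u \<Lambda> = (\<Sum>\<Gamma>\<in>mparts_deg m n.
    mscale (u ^ sum_list (fst \<Gamma>) * p_weight w (snd \<Gamma>) * mcoeff (xp_fun \<Gamma>) (mexp \<Lambda>)) (xp_fun \<Gamma>))"
proof -
  obtain a \<mu> where L: "\<Lambda> = (a, \<mu>)" "length a = m" "0 \<notin># \<mu>" "sum_list a + sum_mset \<mu> = n"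
    using assms by (auto simp: mparts_deg_def mparts_def pdeg_def)
  let ?p = "parts_desc \<mu>"
  define B where "B = {b. length b = m \<and> (\<forall>i<m. b ! i \<le> a ! i)}"
  have sum_le: "sum_list b \<le> sum_list a" if "b \<in> B" for b
    using that L by (auto simp: B_def sum_list_sum_nth intro!: sum_mono)
  have finB: "finite B"
  proof (rule finite_subset)
    show "B \<subseteq> {b. set b \<subseteq> {..sum_list a} \<and> length b = m}"
      using sum_le by (auto simp: B_def intro: order_trans[OF member_le_sum_list])
  qed (rule finite_lists_length_eq, simp)
  have lk: "lookup (mexp \<Lambda>) k = (if k < m then a ! k else if k < m + length ?p then ?p ! (k - m) else 0)" for k
    by (auto simp: mexp_def L lookup_expo nth_append)
  have split: "mexp \<Lambda> = expo b + (mexp \<Lambda> - expo b)" if "b \<in> B" for b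
    using that by (intro poly_mapping_eqI) (auto simp: lookup_add lookup_minus lk lookup_expo B_def)
  have deg: "mdeg (mexp \<Lambda>) = n"
    using assms by (simp add: mdeg_eq_pdeg[of _ m] mparts_deg_def mtype_mexp)
  have deg_b: "mdeg (mexp \<Lambda> - expo b) = n - sum_list b" if "b \<in> B" for b
    using arg_cong[OF split[OF that], of mdeg] by (simp add: mdeg_add deg mdeg_expo)
  have hw_b: "(\<Prod>i<m. hw w (a ! i - b ! i)) * (\<Prod>r\<in>#\<mu>. hw w r) = hw_mono w (mexp \<Lambda> - expo b)"
    if b: "b \<in> B" for b
  proof -
    have lkb: "lookup (mexp \<Lambda> - expo b) i = (if i < m then a ! i - b ! i else lookup (mexp \<Lambda>) i)" for i
      using b by (auto simp: lookup_minus lk lookup_expo B_def)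
    have "hw_mono w (mexp \<Lambda> - expo b) = (\<Prod>i<m + length ?p. hw w (lookup (mexp \<Lambda> - expo b) i))"
      by (rule hw_mono_eq_prod) (auto simp: in_keys_iff lkb lk split: if_splits)
    also have "\<dots> = (\<Prod>i<m. hw w (lookup (mexp \<Lambda> - expo b) i)) *
        (\<Prod>i=0..<length ?p. hw w (lookup (mexp \<Lambda> - expo b) (i + m)))"
      by (rule prod_lessThan_add)
    also have "(\<Prod>i<m. hw w (lookup (mexp \<Lambda> - expo b) i)) = (\<Prod>i<m. hw w (a ! i - b ! i))"
      by (rule prod.cong) (auto simp: lkb)
    also have "(\<Prod>i=0..<length ?p. hw w (lookup (mexp \<Lambda> - expo b) (i + m))) = (\<Prod>i=0..<length ?p. hw w (?p ! i))"
      by (rule prod.cong) (auto simp: lkb lk)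
    also have "\<dots> = (\<Prod>r\<in>#\<mu>. hw w r)"
      using prod_nth_conv_prod_mset[where f = "hw w" and xs = ?p] by (simp only: mset_parts_desc)
    finally show ?thesis ..
  qed
  let ?G = "\<lambda>b \<nu>. mscale (u ^ sum_list b * p_weight w \<nu> * mcoeff (xp_fun (b, \<nu>)) (mexp \<Lambda>)) (xp_fun (b, \<nu>) :: 'a mps)"
  have "hwx w u \<Lambda> = (\<Sum>b\<in>B. (\<Prod>i<m. mscale (u ^ (b ! i)) (X i ^ (b ! i) * hw w (a ! i - b ! i))) * (\<Prod>r\<in>#\<mu>. hw w r))"
    by (simp add: hwx_def L(1,2) prod_sum_lists B_def sum_distrib_right)
  also have "\<dots> = (\<Sum>b\<in>B. mscale (u ^ sum_list b) (x_pow b * hw_mono w (mexp \<Lambda> - expo b)))"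
  proof (rule sum.cong)
    fix b assume b: "b \<in> B"
    have "(\<Prod>i<m. mscale (u ^ (b ! i)) (X i ^ (b ! i) * hw w (a ! i - b ! i))) =
        mscale (u ^ sum_list b) (x_pow b * (\<Prod>i<m. hw w (a ! i - b ! i)))"
      using b by (simp add: mscale_prod prod.distrib x_pow_def B_def sum_list_sum_nth power_sum lessThan_atLeast0)
    then show "(\<Prod>i<m. mscale (u ^ (b ! i)) (X i ^ (b ! i) * hw w (a ! i - b ! i))) * (\<Prod>r\<in>#\<mu>. hw w r) =
        mscale (u ^ sum_list b) (x_pow b * hw_mono w (mexp \<Lambda> - expo b))"
      by (simp add: mscale_mult_left mult.assoc hw_b[OF b])
  qed simp
  also have "\<dots> = (\<Sum>b\<in>B. \<Sum>\<nu>\<in>parts_of (n - sum_list b). ?G b \<nu>)"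
  proof (rule sum.cong)
    fix b assume b: "b \<in> B"
    have "mcoeff (xp_fun (b, \<nu>)) (mexp \<Lambda>) = mcoeff (p_sym \<nu> :: 'a mps) (mexp \<Lambda> - expo b)" for \<nu>
      using mcoeff_mono_mult[of "expo b" "p_sym \<nu>" "mexp \<Lambda> - expo b"] split[OF b]
      by (simp add: xp_fun_def x_pow_conv_mono)
    then show "mscale (u ^ sum_list b) (x_pow b * hw_mono w (mexp \<Lambda> - expo b)) = (\<Sum>\<nu>\<in>parts_of (n - sum_list b). ?G b \<nu>)"
      unfolding hw_mono_def deg_b[OF b]
      by (simp add: sum_distrib_left mps.scale_sum_right mscale_mult_right xp_fun_def mult.assoc)
  qed simp
  also have "\<dots> = (\<Sum>(b, \<nu>)\<in>(SIGMA b:B. parts_of (n - sum_list b)). ?G b \<nu>)"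
    using finB finite_parts_of by (intro sum.Sigma) auto
  also have "\<dots> = (\<Sum>(b, \<nu>)\<in>mparts_deg m n. ?G b \<nu>)"
  \<comment> \<open>The additional indices have some entry \<open>b ! i\<close> above
    \<open>a ! i\<close>; then x^b does not divide the monomial \<open>mexp \<Lambda>\<close>, and
    the coefficient is 0.\<close>
  proof (rule sum.mono_neutral_left[OF finite_mparts_deg])
    show "(SIGMA b:B. parts_of (n - sum_list b)) \<subseteq> mparts_deg m n"
    proof (clarify)
      fix b \<nu> assume "b \<in> B" "\<nu> \<in> parts_of (n - sum_list b)"
      then show "(b, \<nu>) \<in> mparts_deg m n"
        using sum_le[of b] L(4) by (simp add: mparts_deg_def mparts_def pdeg_def parts_of_def B_def)
    qed
    show "\<forall>\<Gamma>\<in>mparts_deg m n - (SIGMA b:B. parts_of (n - sum_list b)). (case \<Gamma> of (b, \<nu>) \<Rightarrow> ?G b \<nu>) = 0"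
    proof
      fix \<Gamma> assume "\<Gamma> \<in> mparts_deg m n - (SIGMA b:B. parts_of (n - sum_list b))"
      then obtain b \<nu> where \<Gamma>: "\<Gamma> = (b, \<nu>)"
        and G: "(b, \<nu>) \<in> mparts_deg m n" "(b, \<nu>) \<notin> (SIGMA b:B. parts_of (n - sum_list b))"
        by (cases \<Gamma>) simp
      then have "b \<notin> B" by (auto simp: mparts_deg_def mparts_def pdeg_def parts_of_def)
      then obtain i where i: "i < m" "a ! i < b ! i" "length b = m"
        using G(1) by (auto simp: B_def mparts_deg_def mparts_def not_le)
      have "mexp \<Lambda> \<noteq> expo b + \<beta>" for \<beta>
      proof
        assume "mexp \<Lambda> = expo b + \<beta>"
        then have "lookup (mexp \<Lambda>) i = lookup (expo b + \<beta>) i" by simp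
        then show False using i by (simp add: lk lookup_add lookup_expo)
      qed
      then have "mcoeff (xp_fun (b, \<nu>) :: 'a mps) (mexp \<Lambda>) = 0"
        by (simp add: xp_fun_def x_pow_conv_mono mcoeff_mono_mult_0)
      then show "(case \<Gamma> of (b, \<nu>) \<Rightarrow> ?G b \<nu>) = 0" by (simp add: \<Gamma>)
    qed
  qed
  finally show ?thesis by (simp add: case_prod_unfold)
qed

lemma h_fun_eq_hwx: "h_fun q \<Lambda> = (hwx (\<lambda>_. 1) (inverse q) \<Lambda> :: 'a::field_char_0 mps)"
  by (simp add: h_fun_def hwx_def h_sym_eq_hw)

lemma p_weight_pleth: "p_weight (\<lambda>k. 1 / (1 - q ^ k)) \<nu> = p_weight (\<lambda>_. 1) \<nu> * (1 / (\<Prod>k\<in>#\<nu>. 1 - q ^ k))"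
proof -
  have "(\<Prod>k\<in>#\<nu>. 1 / (1 - q ^ k)) = 1 / (\<Prod>k\<in>#\<nu>. 1 - q ^ k)"
    by (induction \<nu>) auto
  then show ?thesis by (simp add: p_weight_def)
qed

text \<open>Dividing the coefficient of p_\<nu> by the factors 1 - q^k amounts to changing the
  weights from 1 to 1/(1-q^k).\<close>

lemma pleth_q_h_fun:
  fixes q :: "'a::field_char_0"
  assumes "\<Lambda> \<in> mparts_deg m n"
  shows "pleth_q m q (h_fun q \<Lambda>) = hwx (\<lambda>k. 1 / (1 - q ^ k)) (inverse q) \<Lambda>"
  unfolding h_fun_eq_hwx hwx_expansion[OF assms] pleth_q_def
  by (subst diag_map_eq[OF indep_fam_xp finite_mparts_deg mparts_deg_subset])
     (auto simp: p_weight_pleth case_prod_unfold intro!: sum.cong)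

lemma h_pleth_eq_hw: "h_pleth q r = (hw (\<lambda>k. 1 / (1 - q ^ k)) r :: 'a::field_char_0 mps)"
proof -
  have *: "h_sym r = (\<Sum>\<Gamma>\<in>Pair [] ` parts_of r. mscale (p_weight (\<lambda>_. 1) (snd \<Gamma>)) (xp_fun \<Gamma> :: 'a mps))"
    unfolding h_sym_eq_hw hw_def by (subst sum.reindex) (auto simp: inj_on_def xp_fun_def x_pow_def)
  have "h_pleth q r = (\<Sum>\<Gamma>\<in>Pair [] ` parts_of r.
      mscale (p_weight (\<lambda>_. 1) (snd \<Gamma>) * (case \<Gamma> of (a, \<mu>) \<Rightarrow> 1 / (\<Prod>k\<in>#\<mu>. 1 - q ^ k))) (xp_fun \<Gamma>))"
    unfolding h_pleth_def pleth_q_def *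
    by (rule diag_map_eq[OF indep_fam_xp])
       (simp add: finite_parts_of, auto simp: mparts_def parts_of_def)
  also have "\<dots> = hw (\<lambda>k. 1 / (1 - q ^ k)) r"
    unfolding hw_def p_weight_pleth by (subst sum.reindex) (auto simp: inj_on_def xp_fun_def x_pow_def)
  finally show ?thesis .
qed

text \<open>The power of \<open>q\<close> is spread over the factors: q^(a_i) q^(-c) is the
  coefficient q^(a_i - c) of \<open>h_pleth_x\<close>.\<close>

lemma pleth_q_h_fun_eq_prod:
  fixes q :: "'a::field_char_0"
  assumes "(a, \<mu>) \<in> mparts m" "q \<noteq> 0"
  shows "mscale (q ^ sum_list a) (pleth_q m q (h_fun q (a, \<mu>))) =
    (\<Prod>i<m. h_pleth_x q i (a ! i)) * (\<Prod>r\<in>#\<mu>. h_pleth q r)"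
proof -
  have m: "length a = m" using assms(1) by (simp add: mparts_def)
  have *: "h_pleth_x q i r = mscale (q ^ r) (\<Sum>c\<le>r. mscale (inverse q ^ c) (X i ^ c * h_pleth q (r - c)))" for i r
    unfolding h_pleth_x_def mps.scale_sum_right using assms(2)
    by (intro sum.cong) (auto simp: power_diff field_simps)
  have "(a, \<mu>) \<in> mparts_deg m (pdeg (a, \<mu>))" using assms(1) by (simp add: mparts_deg_def)
  from pleth_q_h_fun[OF this, of q] show ?thesis
    unfolding * mscale_prod mscale_mult_left
    by (simp add: hwx_def m ext[OF h_pleth_eq_hw] sum_list_sum_nth power_sum lessThan_atLeast0)
qed

section \<open>The order on \<open>m\<close>-partitions\<close>

lemma sum_list_parts_desc: "sum_list (parts_desc M) = sum_mset M"
  by (metis mset_parts_desc sum_mset_sum_list)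

lemma length_parts_desc: "length (parts_desc M) = size M"
  by (metis mset_parts_desc size_mset)

text \<open>The partial sums of \<open>M\<close> reach the common total no later than those of
  \<open>N\<close>, and a positive part of \<open>M\<close> beyond that point would exceed
  it.\<close>

lemma dominates_size:
  assumes "dominates M N" "0 \<notin># M"
  shows "size M \<le> size N"
proof -
  have "sum_list (parts_desc M) = sum_list (parts_desc N)"
    using assms(1) by (simp add: dominates_def sum_list_parts_desc)
  also have "\<dots> = sum_list (take (size N) (parts_desc N))"
    by (simp add: length_parts_desc)
  also have "\<dots> \<le> sum_list (take (size N) (parts_desc M))"
    using assms(1) by (simp add: dominates_def)
  finally have "sum_list (drop (size N) (parts_desc M)) = 0"
    using sum_list.append[of "take (size N) (parts_desc M)" "drop (size N) (parts_desc M)"] by simp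
  moreover have "0 \<notin> set (drop (size N) (parts_desc M))"
    using assms(2) by (metis in_set_dropD mset_parts_desc set_mset_mset)
  ultimately have "drop (size N) (parts_desc M) = []"
    by (cases "drop (size N) (parts_desc M)") auto
  then show ?thesis by (simp add: length_parts_desc)
qed

lemma dominates_trans: "dominates M N \<Longrightarrow> dominates N K \<Longrightarrow> dominates M K"
  unfolding dominates_def by (auto intro: order_trans)

text \<open>Differences of partial sums give the entries; trailing zeros cannot be seen, hence the
  filter.\<close>

lemma filter_eq_of_take_sums:
  fixes xs ys :: "nat list"
  assumes "\<And>k. sum_list (take k xs) = sum_list (take k ys)"
  shows "filter (\<lambda>x. x \<noteq> 0) xs = filter (\<lambda>x. x \<noteq> 0) ys"
  using assms
proof (induction xs arbitrary: ys)
  case Nil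
  then show ?case using Nil[of "length ys"] by auto
next
  case (Cons x xs)
  show ?case
  proof (cases ys)
    case Nil
    then show ?thesis using Cons.prems[of "Suc (length xs)"] by auto
  next
    case (Cons y ys')
    have xy: "x = y" using Cons.prems[of 1] Cons by simp
    have "sum_list (take k xs) = sum_list (take k ys')" for k
      using Cons.prems[of "Suc k"] Cons xy by simp
    then show ?thesis using Cons.IH xy Cons by simp
  qed
qed

lemma dominates_antisym_count:
  assumes "dominates M N" "dominates N M" "x \<noteq> 0"
  shows "count M x = count N x"
proof -
  have "filter (\<lambda>x. x \<noteq> 0) (parts_desc M) = filter (\<lambda>x. x \<noteq> 0) (parts_desc N)"
    using assms(1,2) by (intro filter_eq_of_take_sums) (auto simp: dominates_def intro: antisym)
  then have "filter_mset (\<lambda>x. x \<noteq> 0) M = filter_mset (\<lambda>x. x \<noteq> 0) N"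
    by (metis mset_filter mset_parts_desc)
  from arg_cong[OF this, of "\<lambda>K. count K x"] show ?thesis using assms(3) by simp
qed

lemma lift_part_0: "lift_part 0 (a, \<mu>) = mset a + \<mu>"
  by (simp add: lift_part_def map_nth)

lemma lift_part_Suc:
  assumes "i < length a"
  shows "lift_part (Suc i) (a, \<mu>) + {#a ! i#} = lift_part i (a, \<mu>) + {#a ! i + 1#}"
proof -
  let ?g = "\<lambda>n j. if j < n then a ! j + 1 else a ! j"
  have *: "lift_part n (a, \<mu>) = add_mset (?g n i) (image_mset (?g n) (mset_set ({0..<length a} - {i})) + \<mu>)" for n
  proof -
    have "mset_set {0..<length a} = add_mset i (mset_set ({0..<length a} - {i}))"
      using assms by (subst mset_set.remove[of _ i]) auto
    then show ?thesis by (simp add: lift_part_def)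
  qed
  have "image_mset (?g (Suc i)) (mset_set ({0..<length a} - {i})) = image_mset (?g i) (mset_set ({0..<length a} - {i}))"
    by (rule image_mset_cong) auto
  then show ?thesis by (simp add: *)
qed

lemma mpart_le_refl: "mpart_le m \<Lambda> \<Lambda>"
  by (simp add: mpart_le_def dominates_def)

lemma mpart_le_trans: "mpart_le m \<Omega> \<Gamma> \<Longrightarrow> mpart_le m \<Gamma> \<Lambda> \<Longrightarrow> mpart_le m \<Omega> \<Lambda>"
  unfolding mpart_le_def using dominates_trans by blast

text \<open>Consecutive lifts differ by replacing a part a_i with a_i + 1, so their multiplicities
  determine a_i. Once \<open>a\<close> is known, the lift 0 determines \<mu>.\<close>

lemma mpart_le_antisym:
  assumes "\<Lambda> \<in> mparts m" "\<Omega> \<in> mparts m" "mpart_le m \<Omega> \<Lambda>" "mpart_le m \<Lambda> \<Omega>"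
  shows "\<Lambda> = \<Omega>"
proof -
  obtain a \<mu> where L: "\<Lambda> = (a, \<mu>)" "length a = m" "0 \<notin># \<mu>" using assms(1) by (auto simp: mparts_def)
  obtain b \<nu> where O: "\<Omega> = (b, \<nu>)" "length b = m" "0 \<notin># \<nu>" using assms(2) by (auto simp: mparts_def)
  have cnt: "count (lift_part i (a, \<mu>)) x = count (lift_part i (b, \<nu>)) x" if "i \<le> m" "x \<noteq> 0" for i x
    using assms(3,4) that dominates_antisym_count unfolding mpart_le_def L O by blast
  have "a ! i = b ! i" if i: "i < m" for i
  proof -
    have step: "count (lift_part (Suc i) (c, \<rho>)) x + count {#c ! i#} x =
        count (lift_part i (c, \<rho>)) x + count {#c ! i + 1#} x" if "length c = m" for c \<rho> x
      using arg_cong[OF lift_part_Suc[of i c \<rho>], of "\<lambda>M. count M x"] i that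
      by (simp only: count_union)
    have "count {#a ! i + 1#} x + count {#b ! i#} x = count {#b ! i + 1#} x + count {#a ! i#} x" if "x \<noteq> 0" for x
      using cnt[of i x] cnt[of "Suc i" x] i that step[OF L(2), of \<mu> x] step[OF O(2), of \<nu> x] by linarith
    \<comment> \<open>These values are positive, so the multiplicity of zero, which dominance does
      not see, does not enter.\<close>
    from this[of "a ! i + 1"] this[of "b ! i + 1"] show ?thesis
      by (auto split: if_splits)
  qed
  then have ab: "a = b" using L O by (auto intro: nth_equalityI)
  have "count \<mu> x = count \<nu> x" for x
    using cnt[of 0 x] L O ab by (cases "x = 0") (auto simp: lift_part_0 not_in_iff)
  then show ?thesis using L O ab by (simp add: multiset_eq_iff)
qed

text \<open>The lift \<open>m\<close> makes all entries of \<open>a\<close> positive, so its size is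
  \<open>m + len\<close> even when \<open>a\<close> contains zeros, and
  \<open>dominates_size\<close> applies.\<close>

lemma mpart_le_len:
  assumes "\<Lambda> \<in> mparts m" "\<Omega> \<in> mparts m" "mpart_le m \<Omega> \<Lambda>"
  shows "len \<Lambda> \<le> len \<Omega>"
proof -
  have s: "size (lift_part m \<Gamma>) = m + len \<Gamma>" "0 \<notin># lift_part m \<Gamma>" if "\<Gamma> \<in> mparts m" for \<Gamma>
    using that by (auto simp: lift_part_def mparts_def)
  have "dominates (lift_part m \<Lambda>) (lift_part m \<Omega>)" using assms(3) by (simp add: mpart_le_def)
  from dominates_size[OF this s(2)[OF assms(1)]] show ?thesis
    by (simp add: s(1)[OF assms(1)] s(1)[OF assms(2)])
qed

lemma mpart_le_pdeg: "mpart_le m \<Omega> \<Lambda> \<Longrightarrow> pdeg \<Omega> = pdeg \<Lambda>"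
  by (cases \<Omega>; cases \<Lambda>)
     (force simp: mpart_le_def dominates_def lift_part_0 pdeg_def sum_mset_sum_list)

lemma mpart_less_trans:
  assumes "\<Omega> \<in> mparts m" "\<Gamma> \<in> mparts m" "\<Lambda> \<in> mparts m" "mpart_less m \<Omega> \<Gamma>" "mpart_less m \<Gamma> \<Lambda>"
  shows "mpart_less m \<Omega> \<Lambda>"
  using assms(4,5) mpart_le_trans[of m \<Omega> \<Gamma> \<Lambda>] mpart_le_antisym[OF assms(2,1)] unfolding mpart_less_def
  by blast

text \<open>Solves the unitriangular system for the monomials, by induction on the number of smaller
  indices. It transfers orthogonality from the \<open>P \<Gamma>\<close> to the monomials.\<close>

lemma m_fun_in_span:
  assumes P: "\<And>\<Lambda>. \<Lambda> \<in> mparts m \<Longrightarrow> \<exists>d. P \<Lambda> = m_fun \<Lambda> +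
       (\<Sum>\<Omega> | \<Omega> \<in> mparts m \<and> mpart_less m \<Omega> \<Lambda>. mscale (d \<Omega>) (m_fun \<Omega> :: 'a::field mps))"
    and "\<Lambda> \<in> mparts m"
  shows "m_fun \<Lambda> \<in> mps.span (P ` {\<Gamma> \<in> mparts m. mpart_le m \<Gamma> \<Lambda>})"
  using assms(2)
proof (induction "card {\<Omega>. \<Omega> \<in> mparts m \<and> mpart_less m \<Omega> \<Lambda>}" arbitrary: \<Lambda> rule: less_induct)
  case less
  let ?S = "\<lambda>\<Lambda>. {\<Omega>. \<Omega> \<in> mparts m \<and> mpart_less m \<Omega> \<Lambda>}"
  let ?T = "\<lambda>\<Lambda>. {\<Gamma> \<in> mparts m. mpart_le m \<Gamma> \<Lambda>}"
  obtain d where d: "P \<Lambda> = m_fun \<Lambda> + (\<Sum>\<Omega>\<in>?S \<Lambda>. mscale (d \<Omega>) (m_fun \<Omega>))"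
    using P[OF less.prems] by blast
  have "m_fun \<Omega> \<in> mps.span (P ` ?T \<Lambda>)" if O: "\<Omega> \<in> ?S \<Lambda>" for \<Omega>
  proof -
    have "?S \<Omega> \<subseteq> ?S \<Lambda>"
      using O mpart_less_trans[OF _ _ less.prems] by blast
    moreover have "\<Omega> \<in> ?S \<Lambda>" "\<Omega> \<notin> ?S \<Omega>"
      using O by (simp_all add: mpart_less_def)
    ultimately have "?S \<Omega> \<subset> ?S \<Lambda>" by blast
    then have "card (?S \<Omega>) < card (?S \<Lambda>)"
      by (intro psubset_card_mono finite_mpart_less)
    then have "m_fun \<Omega> \<in> mps.span (P ` ?T \<Omega>)" using O less.hyps by blast
    moreover have "?T \<Omega> \<subseteq> ?T \<Lambda>"
      using O mpart_le_trans[of m _ \<Omega> \<Lambda>] unfolding mpart_less_def by blast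
    ultimately show ?thesis
      using subsetD[OF mps.span_mono[OF image_mono]] by blast
  qed
  then have "(\<Sum>\<Omega>\<in>?S \<Lambda>. mscale (d \<Omega>) (m_fun \<Omega>)) \<in> mps.span (P ` ?T \<Lambda>)"
    by (rule sum_mscale_in_span)
  moreover have "P \<Lambda> \<in> mps.span (P ` ?T \<Lambda>)"
    using less.prems mpart_le_refl[of m \<Lambda>] by (intro mps.span_base imageI) simp
  ultimately have "P \<Lambda> - (\<Sum>\<Omega>\<in>?S \<Lambda>. mscale (d \<Omega>) (m_fun \<Omega>)) \<in> mps.span (P ` ?T \<Lambda>)"
    by (intro mps.span_diff)
  then show ?case unfolding d by simp
qed

section \<open>The leading behaviour of \<open>c_coeff\<close> at \<open>t = 1\<close>\<close>

lemma has_limit_t1_one_minus_power_div: "has_limit_t1 ((1 - t_Qqt ^ k) / (1 - t_Qqt)) (of_nat k)"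
proof -
  have "t_Qqt \<noteq> 1" using one_minus_t_nonzero by force
  then have "(1 - t_Qqt ^ k) / (1 - t_Qqt) = (\<Sum>i<k. t_Qqt ^ i)"
    by (simp add: one_diff_power_eq)
  moreover have "has_limit_t1 (\<Sum>i<k. t_Qqt ^ i) (\<Sum>i<k. 1 ^ i)"
    by (intro has_limit_t1_sum has_limit_t1_power has_limit_t1_t)
  ultimately show ?thesis by simp
qed

lemma has_limit_t1_one_minus_monom: "has_limit_t1 (1 - q_Qqt ^ i * t_Qqt ^ j) (1 - q_Qq ^ i)"
  using has_limit_t1_diff[OF has_limit_t1_1 has_limit_t1_mult[OF
      has_limit_t1_power[OF has_limit_t1_q, of i] has_limit_t1_power[OF has_limit_t1_t, of j]]] by simp

text \<open>What a row contributes to the limit of \<open>c_coeff\<close>, after division by 1 - t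
  if it has no circle. A circle adds 1 to every arm, so the arms run from n down to 1 and no factor
  vanishes. Without a circle they run from n - 1 down to 0, and the square of arm 0 gives (1 -
  t^l)/(1 - t), which tends to l = leg + 1.\<close>

definition row_lim :: "'a::field \<Rightarrow> (nat \<times> nat option) list \<Rightarrow> nat \<Rightarrow> 'a"
  where "row_lim q R r = (case R ! r of (n, None) \<Rightarrow>
      q_fact q (n - 1) * of_nat (Suc (length (filter (\<lambda>y. n \<le> fst y) (drop (Suc r) R)))) |
    (n, Some i) \<Rightarrow> q_fact q n)"

definition rows_lim :: "'a::field \<Rightarrow> (nat \<times> nat option) list \<Rightarrow> 'a"
  where "rows_lim q R = (\<Prod>r<length R. row_lim q R r)"

lemma rows_lim_Cons: "rows_lim q (x # R) = row_lim q (x # R) 0 * rows_lim q R"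
proof -
  have "row_lim q (x # R) (Suc r) = row_lim q R r" for r
    by (simp only: row_lim_def nth_Cons_Suc drop_Suc_Cons)
  then show ?thesis
    by (simp add: rows_lim_def prod.lessThan_Suc_shift del: prod.lessThan_Suc)
qed

lemma rows_lim_Nil [simp]: "rows_lim q [] = 1"
  by (simp add: rows_lim_def)

lemma rows_lim_Some: "rows_lim q (map (\<lambda>i. (n, Some i)) is @ R) = q_fact q n ^ length is * rows_lim q R"
  by (induction "is") (auto simp: rows_lim_Cons row_lim_def)

text \<open>From the bottom of a block of \<open>k\<close> equal rows to its top, the number leg + 1
  at the last square runs through 1, ..., k; hence the factorial.\<close>

lemma rows_lim_None:
  assumes "\<And>y. y \<in> set R \<Longrightarrow> fst y < n"
  shows "rows_lim q (replicate k (n, None) @ R) = q_fact q (n - 1) ^ k * of_nat (fact k) * rows_lim q R"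
proof -
  have "filter (\<lambda>y. n \<le> fst y) R = []"
    using assms by (auto simp: filter_empty_conv not_le)
  then show ?thesis by (induction k) (auto simp: rows_lim_Cons row_lim_def algebra_simps)
qed

definition row_block :: "mpart \<Rightarrow> nat \<Rightarrow> (nat \<times> nat option) list"
  where "row_block \<Lambda> r = map (\<lambda>i. (r, Some i)) (filter (\<lambda>i. fst \<Lambda> ! i = r) [0..<length (fst \<Lambda>)]) @
    replicate (count (snd \<Lambda>) r) (r, None)"

text \<open>The rows with fewer than \<open>N\<close> squares, so that induction on \<open>N\<close>
  adds longer rows on top and leaves the legs below unchanged.\<close>

definition row_blocks :: "mpart \<Rightarrow> nat \<Rightarrow> (nat \<times> nat option) list"
  where "row_blocks \<Lambda> N = concat (map (row_block \<Lambda>) (rev [0..<N]))"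

lemma rows_eq_row_blocks: "rows \<Lambda> = row_blocks \<Lambda> (Suc (pdeg \<Lambda>))"
  by (cases \<Lambda>) (simp add: rows_def row_blocks_def row_block_def[abs_def] pdeg_def)

lemma row_blocks_Suc: "row_blocks \<Lambda> (Suc N) = row_block \<Lambda> N @ row_blocks \<Lambda> N"
  by (simp add: row_blocks_def)

lemma set_row_blocks: "y \<in> set (row_blocks \<Lambda> N) \<Longrightarrow> fst y < N \<and> (snd y = None \<longrightarrow> fst y \<in># snd \<Lambda>)"
  by (auto simp: row_blocks_def row_block_def simp flip: count_greater_zero_iff)

lemma length_filter_nth: "length (filter (\<lambda>i. a ! i = r) [0..<length a]) = count (mset a) r"
proof -
  have "length (filter (\<lambda>i. a ! i = r) [0..<length a]) = card {i. i < length a \<and> a ! i = r}"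
    unfolding length_filter_conv_card by (rule arg_cong[where f = card]) auto
  also have "\<dots> = count (mset a) r"
    unfolding count_mset count_list_eq_length_filter length_filter_conv_card by (rule arg_cong[where f = card]) auto
  finally show ?thesis .
qed

lemma rows_lim_row_blocks: "rows_lim q (row_blocks \<Lambda> N) =
  (\<Prod>r<N. q_fact q r ^ count (mset (fst \<Lambda>)) r) *
  (\<Prod>r<N. q_fact q (r - 1) ^ count (snd \<Lambda>) r) * (\<Prod>r<N. of_nat (fact (count (snd \<Lambda>) r)))"
proof (induction N)
  case 0
  show ?case by (simp add: row_blocks_def)
next
  case (Suc N)
  have "rows_lim q (row_blocks \<Lambda> (Suc N)) = q_fact q N ^ count (mset (fst \<Lambda>)) N *
      (q_fact q (N - 1) ^ count (snd \<Lambda>) N * of_nat (fact (count (snd \<Lambda>) N)) * rows_lim q (row_blocks \<Lambda> N))"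
    unfolding row_blocks_Suc row_block_def append_assoc rows_lim_Some length_filter_nth
    by (subst rows_lim_None) (use set_row_blocks in auto)
  then show ?case unfolding Suc by (simp add: mult_ac)
qed

lemma prod_power_count:
  fixes N :: nat
  assumes "\<And>x. x \<in># M \<Longrightarrow> x < N"
  shows "(\<Prod>r<N. f r ^ count M r) = (\<Prod>x\<in>#M. f x :: 'a::comm_monoid_mult)"
  using assms
proof (induction M)
  case (add x M)
  have "(\<Prod>r<N. f r ^ count (add_mset x M) r) = (\<Prod>r<N. f r ^ count M r * (if r = x then f x else 1))"
    by (rule prod.cong) (auto simp: mult.commute)
  also have "\<dots> = (\<Prod>r<N. f r ^ count M r) * f x"
    using add.prems[of x] by (simp add: prod.distrib)
  finally show ?case using add by (simp add: mult.commute)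
qed simp

lemma pdeg_bound:
  assumes "x \<in># mset (fst \<Lambda>) + snd \<Lambda>"
  shows "x < Suc (pdeg \<Lambda>)"
proof -
  obtain M where "mset (fst \<Lambda>) + snd \<Lambda> = add_mset x M" using assms by (metis insert_DiffM)
  moreover have "pdeg \<Lambda> = sum_mset (mset (fst \<Lambda>) + snd \<Lambda>)"
    by (simp add: pdeg_def sum_mset_sum_list)
  ultimately show ?thesis by simp
qed

lemma rows_lim_rows: "rows_lim q (rows (a, \<mu>)) =
  (\<Prod>i<length a. q_fact q (a ! i)) * (\<Prod>r\<in>#\<mu>. q_fact q (r - 1)) * of_nat (aut \<mu>)"
proof -
  let ?N = "Suc (pdeg (a, \<mu>))"
  have "(\<Prod>r<?N. of_nat (fact (count \<mu> r)) :: 'a) = of_nat (aut \<mu>)"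
    unfolding aut_def of_nat_prod using pdeg_bound[of _ "(a, \<mu>)"]
    by (intro prod.mono_neutral_right) (auto simp: not_in_iff)
  moreover have "(\<Prod>r<?N. q_fact q r ^ count (mset a) r) = (\<Prod>x\<in>#mset a. q_fact q x)"
    by (rule prod_power_count, rule pdeg_bound) simp
  moreover have "(\<Prod>r<?N. q_fact q (r - 1) ^ count \<mu> r) = (\<Prod>x\<in>#\<mu>. q_fact q (x - 1))"
    by (rule prod_power_count, rule pdeg_bound) simp
  moreover have "(\<Prod>x\<in>#mset a. q_fact q x) = (\<Prod>i<length a. q_fact q (a ! i))"
    by (simp add: prod_nth_conv_prod_mset[symmetric] lessThan_atLeast0)
  ultimately show ?thesis
    unfolding rows_eq_row_blocks rows_lim_row_blocks by simp
qed

text \<open>Counts the rows without circle, each of which takes one factor 1 - t from the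
  denominator in \<open>c_coeff_limit\<close>.\<close>

lemma prod_None_rows:
  "(\<Prod>r<length (rows \<Lambda>). if snd (rows \<Lambda> ! r) = None then s else 1) = (s :: 'a::comm_monoid_mult) ^ len \<Lambda>"
proof -
  have 1: "(\<Prod>r<length R. if snd (R ! r) = None then s else 1) = s ^ length (filter (\<lambda>y. snd y = None) R)"
    for R :: "(nat \<times> nat option) list"
    by (induction R) (auto simp: prod.lessThan_Suc_shift simp del: prod.lessThan_Suc)
  have "length (filter (\<lambda>y. snd y = None) (row_blocks \<Lambda> N)) = (\<Sum>r<N. count (snd \<Lambda>) r)" for N
    by (induction N) (auto simp: row_blocks_def row_block_def filter_map o_def)
  moreover have "(\<Sum>r<Suc (pdeg \<Lambda>). count (snd \<Lambda>) r) = len \<Lambda>"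
    unfolding size_multiset_overloaded_eq using pdeg_bound[of _ \<Lambda>]
    by (intro sum.mono_neutral_right) (auto simp: not_in_iff)
  ultimately show ?thesis by (simp add: 1 rows_eq_row_blocks)
qed

lemma prod_q_fact_rev: "(\<Prod>c<n. 1 - q ^ (n - c)) = q_fact q n"
  unfolding q_fact_def
  by (rule prod.reindex_bij_witness[where i = "\<lambda>k. n - k" and j = "\<lambda>c. n - c"]) auto

lemma c_coeff_limit:
  assumes "(a, \<mu>) \<in> mparts m"
  shows "has_limit_t1 (c_coeff q_Qqt t_Qqt (a, \<mu>) / (1 - t_Qqt) ^ size \<mu>)
    ((\<Prod>i<length a. q_fact q_Qq (a ! i)) * (\<Prod>r\<in>#\<mu>. q_fact q_Qq (r - 1)) * of_nat (aut \<mu>))"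
proof -
  define \<Lambda> where "\<Lambda> = (a, \<mu>)"
  define R where "R = rows \<Lambda>"
  define f where "f r c = 1 - q_Qqt ^ arm \<Lambda> (r, c) * t_Qqt ^ (leg \<Lambda> (r, c) + 1)" for r c
  have sq: "squares \<Lambda> = (SIGMA r:{..<length R}. {..<fst (R ! r)})"
    by (auto simp: squares_def R_def)
  have row: "has_limit_t1 ((\<Prod>c<fst (R ! r). f r c) / (if snd (R ! r) = None then 1 - t_Qqt else 1)) (row_lim q_Qq R r)"
    if r: "r < length R" for r
  proof (cases "snd (R ! r)")
    case (Some i)
    then obtain n where n: "R ! r = (n, Some i)" by (metis prod.collapse)
    have "has_limit_t1 (\<Prod>c<n. f r c) (\<Prod>c<n. 1 - q_Qq ^ (n - c))"
    proof (rule has_limit_t1_prod)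
      fix c assume "c \<in> {..<n}"
      then have "arm \<Lambda> (r, c) = n - c" using n by (simp add: arm_def R_def[symmetric])
      then show "has_limit_t1 (f r c) (1 - q_Qq ^ (n - c))"
        unfolding f_def by (metis has_limit_t1_one_minus_monom)
    qed
    then show ?thesis by (simp add: n row_lim_def prod_q_fact_rev)
  next
    case None
    then obtain n where n: "R ! r = (n, None)" by (metis prod.collapse)
    have "n \<in># \<mu>"
      using set_row_blocks[of "R ! r" \<Lambda> "Suc (pdeg \<Lambda>)"] r n
      by (simp add: R_def rows_eq_row_blocks \<Lambda>_def) (metis fst_conv nth_mem snd_conv)
    \<comment> \<open>Parts of \<mu> are positive, so the row has a last square, in column
      \<open>n'\<close>. Its factor is the one that vanishes at \<open>t = 1\<close>.\<close>
    then have "n > 0" using assms by (auto simp: mparts_def intro: Nat.gr0I)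
    then obtain n' where n': "n = Suc n'" by (cases n) auto
    let ?l = "Suc (length (filter (\<lambda>y. n \<le> fst y) (drop (Suc r) R)))"
    \<comment> \<open>As the row has no circle, its leg counts only squares below; the shift by
      \<open>Suc r\<close> turns row indices into positions in
      \<open>drop (Suc r) R\<close>.\<close>
    have "{r'. r < r' \<and> (r', n') \<in> squares \<Lambda>} =
        (\<lambda>j. Suc r + j) ` {j. j < length (drop (Suc r) R) \<and> n \<le> fst (drop (Suc r) R ! j)}"
    proof (intro equalityI subsetI)
      fix r' assume "r' \<in> {r'. r < r' \<and> (r', n') \<in> squares \<Lambda>}"
      then show "r' \<in> (\<lambda>j. Suc r + j) ` {j. j < length (drop (Suc r) R) \<and> n \<le> fst (drop (Suc r) R ! j)}"
        by (intro image_eqI[of _ _ "r' - Suc r"]) (auto simp: sq n')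
    qed (auto simp: sq n')
    then have "card {r'. r < r' \<and> (r', n') \<in> squares \<Lambda>} = length (filter (\<lambda>y. n \<le> fst y) (drop (Suc r) R))"
      by (simp only: card_image[OF inj_on_add] length_filter_conv_card)
    then have "leg \<Lambda> (r, n') + 1 = ?l" "arm \<Lambda> (r, n') = 0"
      using n n' by (simp_all add: leg_def arm_def R_def[symmetric])
    then have "f r n' = 1 - t_Qqt ^ ?l" unfolding f_def by simp
    then have eq: "(\<Prod>c<fst (R ! r). f r c) / (if snd (R ! r) = None then 1 - t_Qqt else 1) =
        (\<Prod>c<n'. f r c) * ((1 - t_Qqt ^ ?l) / (1 - t_Qqt))"
      using n n' by simp
    have "has_limit_t1 (\<Prod>c<n'. f r c) (\<Prod>c<n'. 1 - q_Qq ^ (n' - c))"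
    proof (rule has_limit_t1_prod)
      fix c assume "c \<in> {..<n'}"
      then have "arm \<Lambda> (r, c) = n' - c" using n n' by (simp add: arm_def R_def[symmetric])
      then show "has_limit_t1 (f r c) (1 - q_Qq ^ (n' - c))"
        unfolding f_def by (metis has_limit_t1_one_minus_monom)
    qed
    then have "has_limit_t1 ((\<Prod>c<n'. f r c) * ((1 - t_Qqt ^ ?l) / (1 - t_Qqt))) (q_fact q_Qq n' * of_nat ?l)"
      unfolding prod_q_fact_rev by (rule has_limit_t1_mult[OF _ has_limit_t1_one_minus_power_div])
    moreover have "row_lim q_Qq R r = q_fact q_Qq n' * of_nat ?l"
      using n n' by (simp add: row_lim_def)
    ultimately show ?thesis unfolding eq by simp
  qed
  have "has_limit_t1 (\<Prod>r<length R. (\<Prod>c<fst (R ! r). f r c) / (if snd (R ! r) = None then 1 - t_Qqt else 1))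
      (rows_lim q_Qq R)"
    unfolding rows_lim_def using row by (intro has_limit_t1_prod) auto
  also have "(\<Prod>r<length R. (\<Prod>c<fst (R ! r). f r c) / (if snd (R ! r) = None then 1 - t_Qqt else 1)) =
      (\<Prod>r<length R. \<Prod>c<fst (R ! r). f r c) / (1 - t_Qqt) ^ len \<Lambda>"
    unfolding prod_dividef R_def prod_None_rows ..
  also have "(\<Prod>r<length R. \<Prod>c<fst (R ! r). f r c) = c_coeff q_Qqt t_Qqt \<Lambda>"
    unfolding c_coeff_def sq by (subst prod.Sigma) (auto simp: f_def intro!: prod.cong)
  finally show ?thesis by (simp add: R_def \<Lambda>_def rows_lim_rows)
qed

section \<open>The bilinear form near \<open>t = 1\<close>\<close>

text \<open>The form is defined through coordinates, so its linearity is established only for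
  elements of the span of finitely many basis vectors.\<close>

lemma diag_form_sum:
  assumes "indep_fam I b" "finite J" "J \<subseteq> I" "f \<in> mps.span (b ` J)" "\<And>k. k \<in> K \<Longrightarrow> g k \<in> mps.span (b ` J)"
  shows "diag_form I b v f (\<Sum>k\<in>K. mscale (e k) (g k)) = (\<Sum>k\<in>K. e k * diag_form I b v f (g k))"
    and "diag_form I b v (\<Sum>k\<in>K. mscale (e k) (g k)) f = (\<Sum>k\<in>K. e k * diag_form I b v (g k) f)"
proof -
  obtain x where x: "f = (\<Sum>i\<in>J. mscale (x i) (b i))"
    using span_image_explicit[OF assms(2,4)] .
  have "\<forall>k\<in>K. \<exists>y. g k = (\<Sum>i\<in>J. mscale (y i) (b i))"
    using span_image_explicit[OF assms(2) assms(5)] by metis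
  then obtain y where "\<forall>k\<in>K. g k = (\<Sum>i\<in>J. mscale (y k i) (b i))"
    by (rule bchoice[THEN exE])
  then have y: "\<And>k. k \<in> K \<Longrightarrow> g k = (\<Sum>i\<in>J. mscale (y k i) (b i))" by blast
  have "(\<Sum>k\<in>K. mscale (e k) (g k)) = (\<Sum>k\<in>K. \<Sum>i\<in>J. mscale (e k * y k i) (b i))"
    by (rule sum.cong) (auto simp: y mps.scale_sum_right)
  also have "\<dots> = (\<Sum>i\<in>J. mscale (\<Sum>k\<in>K. e k * y k i) (b i))"
    by (subst sum.swap) (simp add: mps.scale_sum_left)
  finally have z: "(\<Sum>k\<in>K. mscale (e k) (g k)) = (\<Sum>i\<in>J. mscale (\<Sum>k\<in>K. e k * y k i) (b i))" .
  note eq = diag_form_eq[OF assms(1-3)]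
  have "diag_form I b v f (\<Sum>k\<in>K. mscale (e k) (g k)) = (\<Sum>i\<in>J. \<Sum>k\<in>K. e k * (x i * y k i * v i))"
    unfolding z x eq by (simp add: sum_distrib_left sum_distrib_right ac_simps)
  also have "\<dots> = (\<Sum>k\<in>K. e k * diag_form I b v f (g k))"
    by (subst sum.swap) (auto simp: y x eq sum_distrib_left intro!: sum.cong)
  finally show "diag_form I b v f (\<Sum>k\<in>K. mscale (e k) (g k)) = (\<Sum>k\<in>K. e k * diag_form I b v f (g k))" .
  have "diag_form I b v (\<Sum>k\<in>K. mscale (e k) (g k)) f = (\<Sum>i\<in>J. \<Sum>k\<in>K. e k * (y k i * x i * v i))"
    unfolding z x eq by (simp add: sum_distrib_left sum_distrib_right ac_simps)
  also have "\<dots> = (\<Sum>k\<in>K. e k * diag_form I b v (g k) f)"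
    by (subst sum.swap) (auto simp: y x eq sum_distrib_left intro!: sum.cong)
  finally show "diag_form I b v (\<Sum>k\<in>K. mscale (e k) (g k)) f = (\<Sum>k\<in>K. e k * diag_form I b v (g k) f)" .
qed

lemma mps_limit_t1_p_fun: "mps_limit_t1 (p_fun t_Qqt \<Gamma>) (xp_fun \<Gamma>)"
  by (cases \<Gamma>) (simp add: p_fun_def xp_fun_def mps_limit_t1_mult mps_limit_t1_H mps_limit_t1_p_sym)

lemma indep_fam_p_fun: "indep_fam (mparts m) (p_fun t_Qqt)"
  by (rule indep_fam_limit[OF mps_limit_t1_p_fun indep_fam_xp])

text \<open>Only x^b is rewritten, in the H_c of the same degree, while p_\<nu> is common to both
  families. So the length is preserved already for generic \<open>t\<close>.\<close>

lemma xp_fun_in_span_p_fun: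
  assumes "\<Gamma> \<in> mparts_deg m n"
  shows "xp_fun \<Gamma> \<in> mps.span (p_fun t_Qqt ` {\<Gamma>' \<in> mparts_deg m n. len \<Gamma>' = len \<Gamma>})"
proof -
  obtain b \<nu> where G: "\<Gamma> = (b, \<nu>)" "length b = m" "0 \<notin># \<nu>" "sum_list b + sum_mset \<nu> = n"
    using assms by (auto simp: mparts_deg_def mparts_def pdeg_def)
  have "b \<in> comps m (sum_list b)" using G by (simp add: comps_def)
  from span_image_explicit[OF finite_comps x_pow_in_span_H[OF this]]
  obtain w where w: "x_pow b = (\<Sum>c\<in>comps m (sum_list b). mscale (w c) (H_fun t_Qqt c))" .
  have "xp_fun \<Gamma> = (\<Sum>c\<in>comps m (sum_list b). mscale (w c) (p_fun t_Qqt (c, \<nu>)))"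
    by (simp add: xp_fun_def p_fun_def G(1) w sum_distrib_right mscale_mult_left)
  also have "\<dots> \<in> mps.span (p_fun t_Qqt ` {\<Gamma>' \<in> mparts_deg m n. len \<Gamma>' = len \<Gamma>})"
    by (rule sum_mscale_in_span, rule mps.span_base, rule imageI)
       (use G in \<open>auto simp: comps_def mparts_deg_def mparts_def pdeg_def\<close>)
  finally show ?thesis .
qed

lemma mps_limit_t1_m_fun:
  assumes "\<Lambda> \<in> mparts m"
  shows "mps_limit_t1 (m_fun \<Lambda>) (m_fun \<Lambda>)"
  by (rule mps_limit_t1I) (simp add: mcoeff_m_fun[OF assms])

text \<open>For generic \<open>t\<close> the coefficients \<open>u\<close> vanish only at indices
  longer than \<Lambda>; the other indices of the same length drop out only in the limit
  \<open>U\<close>, which is the expansion of m_\<Lambda> in the limit basis.\<close>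

definition p_expansion :: "nat \<Rightarrow> nat \<Rightarrow> mpart \<Rightarrow> (mpart \<Rightarrow> Qqt) \<Rightarrow> (mpart \<Rightarrow> Qq) \<Rightarrow> bool"
  where "p_expansion m n \<Lambda> u U \<longleftrightarrow>
    m_fun \<Lambda> = (\<Sum>\<Gamma>\<in>mparts_deg m n. mscale (u \<Gamma>) (p_fun t_Qqt \<Gamma>)) \<and>
    (\<forall>\<Gamma>\<in>mparts_deg m n. has_limit_t1 (u \<Gamma>) (U \<Gamma>) \<and> (len \<Lambda> < len \<Gamma> \<longrightarrow> u \<Gamma> = 0) \<and>
      (len \<Lambda> \<le> len \<Gamma> \<longrightarrow> \<Gamma> \<noteq> \<Lambda> \<longrightarrow> U \<Gamma> = 0)) \<and>
    U \<Lambda> = 1 / of_nat (aut (snd \<Lambda>)) \<and> m_fun \<Lambda> = (\<Sum>\<Gamma>\<in>mparts_deg m n. mscale (U \<Gamma>) (xp_fun \<Gamma>))"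

text \<open>Passing through the x^b p_\<nu> over \<rat>(q,t) bounds the lengths,
  \<open>coeffs_limit\<close> supplies the limits, and independence identifies them with the
  triangular coefficients over \<rat>(q).\<close>

lemma m_fun_p_fun_expansion:
  assumes "\<Lambda> \<in> mparts_deg m n"
  shows "\<exists>u U. p_expansion m n \<Lambda> u U"
proof -
  let ?I = "mparts_deg m n"
  define J where "J = {\<Gamma>\<in>?I. len \<Gamma> \<le> len \<Lambda>}"
  have J: "finite J" "J \<subseteq> ?I" using finite_mparts_deg by (auto simp: J_def)
  obtain V where V: "m_fun \<Lambda> = (\<Sum>\<Gamma>\<in>?I. mscale (V \<Gamma>) (xp_fun \<Gamma> :: Qqt mps))"
      "\<And>\<Gamma>. len \<Lambda> \<le> len \<Gamma> \<Longrightarrow> \<Gamma> \<noteq> \<Lambda> \<Longrightarrow> V \<Gamma> = 0"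
    using m_fun_expansion[OF assms] by blast
  have "mscale (V \<Gamma>) (xp_fun \<Gamma>) \<in> mps.span (p_fun t_Qqt ` J)" if "\<Gamma> \<in> ?I" for \<Gamma>
  proof (cases "len \<Gamma> \<le> len \<Lambda>")
    case True
    then have "{\<Gamma>' \<in> ?I. len \<Gamma>' = len \<Gamma>} \<subseteq> J" by (auto simp: J_def)
    then have "xp_fun \<Gamma> \<in> mps.span (p_fun t_Qqt ` J)"
      using subsetD[OF mps.span_mono[OF image_mono] xp_fun_in_span_p_fun[OF that]] by blast
    then show ?thesis by (rule mps.span_scale)
  next
    case False
    then have "V \<Gamma> = 0" by (intro V(2)) auto
    then show ?thesis by (simp add: mps.span_zero)
  qed
  then have "m_fun \<Lambda> \<in> mps.span (p_fun t_Qqt ` J)"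
    unfolding V(1) by (rule mps.span_sum)
  then obtain w where w: "m_fun \<Lambda> = (\<Sum>\<Gamma>\<in>J. mscale (w \<Gamma>) (p_fun t_Qqt \<Gamma>))"
    by (rule span_image_explicit[OF J(1)])
  define u where "u \<Gamma> = (if \<Gamma> \<in> J then w \<Gamma> else 0)" for \<Gamma>
  have u: "m_fun \<Lambda> = (\<Sum>\<Gamma>\<in>?I. mscale (u \<Gamma>) (p_fun t_Qqt \<Gamma>))"
    unfolding w using J finite_mparts_deg
    by (intro sum.mono_neutral_cong_left) (auto simp: u_def)
  have L: "\<Lambda> \<in> mparts m" using assms by (simp add: mparts_deg_def)
  have ind: "indep_fam ?I (xp_fun :: mpart \<Rightarrow> Qq mps)"
    by (rule indep_fam_subset[OF indep_fam_xp mparts_deg_subset])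
  obtain U where U: "\<And>\<Gamma>. \<Gamma> \<in> ?I \<Longrightarrow> has_limit_t1 (u \<Gamma>) (U \<Gamma>)"
      "m_fun \<Lambda> = (\<Sum>\<Gamma>\<in>?I. mscale (U \<Gamma>) (xp_fun \<Gamma>))"
    using coeffs_limit[OF finite_mparts_deg mps_limit_t1_p_fun ind mps_limit_t1_m_fun[OF L, unfolded u]]
    by blast
  obtain V' where V': "m_fun \<Lambda> = (\<Sum>\<Gamma>\<in>?I. mscale (V' \<Gamma>) (xp_fun \<Gamma> :: Qq mps))"
      "V' \<Lambda> = 1 / of_nat (aut (snd \<Lambda>))"
      "\<And>\<Gamma>. len \<Lambda> \<le> len \<Gamma> \<Longrightarrow> \<Gamma> \<noteq> \<Lambda> \<Longrightarrow> V' \<Gamma> = 0"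
    using m_fun_expansion[OF assms] by blast
  have UV: "U \<Gamma> = V' \<Gamma>" if "\<Gamma> \<in> ?I" for \<Gamma>
    using indep_fam_eqD[OF ind finite_mparts_deg order_refl _ that, of U V'] U(2) V'(1) by simp
  show ?thesis
    unfolding p_expansion_def
    by (intro exI[of _ u] exI[of _ U] conjI u U(2) ballI)
       (use UV V' U(1) assms in \<open>auto simp: u_def J_def\<close>)
qed

definition p_norm_lim :: "'a::field \<Rightarrow> mpart \<Rightarrow> 'a"
  where "p_norm_lim q \<Gamma> = q ^ sum_list (fst \<Gamma>) * of_nat (z_coeff (snd \<Gamma>)) * (\<Prod>k\<in>#snd \<Gamma>. (1 - q ^ k) / of_nat k)"

lemma p_norm_limit:
  assumes "\<Gamma> \<in> mparts m"
  shows "has_limit_t1 ((1 - t_Qqt) ^ len \<Gamma> * p_norm q_Qqt t_Qqt \<Gamma>) (p_norm_lim q_Qq \<Gamma>)"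
proof -
  obtain b \<nu> where G: "\<Gamma> = (b, \<nu>)" "0 \<notin># \<nu>" using assms by (auto simp: mparts_def)
  have "(\<Prod>k\<in>#\<nu>. (1 - q_Qqt ^ k) / ((1 - t_Qqt ^ k) / (1 - t_Qqt))) =
      (1 - t_Qqt) ^ size \<nu> * (\<Prod>k\<in>#\<nu>. (1 - q_Qqt ^ k) / (1 - t_Qqt ^ k))"
    by (induction \<nu>) auto
  then have eq: "(1 - t_Qqt) ^ len \<Gamma> * p_norm q_Qqt t_Qqt \<Gamma> =
      q_Qqt ^ sum_list b * t_Qqt ^ Inv b * of_nat (z_coeff \<nu>) *
      (\<Prod>k\<in>#\<nu>. (1 - q_Qqt ^ k) / ((1 - t_Qqt ^ k) / (1 - t_Qqt)))"
    by (simp add: p_norm_def G)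
  have "has_limit_t1 ((1 - t_Qqt) ^ len \<Gamma> * p_norm q_Qqt t_Qqt \<Gamma>)
      (q_Qq ^ sum_list b * 1 ^ Inv b * of_nat (z_coeff \<nu>) * (\<Prod>k\<in>#\<nu>. (1 - q_Qq ^ k) / of_nat k))"
    unfolding eq
    by (intro has_limit_t1_mult has_limit_t1_prod_mset has_limit_t1_divide has_limit_t1_diff
        has_limit_t1_power has_limit_t1_q has_limit_t1_t has_limit_t1_1 has_limit_t1_of_nat
        has_limit_t1_one_minus_power_div) (use G in \<open>auto intro: Nat.gr0I\<close>)
  then show ?thesis by (simp add: p_norm_lim_def G)
qed

lemma one_minus_t_power_nonzero: "k > 0 \<Longrightarrow> 1 - t_Qqt ^ k \<noteq> 0"
  using has_limit_t1_one_minus_power_div[of k] has_limit_t1_unique[of 0 0 "of_nat k"]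
  by auto

lemma q_Qq_power: "q_Qq ^ k = Fract (monom 1 k) 1"
  by (induction k) (auto simp: q_Qq_def One_fract_def monom_Suc simp flip: one_pCons)

lemma q_Qq_nonzero: "q_Qq \<noteq> 0"
  by (simp add: q_Qq_def Zero_fract_def eq_fract)

lemma one_minus_q_power_nonzero: "k > 0 \<Longrightarrow> 1 - q_Qq ^ k \<noteq> 0"
proof
  assume k: "k > 0" and "1 - q_Qq ^ k = 0"
  then have "Fract (monom 1 k) 1 = (Fract 1 1 :: Qq)"
    by (simp add: q_Qq_power One_fract_def[where 'a = "rat poly", symmetric])
  then have "monom 1 k = (1 :: rat poly)"
    by (simp add: eq_fract)
  then have "degree (monom 1 k :: rat poly) = 0" by simp
  then show False using k by (simp add: degree_monom_eq)
qed

lemma prod_mset_nonzero: "(\<And>k. k \<in># M \<Longrightarrow> f k \<noteq> (0 :: 'a::field)) \<Longrightarrow> (\<Prod>k\<in>#M. f k) \<noteq> 0"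
  by (induction M) auto

lemma z_coeff_eq_aut: "z_coeff \<nu> = aut \<nu> * (\<Prod>k\<in>#\<nu>. k)"
proof (induction \<nu>)
  case empty
  show ?case by (simp add: z_coeff_def aut_def)
next
  case (add k \<nu>)
  then show ?case by (simp add: z_coeff_add aut_add algebra_simps)
qed

text \<open>The two factors 1/aut are the diagonal coefficients \<open>U\<close>. As z_\<mu> is aut
  times the product of the parts, the parts cancel against the limit of the norm, and the remaining
  factors 1 - q^r complete \<open>q_fact q (r - 1)\<close> to \<open>q_fact q r\<close>.\<close>

lemma leading_constant:
  fixes q :: "'a::field_char_0"
  assumes "0 \<notin># \<mu>"
  shows "(\<Prod>i<length a. q_fact q (a ! i)) * (\<Prod>r\<in>#\<mu>. q_fact q (r - 1)) * of_nat (aut \<mu>) *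
      (1 / of_nat (aut \<mu>) * (1 / of_nat (aut \<mu>)) * p_norm_lim q (a, \<mu>)) =
    q ^ sum_list a * q_fact_mpart q (a, \<mu>)" (is "?A * ?Q * ?n * _ = _")
proof -
  have n: "?n \<noteq> 0" using aut_pos[of \<mu>] by simp
  have 1: "of_nat (\<Prod>k\<in>#\<mu>. k) * (\<Prod>k\<in>#\<mu>. (1 - q ^ k) / of_nat k) = (\<Prod>k\<in>#\<mu>. 1 - q ^ k)"
    using assms by (induction \<mu>) auto
  have "q_fact q (r - 1) * (1 - q ^ r) = q_fact q r" if "r > 0" for r
    using that by (cases r) (auto simp: q_fact_def)
  then have 2: "?Q * (\<Prod>k\<in>#\<mu>. 1 - q ^ k) = (\<Prod>r\<in>#\<mu>. q_fact q r)"
    using assms by (induction \<mu>) (auto simp: ac_simps)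
  have "?A * ?Q * ?n * (1 / ?n * (1 / ?n) * p_norm_lim q (a, \<mu>)) =
      q ^ sum_list a * (?A * (?Q * (of_nat (\<Prod>k\<in>#\<mu>. k) * (\<Prod>k\<in>#\<mu>. (1 - q ^ k) / of_nat k))))"
    using n by (simp add: p_norm_lim_def z_coeff_eq_aut field_simps)
  then show ?thesis by (simp only: 1 2) (simp add: q_fact_mpart_def)
qed

section \<open>The limit of the integral form\<close>

theorem proposition14:
  fixes m :: nat and P :: "mpart \<Rightarrow> Qqt mps" and a :: "nat list" and \<mu> :: "nat multiset"
  assumes "is_macdonald m q_Qqt t_Qqt P"
    and "(a, \<mu>) \<in> mparts m"
  shows "mps_limit_t1 (pleth_t m t_Qqt (J_fun q_Qqt t_Qqt P (a, \<mu>)))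
           (mscale (q_Qq ^ sum_list a * q_fact_mpart q_Qq (a, \<mu>))
              (pleth_q m q_Qq (h_fun q_Qq (a, \<mu>))))
    \<and> mscale (q_Qq ^ sum_list a * q_fact_mpart q_Qq (a, \<mu>))
          (pleth_q m q_Qq (h_fun q_Qq (a, \<mu>)))
      = mscale (q_fact_mpart q_Qq (a, \<mu>))
          ((\<Prod>i<m. h_pleth_x q_Qq i (a ! i)) * (\<Prod>r\<in>#\<mu>. h_pleth q_Qq r))"
proof
  define \<Lambda> where "\<Lambda> = (a, \<mu>)"
  define n where "n = pdeg \<Lambda>"
  define I where "I = mparts_deg m n"
  define N where "N = p_norm q_Qqt t_Qqt"
  define s where "s = 1 - t_Qqt"
  define C where "C = q_Qq ^ sum_list a * q_fact_mpart q_Qq \<Lambda>"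
  define F where "F = mac_form m q_Qqt t_Qqt"
  let ?p = "p_fun t_Qqt"
  have L: "\<Lambda> \<in> mparts m" using assms(2) by (simp add: \<Lambda>_def)
  have LI: "\<Lambda> \<in> I" using L by (simp add: I_def mparts_deg_def n_def)
  have finI: "finite I" and Im: "I \<subseteq> mparts m"
    by (simp_all add: I_def finite_mparts_deg mparts_deg_subset)
  \<comment> \<open>Comparable indices have the same degree, so the whole argument stays inside the
    finite set \<open>I\<close>.\<close>
  have le_I: "\<Omega> \<in> I" if "\<Omega> \<in> mparts m" "mpart_le m \<Omega> \<Gamma>" "\<Gamma> \<in> I" for \<Omega> \<Gamma>
    using that mpart_le_pdeg[OF that(2)] by (simp add: I_def mparts_deg_def)

  have "\<forall>\<Omega>\<in>I. \<exists>u U. p_expansion m n \<Omega> u U"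
    unfolding I_def using m_fun_p_fun_expansion by blast
  then obtain u where "\<forall>\<Omega>\<in>I. \<exists>U. p_expansion m n \<Omega> (u \<Omega>) U"
    by (rule bchoice[THEN exE])
  then obtain U where "\<forall>\<Omega>\<in>I. p_expansion m n \<Omega> (u \<Omega>) (U \<Omega>)"
    by (rule bchoice[THEN exE])
  note uU = this[unfolded p_expansion_def I_def[symmetric]]
  have m_p: "m_fun \<Omega> = (\<Sum>\<Gamma>\<in>I. mscale (u \<Omega> \<Gamma>) (?p \<Gamma>))"
    and m_xp: "m_fun \<Omega> = (\<Sum>\<Gamma>\<in>I. mscale (U \<Omega> \<Gamma>) (xp_fun \<Gamma>))"
    and U_diag: "U \<Omega> \<Omega> = 1 / of_nat (aut (snd \<Omega>))" if "\<Omega> \<in> I" for \<Omega>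
    using uU that by blast+
  have u_lim: "has_limit_t1 (u \<Omega> \<Gamma>) (U \<Omega> \<Gamma>)"
    and u_0: "len \<Omega> < len \<Gamma> \<Longrightarrow> u \<Omega> \<Gamma> = 0"
    and U_0: "len \<Omega> \<le> len \<Gamma> \<Longrightarrow> \<Gamma> \<noteq> \<Omega> \<Longrightarrow> U \<Omega> \<Gamma> = 0" if "\<Omega> \<in> I" "\<Gamma> \<in> I" for \<Omega> \<Gamma>
    using uU that by blast+
  have U_diag_nz: "U \<Omega> \<Omega> \<noteq> 0" if "\<Omega> \<in> I" for \<Omega>
    using U_diag[OF that] aut_pos[of "snd \<Omega>"] by simp
  have norm_nz: "p_norm_lim q_Qq \<Gamma> \<noteq> 0" if "\<Gamma> \<in> I" for \<Gamma>
  proof -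
    have 0: "0 \<notin># snd \<Gamma>" using that Im by (auto simp: mparts_def)
    have "(1 - q_Qq ^ k) / of_nat k \<noteq> 0" if "k \<in># snd \<Gamma>" for k
    proof -
      have "k > 0" using 0 that by (cases k) auto
      then show ?thesis using one_minus_q_power_nonzero[of k] by simp
    qed
    then have "(\<Prod>k\<in>#snd \<Gamma>. (1 - q_Qq ^ k) / of_nat k) \<noteq> 0" by (rule prod_mset_nonzero)
    then show ?thesis
      unfolding p_norm_lim_def using z_coeff_pos[OF 0] q_Qq_nonzero by simp
  qed
  note ind = indep_fam_p_fun[of m]
  have m_span: "m_fun \<Omega> \<in> mps.span (?p ` I)" if "\<Omega> \<in> I" for \<Omega>
    unfolding m_p[OF that] by (intro sum_mscale_in_span mps.span_base imageI)
  note F_sum = diag_form_sum[OF ind finI Im, where v = N,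
      folded F_def[unfolded mac_form_def N_def[symmetric]]]

  text \<open>The Gram matrix of the monomials has a pole of order at most the smaller number of parts.\<close>
  have gram: "has_limit_t1 (s ^ l * F (m_fun \<Gamma>) (m_fun \<Omega>))
      (if l = len \<Omega> then U \<Gamma> \<Omega> * U \<Omega> \<Omega> * p_norm_lim q_Qq \<Omega> else 0)"
    if G: "\<Gamma> \<in> I" and O: "\<Omega> \<in> I" and l: "len \<Omega> \<le> l" for \<Gamma> \<Omega> l
  proof -
    have "F (m_fun \<Gamma>) (m_fun \<Omega>) = (\<Sum>\<Xi>\<in>I. u \<Gamma> \<Xi> * u \<Omega> \<Xi> * N \<Xi>)"
      unfolding m_p[OF G] m_p[OF O] F_def mac_form_def N_def
      by (rule diag_form_eq[OF ind finI Im])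
    then have "s ^ l * F (m_fun \<Gamma>) (m_fun \<Omega>) = (\<Sum>\<Xi>\<in>I. s ^ l * (u \<Gamma> \<Xi> * u \<Omega> \<Xi> * N \<Xi>))"
      by (simp add: sum_distrib_left)
    moreover have "has_limit_t1 (s ^ l * (u \<Gamma> \<Xi> * u \<Omega> \<Xi> * N \<Xi>))
        (if \<Xi> = \<Omega> \<and> l = len \<Omega> then U \<Gamma> \<Omega> * U \<Omega> \<Omega> * p_norm_lim q_Qq \<Omega> else 0)" if X: "\<Xi> \<in> I" for \<Xi>
    proof (cases "len \<Omega> < len \<Xi>")
      case True
      then show ?thesis using u_0[OF O X] by auto
    next
      case False
      then have "s ^ l = s ^ (l - len \<Xi>) * s ^ len \<Xi>"
        using l by (simp add: power_add[symmetric])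
      then have eq: "s ^ l * (u \<Gamma> \<Xi> * u \<Omega> \<Xi> * N \<Xi>) = s ^ (l - len \<Xi>) * (u \<Gamma> \<Xi> * u \<Omega> \<Xi> * (s ^ len \<Xi> * N \<Xi>))"
        by (simp add: ac_simps)
      have lim: "has_limit_t1 (u \<Gamma> \<Xi> * u \<Omega> \<Xi> * (s ^ len \<Xi> * N \<Xi>)) (U \<Gamma> \<Xi> * U \<Omega> \<Xi> * p_norm_lim q_Qq \<Xi>)"
        using X Im unfolding s_def N_def
        by (intro has_limit_t1_mult u_lim G O p_norm_limit[of \<Xi> m]) auto
      \<comment> \<open>A surplus factor \<open>s\<close> forces the limit 0 unless
        \<open>l = len \<Xi>\<close>. As \<Xi> is not longer than \<Omega>, all three lengths then
        agree, and \<open>U_0\<close> leaves only \<Xi> = \<Omega>.\<close>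
      show ?thesis
      proof (cases "l = len \<Xi>")
        case True
        then have "l = len \<Omega>" using False l by simp
        then show ?thesis using lim True U_0[OF O X] unfolding eq by (cases "\<Xi> = \<Omega>") auto
      next
        case neq: False
        then have "has_limit_t1 (s ^ l * (u \<Gamma> \<Xi> * u \<Omega> \<Xi> * N \<Xi>)) 0"
          unfolding eq using has_limit_t1_0_power[OF lim, of "l - len \<Xi>", folded s_def] False l by simp
        then show ?thesis using neq by auto
      qed
    qed
    then have "has_limit_t1 (\<Sum>\<Xi>\<in>I. s ^ l * (u \<Gamma> \<Xi> * u \<Omega> \<Xi> * N \<Xi>))
        (\<Sum>\<Xi>\<in>I. if \<Xi> = \<Omega> \<and> l = len \<Omega> then U \<Gamma> \<Omega> * U \<Omega> \<Omega> * p_norm_lim q_Qq \<Omega> else 0)"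
      by (rule has_limit_t1_sum)
    moreover have "(\<Sum>\<Xi>\<in>I. if \<Xi> = \<Omega> \<and> l = len \<Omega> then U \<Gamma> \<Omega> * U \<Omega> \<Omega> * p_norm_lim q_Qq \<Omega> else 0) =
        (if l = len \<Omega> then U \<Gamma> \<Omega> * U \<Omega> \<Omega> * p_norm_lim q_Qq \<Omega> else 0)"
      using O finI by (cases "l = len \<Omega>") auto
    ultimately show ?thesis by simp
  qed

  define S where "S = {\<Omega>. \<Omega> \<in> mparts m \<and> mpart_less m \<Omega> \<Lambda>}"
  have P_tri: "\<exists>d. P \<Gamma> = m_fun \<Gamma> + (\<Sum>\<Omega> | \<Omega> \<in> mparts m \<and> mpart_less m \<Omega> \<Gamma>. mscale (d \<Omega>) (m_fun \<Omega>))"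
    if "\<Gamma> \<in> mparts m" for \<Gamma>
    using assms(1) that unfolding is_macdonald_def by blast
  obtain d where d: "P \<Lambda> = m_fun \<Lambda> + (\<Sum>\<Omega>\<in>S. mscale (d \<Omega>) (m_fun \<Omega>))"
    using P_tri[OF L] unfolding S_def by blast
  have P_span: "P \<Gamma> \<in> mps.span (?p ` I)" if G: "\<Gamma> \<in> I" for \<Gamma>
  proof -
    obtain e where e: "P \<Gamma> = m_fun \<Gamma> + (\<Sum>\<Omega> | \<Omega> \<in> mparts m \<and> mpart_less m \<Omega> \<Gamma>. mscale (e \<Omega>) (m_fun \<Omega>))"
      using P_tri[OF subsetD[OF Im G]] by blast
    have "m_fun \<Omega> \<in> mps.span (?p ` I)" if "\<Omega> \<in> {\<Omega>. \<Omega> \<in> mparts m \<and> mpart_less m \<Omega> \<Gamma>}" for \<Omega>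
      using that le_I[of \<Omega> \<Gamma>] G m_span by (auto simp: mpart_less_def)
    then show ?thesis
      unfolding e using m_span[OF G] by (intro mps.span_add sum_mscale_in_span)
  qed
  have finS: "finite S" unfolding S_def by (rule finite_mpart_less)
  have SI: "S \<subseteq> I" using le_I[OF _ _ LI] by (auto simp: S_def mpart_less_def)
  have S_len: "len \<Lambda> \<le> len \<Omega>" "\<Omega> \<noteq> \<Lambda>" "\<not> mpart_le m \<Lambda> \<Omega>" if "\<Omega> \<in> S" for \<Omega>
    using that mpart_le_len[OF L, of \<Omega>] mpart_le_antisym[OF L, of \<Omega>] by (auto simp: S_def mpart_less_def)

  \<comment> \<open>m_\<Omega> is a combination of those \<open>P \<Gamma>\<close> with \<Gamma>
    below \<Omega>, and \<Lambda> is not among these \<Gamma>.\<close>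
  have orth: "F (P \<Lambda>) (m_fun \<Omega>) = 0" if O: "\<Omega> \<in> I" and nle: "\<not> mpart_le m \<Lambda> \<Omega>" for \<Omega>
  proof -
    define T where "T = {\<Gamma> \<in> mparts m. mpart_le m \<Gamma> \<Omega>}"
    have T: "T \<subseteq> I" using le_I[OF _ _ O] by (auto simp: T_def)
    then have "finite T" using finI by (rule finite_subset)
    have "m_fun \<Omega> \<in> mps.span (P ` T)"
      unfolding T_def using O Im P_tri by (intro m_fun_in_span) auto
    then obtain e where e: "m_fun \<Omega> = (\<Sum>\<Gamma>\<in>T. mscale (e \<Gamma>) (P \<Gamma>))"
      by (rule span_image_explicit[OF \<open>finite T\<close>])
    have "F (P \<Lambda>) (m_fun \<Omega>) = (\<Sum>\<Gamma>\<in>T. e \<Gamma> * F (P \<Lambda>) (P \<Gamma>))"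
      unfolding e using P_span LI T by (intro F_sum) auto
    also have "\<dots> = 0"
    proof (rule sum.neutral, rule ballI)
      fix \<Gamma> assume G: "\<Gamma> \<in> T"
      then have "\<Gamma> \<noteq> \<Lambda>" using nle by (auto simp: T_def)
      then show "e \<Gamma> * F (P \<Lambda>) (P \<Gamma>) = 0"
        using assms(1) L G unfolding is_macdonald_def F_def T_def by auto
    qed
    finally show ?thesis .
  qed
  have F_P: "F (P \<Lambda>) (m_fun \<Omega>) = F (m_fun \<Lambda>) (m_fun \<Omega>) + (\<Sum>\<Gamma>\<in>S. d \<Gamma> * F (m_fun \<Gamma>) (m_fun \<Omega>))"
    if O: "\<Omega> \<in> I" for \<Omega>
  proof -
    define e where "e \<Gamma> = (if \<Gamma> = \<Lambda> then 1 else d \<Gamma>)" for \<Gamma>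
    have LS: "\<Lambda> \<notin> S" using S_len(2) by blast
    have "P \<Lambda> = (\<Sum>\<Gamma>\<in>insert \<Lambda> S. mscale (e \<Gamma>) (m_fun \<Gamma>))"
      unfolding d using LS finS by (auto simp: e_def intro!: sum.cong)
    then have "F (P \<Lambda>) (m_fun \<Omega>) = (\<Sum>\<Gamma>\<in>insert \<Lambda> S. e \<Gamma> * F (m_fun \<Gamma>) (m_fun \<Omega>))"
      using F_sum(2)[OF m_span[OF O], of "insert \<Lambda> S" m_fun e] m_span LI SI by auto
    then show ?thesis using LS finS by (auto simp: e_def intro!: sum.cong)
  qed

  text \<open>Orthogonality to the lower monomials is a linear system for \<open>d\<close> whose matrix, after
    rescaling, becomes triangular at \<open>t = 1\<close>, while its right-hand side vanishes there.\<close>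
  have d_lim: "has_limit_t1 (d \<Omega>) 0" if "\<Omega> \<in> S" for \<Omega>
  proof -
    \<comment> \<open>Equation \<Omega> is scaled by just the power that clears its poles. As
      \<open>has_limit_t1_solution\<close> wants an equation for every index, those outside
      \<open>S\<close> are padded to 0 = 0.\<close>
    define B where "B \<Gamma> \<Omega> = (if \<Omega> \<in> S then s ^ len \<Omega> * F (m_fun \<Gamma>) (m_fun \<Omega>) else 0)" for \<Gamma> \<Omega>
    define B' where "B' \<Gamma> \<Omega> = (if \<Omega> \<in> S then U \<Gamma> \<Omega> * U \<Omega> \<Omega> * p_norm_lim q_Qq \<Omega> else 0)" for \<Gamma> \<Omega>
    have B: "has_limit_t1 (B \<Gamma> \<Omega>) (B' \<Gamma> \<Omega>)" if "\<Gamma> \<in> I" for \<Gamma> \<Omega>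
      using gram[OF that, of \<Omega> "len \<Omega>"] SI by (auto simp: B_def B'_def)
    \<comment> \<open>\<open>U \<Gamma> \<Omega>\<close> can be nonzero only if \<Gamma> is \<Omega>
      or strictly longer, so the equation of a longest index with nonzero coefficient contains that
      coefficient alone.\<close>
    have ind': "\<forall>\<Gamma>\<in>S. e \<Gamma> = 0" if e: "\<And>\<Omega>. (\<Sum>\<Gamma>\<in>S. e \<Gamma> * B' \<Gamma> \<Omega>) = 0" for e
    proof (rule ccontr)
      assume "\<not> (\<forall>\<Gamma>\<in>S. e \<Gamma> = 0)"
      then obtain \<Omega> where O: "\<Omega> \<in> S" "e \<Omega> \<noteq> 0"
        and max: "\<And>\<Gamma>. \<Gamma> \<in> S \<Longrightarrow> e \<Gamma> \<noteq> 0 \<Longrightarrow> len \<Gamma> \<le> len \<Omega>"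
        using obtain_max_such[OF finS, of "\<lambda>\<Gamma>. e \<Gamma> \<noteq> 0" len] by blast
      have "(\<Sum>\<Gamma>\<in>S. e \<Gamma> * B' \<Gamma> \<Omega>) = (\<Sum>\<Gamma>\<in>S. if \<Gamma> = \<Omega> then e \<Omega> * B' \<Omega> \<Omega> else 0)"
      proof (rule sum.cong)
        fix \<Gamma> assume "\<Gamma> \<in> S"
        then show "e \<Gamma> * B' \<Gamma> \<Omega> = (if \<Gamma> = \<Omega> then e \<Omega> * B' \<Omega> \<Omega> else 0)"
          using max[of \<Gamma>] U_0[of \<Gamma> \<Omega>] SI O(1) by (cases "e \<Gamma> = 0") (auto simp: B'_def)
      qed simp
      also have "\<dots> = e \<Omega> * B' \<Omega> \<Omega>" using finS O(1) by simp
      finally have "e \<Omega> * B' \<Omega> \<Omega> = 0" using e by simp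
      then show False using O SI U_diag_nz[of \<Omega>] norm_nz[of \<Omega>] by (auto simp: B'_def)
    qed
    have sol: "(\<Sum>\<Gamma>\<in>S. d \<Gamma> * B \<Gamma> \<Omega>) = - B \<Lambda> \<Omega>" for \<Omega>
    proof (cases "\<Omega> \<in> S")
      case True
      then have "F (m_fun \<Lambda>) (m_fun \<Omega>) + (\<Sum>\<Gamma>\<in>S. d \<Gamma> * F (m_fun \<Gamma>) (m_fun \<Omega>)) = 0"
        using orth[of \<Omega>] F_P[of \<Omega>] S_len(3)[of \<Omega>] SI by auto
      then have "(\<Sum>\<Gamma>\<in>S. d \<Gamma> * F (m_fun \<Gamma>) (m_fun \<Omega>)) = - F (m_fun \<Lambda>) (m_fun \<Omega>)"
        by (simp add: add_eq_0_iff)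
      then have "s ^ len \<Omega> * (\<Sum>\<Gamma>\<in>S. d \<Gamma> * F (m_fun \<Gamma>) (m_fun \<Omega>)) = - (s ^ len \<Omega> * F (m_fun \<Lambda>) (m_fun \<Omega>))"
        by simp
      then show ?thesis using True by (simp add: B_def sum_distrib_left ac_simps)
    qed (simp add: B_def)
    \<comment> \<open>Indices in \<open>S\<close> are at least as long as \<Lambda> and different
      from it, so \<open>U \<Lambda> \<Omega>\<close> is 0.\<close>
    have R: "has_limit_t1 (- B \<Lambda> \<Omega>) 0" for \<Omega>
      using has_limit_t1_minus[OF B[OF LI, of \<Omega>]] U_0[OF LI, of \<Omega>] S_len[of \<Omega>] SI
      by (auto simp: B'_def split: if_splits)
    obtain d' where d': "\<And>\<Gamma>. \<Gamma> \<in> S \<Longrightarrow> has_limit_t1 (d \<Gamma>) (d' \<Gamma>)" "\<And>\<Omega>. (\<Sum>\<Gamma>\<in>S. d' \<Gamma> * B' \<Gamma> \<Omega>) = 0"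
      using has_limit_t1_solution[of S B B' d "\<lambda>\<Omega>. - B \<Lambda> \<Omega>" "\<lambda>_. 0", OF finS B[OF subsetD[OF SI]] ind' sol R]
      by blast
    show ?thesis using ind'[OF d'(2)] d'(1) that by fastforce
  qed

  \<comment> \<open>In the case \<Lambda> \<le> \<Omega> the index \<Omega> is not longer than
    \<Lambda>, so the zero of \<open>c_coeff\<close> compensates the pole. The terms with
    \<open>d\<close> disappear in the limit; for \<Omega> other than \<Lambda> the main term does
    too, by a surplus power of \<open>s\<close> or by \<open>U_0\<close>.\<close>
  have c_lim: "has_limit_t1 (c_coeff q_Qqt t_Qqt \<Lambda> * F (P \<Lambda>) (m_fun \<Omega>)) (if \<Omega> = \<Lambda> then C else 0)"
    if O: "\<Omega> \<in> I" for \<Omega>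
  proof (cases "mpart_le m \<Lambda> \<Omega>")
    case False
    then have "\<Omega> \<noteq> \<Lambda>" using mpart_le_refl[of m \<Lambda>] by auto
    then show ?thesis using orth[OF O False] by simp
  next
    case True
    then have len: "len \<Omega> \<le> len \<Lambda>" using mpart_le_len[OF _ L] O Im by blast
    define K where "K = (\<Prod>i<length a. q_fact q_Qq (a ! i)) * (\<Prod>r\<in>#\<mu>. q_fact q_Qq (r - 1)) * of_nat (aut \<mu>)"
    have eq: "c_coeff q_Qqt t_Qqt \<Lambda> * F (P \<Lambda>) (m_fun \<Omega>) =
        c_coeff q_Qqt t_Qqt \<Lambda> / s ^ len \<Lambda> * (s ^ len \<Lambda> * F (m_fun \<Lambda>) (m_fun \<Omega>) +
          (\<Sum>\<Gamma>\<in>S. d \<Gamma> * (s ^ len \<Lambda> * F (m_fun \<Gamma>) (m_fun \<Omega>))))"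
    proof -
      have "(\<Sum>\<Gamma>\<in>S. d \<Gamma> * (s ^ len \<Lambda> * F (m_fun \<Gamma>) (m_fun \<Omega>))) =
          s ^ len \<Lambda> * (\<Sum>\<Gamma>\<in>S. d \<Gamma> * F (m_fun \<Gamma>) (m_fun \<Omega>))"
        by (simp add: sum_distrib_left ac_simps)
      then have "s ^ len \<Lambda> * F (m_fun \<Lambda>) (m_fun \<Omega>) +
          (\<Sum>\<Gamma>\<in>S. d \<Gamma> * (s ^ len \<Lambda> * F (m_fun \<Gamma>) (m_fun \<Omega>))) = s ^ len \<Lambda> * F (P \<Lambda>) (m_fun \<Omega>)"
        by (simp add: F_P[OF O] distrib_left)
      moreover have "s \<noteq> 0"
        unfolding s_def by (rule one_minus_t_nonzero)
      ultimately show ?thesis by simp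
    qed
    have c: "has_limit_t1 (c_coeff q_Qqt t_Qqt \<Lambda> / s ^ len \<Lambda>) K"
      using c_coeff_limit[OF assms(2)] by (simp add: \<Lambda>_def s_def K_def)
    define g where "g \<Gamma> = (if len \<Lambda> = len \<Omega> then U \<Gamma> \<Omega> * U \<Omega> \<Omega> * p_norm_lim q_Qq \<Omega> else 0)" for \<Gamma>
    have g: "has_limit_t1 (s ^ len \<Lambda> * F (m_fun \<Gamma>) (m_fun \<Omega>)) (g \<Gamma>)" if "\<Gamma> \<in> S" for \<Gamma>
      unfolding g_def by (rule gram[OF subsetD[OF SI that] O len])
    have "has_limit_t1 (\<Sum>\<Gamma>\<in>S. d \<Gamma> * (s ^ len \<Lambda> * F (m_fun \<Gamma>) (m_fun \<Omega>))) (\<Sum>\<Gamma>\<in>S. 0 * g \<Gamma>)"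
      by (intro has_limit_t1_sum has_limit_t1_mult d_lim g)
    then have "has_limit_t1 (c_coeff q_Qqt t_Qqt \<Lambda> * F (P \<Lambda>) (m_fun \<Omega>))
        (K * ((if len \<Lambda> = len \<Omega> then U \<Lambda> \<Omega> * U \<Omega> \<Omega> * p_norm_lim q_Qq \<Omega> else 0) + (\<Sum>\<Gamma>\<in>S. 0 * g \<Gamma>)))"
      unfolding eq by (intro has_limit_t1_mult c has_limit_t1_add gram[OF LI O len])
    moreover have "K * ((if len \<Lambda> = len \<Omega> then U \<Lambda> \<Omega> * U \<Omega> \<Omega> * p_norm_lim q_Qq \<Omega> else 0) + (\<Sum>\<Gamma>\<in>S. 0 * g \<Gamma>)) =
        (if \<Omega> = \<Lambda> then C else 0)"
    proof (cases "\<Omega> = \<Lambda>")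
      case True
      have "0 \<notin># \<mu>" using assms(2) by (simp add: mparts_def)
      from leading_constant[OF this, where a = a and q = q_Qq] show ?thesis
        using True U_diag[OF LI] by (simp add: K_def C_def \<Lambda>_def)
    next
      case False
      then show ?thesis using U_0[OF LI O] by auto
    qed
    ultimately show ?thesis by simp
  qed

  \<comment> \<open>The added factors cancel the poles of the norm and undo those of
    \<open>pleth_t\<close>: F(f, g) is the pairing of f[X/(1-t)] with g for the norm \<rho>, whose
    limit \<rho>' has no zero on \<open>I\<close>.\<close>
  define \<rho> where "\<rho> \<Gamma> = N \<Gamma> * (\<Prod>k\<in>#snd \<Gamma>. 1 - t_Qqt ^ k)" for \<Gamma>
  define \<rho>' where "\<rho>' \<Gamma> = q_Qq ^ sum_list (fst \<Gamma>) * of_nat (z_coeff (snd \<Gamma>)) * (\<Prod>k\<in>#snd \<Gamma>. 1 - q_Qq ^ k)" for \<Gamma>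
  have part_pos: "k > 0" if "\<Gamma> \<in> I" "k \<in># snd \<Gamma>" for \<Gamma> k
    using that Im by (cases k) (auto simp: mparts_def)
  have t_nz: "(\<Prod>k\<in>#snd \<Gamma>. 1 - t_Qqt ^ k) \<noteq> 0" if "\<Gamma> \<in> I" for \<Gamma>
    by (intro prod_mset_nonzero one_minus_t_power_nonzero part_pos[OF that])
  have q_nz: "(\<Prod>k\<in>#snd \<Gamma>. 1 - q_Qq ^ k) \<noteq> 0" if "\<Gamma> \<in> I" for \<Gamma>
    by (intro prod_mset_nonzero one_minus_q_power_nonzero part_pos[OF that])
  have z_nz: "of_nat (z_coeff (snd \<Gamma>)) \<noteq> (0 :: Qq)" if "\<Gamma> \<in> I" for \<Gamma>
    using z_coeff_pos[of "snd \<Gamma>"] part_pos[OF that, of 0] by auto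
  have \<rho>_lim: "has_limit_t1 (\<rho> \<Gamma>) (\<rho>' \<Gamma>)" if "\<Gamma> \<in> I" for \<Gamma>
  proof -
    have "(\<Prod>k\<in>#\<nu>. x k / y k) = (\<Prod>k\<in>#\<nu>. x k) / (\<Prod>k\<in>#\<nu>. y k :: Qqt)" for x y and \<nu> :: "nat multiset"
      by (induction \<nu>) auto
    then have "\<rho> \<Gamma> = q_Qqt ^ sum_list (fst \<Gamma>) * t_Qqt ^ Inv (fst \<Gamma>) * of_nat (z_coeff (snd \<Gamma>)) *
        (\<Prod>k\<in>#snd \<Gamma>. 1 - q_Qqt ^ k)"
      using t_nz[OF that] by (simp add: \<rho>_def N_def p_norm_def case_prod_unfold)
    moreover have "has_limit_t1 (q_Qqt ^ sum_list (fst \<Gamma>) * t_Qqt ^ Inv (fst \<Gamma>) * of_nat (z_coeff (snd \<Gamma>)) *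
        (\<Prod>k\<in>#snd \<Gamma>. 1 - q_Qqt ^ k)) (q_Qq ^ sum_list (fst \<Gamma>) * 1 ^ Inv (fst \<Gamma>) * of_nat (z_coeff (snd \<Gamma>)) *
        (\<Prod>k\<in>#snd \<Gamma>. 1 - q_Qq ^ k))"
      by (intro has_limit_t1_mult has_limit_t1_prod_mset has_limit_t1_diff has_limit_t1_power
          has_limit_t1_q has_limit_t1_t has_limit_t1_1 has_limit_t1_of_nat)
    ultimately show ?thesis by (simp add: \<rho>'_def)
  qed
  have \<rho>'_nz: "\<rho>' \<Gamma> \<noteq> 0" if "\<Gamma> \<in> I" for \<Gamma>
    using q_nz[OF that] z_nz[OF that] q_Qq_nonzero by (simp add: \<rho>'_def)
  \<comment> \<open>The pairing of the basis vector \<open>?p \<Gamma>\<close> with m_\<Omega> for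
    the norm \<rho>, again padded by zeros.\<close>
  define B where "B \<Gamma> \<Omega> = (if \<Omega> \<in> I then u \<Omega> \<Gamma> * \<rho> \<Gamma> else 0)" for \<Gamma> \<Omega>
  define B' where "B' \<Gamma> \<Omega> = (if \<Omega> \<in> I then U \<Omega> \<Gamma> * \<rho>' \<Gamma> else 0)" for \<Gamma> \<Omega>
  have B_lim: "has_limit_t1 (B \<Gamma> \<Omega>) (B' \<Gamma> \<Omega>)" if "\<Gamma> \<in> I" for \<Gamma> \<Omega>
    using that by (auto simp: B_def B'_def intro!: has_limit_t1_mult u_lim \<rho>_lim)
  \<comment> \<open>The indices of \<open>U\<close> are now transposed:
    \<open>U \<Omega> \<Gamma>\<close> requires \<Gamma> to be \<Omega> or strictly shorter, so a
    shortest index with nonzero coefficient is isolated.\<close>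
  have ind': "\<forall>\<Gamma>\<in>I. e \<Gamma> = 0" if e: "\<And>\<Omega>. (\<Sum>\<Gamma>\<in>I. e \<Gamma> * B' \<Gamma> \<Omega>) = 0" for e
  proof (rule ccontr)
    assume "\<not> (\<forall>\<Gamma>\<in>I. e \<Gamma> = 0)"
    then obtain \<Xi> where "\<Xi> \<in> I \<and> e \<Xi> \<noteq> 0" by blast
    from ex_has_least_nat[of "\<lambda>\<Gamma>. \<Gamma> \<in> I \<and> e \<Gamma> \<noteq> 0", OF this, of len]
    obtain \<Omega> where O: "\<Omega> \<in> I" "e \<Omega> \<noteq> 0"
      and min: "\<And>\<Gamma>. \<Gamma> \<in> I \<Longrightarrow> e \<Gamma> \<noteq> 0 \<Longrightarrow> len \<Omega> \<le> len \<Gamma>"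
      by blast
    have "(\<Sum>\<Gamma>\<in>I. e \<Gamma> * B' \<Gamma> \<Omega>) = (\<Sum>\<Gamma>\<in>I. if \<Gamma> = \<Omega> then e \<Omega> * B' \<Omega> \<Omega> else 0)"
    proof (rule sum.cong)
      fix \<Gamma> assume "\<Gamma> \<in> I"
      then show "e \<Gamma> * B' \<Gamma> \<Omega> = (if \<Gamma> = \<Omega> then e \<Omega> * B' \<Omega> \<Omega> else 0)"
        using min[of \<Gamma>] U_0[of \<Omega> \<Gamma>] O(1) by (cases "e \<Gamma> = 0") (auto simp: B'_def)
    qed simp
    also have "\<dots> = e \<Omega> * B' \<Omega> \<Omega>" using finI O(1) by simp
    finally have "e \<Omega> * B' \<Omega> \<Omega> = 0" using e by simp
    then show False using O U_diag_nz[of \<Omega>] \<rho>'_nz[of \<Omega>] by (auto simp: B'_def)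
  qed

  obtain y where y: "P \<Lambda> = (\<Sum>\<Gamma>\<in>I. mscale (y \<Gamma>) (?p \<Gamma>))"
    using span_image_explicit[OF finI P_span[OF LI]] .
  define w where "w \<Gamma> = c_coeff q_Qqt t_Qqt \<Lambda> * y \<Gamma> * (1 / (\<Prod>k\<in>#snd \<Gamma>. 1 - t_Qqt ^ k))" for \<Gamma>
  have J: "pleth_t m t_Qqt (J_fun q_Qqt t_Qqt P \<Lambda>) = (\<Sum>\<Gamma>\<in>I. mscale (w \<Gamma>) (?p \<Gamma>))"
  proof -
    have "J_fun q_Qqt t_Qqt P \<Lambda> = (\<Sum>\<Gamma>\<in>I. mscale (c_coeff q_Qqt t_Qqt \<Lambda> * y \<Gamma>) (?p \<Gamma>))"
      unfolding J_fun_def y by (simp add: mps.scale_sum_right)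
    then show ?thesis
      unfolding pleth_t_def by (simp add: diag_map_eq[OF ind finI Im] w_def case_prod_unfold)
  qed
  have sol: "(\<Sum>\<Gamma>\<in>I. w \<Gamma> * B \<Gamma> \<Omega>) =
      (if \<Omega> \<in> I then c_coeff q_Qqt t_Qqt \<Lambda> * F (P \<Lambda>) (m_fun \<Omega>) else 0)" for \<Omega>
  proof (cases "\<Omega> \<in> I")
    case True
    have "F (P \<Lambda>) (m_fun \<Omega>) = (\<Sum>\<Gamma>\<in>I. y \<Gamma> * u \<Omega> \<Gamma> * N \<Gamma>)"
      unfolding y m_p[OF True] F_def mac_form_def N_def by (rule diag_form_eq[OF ind finI Im])
    moreover have "w \<Gamma> * B \<Gamma> \<Omega> = c_coeff q_Qqt t_Qqt \<Lambda> * (y \<Gamma> * u \<Omega> \<Gamma> * N \<Gamma>)" if "\<Gamma> \<in> I" for \<Gamma>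
      using t_nz[OF that] True by (simp add: w_def B_def \<rho>_def)
    ultimately show ?thesis using True by (simp add: sum_distrib_left)
  qed (simp add: B_def)
  have R: "has_limit_t1 (if \<Omega> \<in> I then c_coeff q_Qqt t_Qqt \<Lambda> * F (P \<Lambda>) (m_fun \<Omega>) else 0)
      (if \<Omega> = \<Lambda> then C else 0)" for \<Omega>
    using c_lim[of \<Omega>] LI by auto
  obtain w' where w': "\<And>\<Gamma>. \<Gamma> \<in> I \<Longrightarrow> has_limit_t1 (w \<Gamma>) (w' \<Gamma>)"
      "\<And>\<Omega>. (\<Sum>\<Gamma>\<in>I. w' \<Gamma> * B' \<Gamma> \<Omega>) = (if \<Omega> = \<Lambda> then C else 0)"
    using has_limit_t1_solution[of I B B' w, OF finI B_lim ind' sol R] by blast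

  define v where "v \<Gamma> = inverse q_Qq ^ sum_list (fst \<Gamma>) * p_weight (\<lambda>k. 1 / (1 - q_Qq ^ k)) (snd \<Gamma>) *
      mcoeff (xp_fun \<Gamma>) (mexp \<Lambda>)" for \<Gamma>
  have h: "pleth_q m q_Qq (h_fun q_Qq \<Lambda>) = (\<Sum>\<Gamma>\<in>I. mscale (v \<Gamma>) (xp_fun \<Gamma>))"
    using LI unfolding I_def v_def by (simp add: pleth_q_h_fun hwx_expansion)
  \<comment> \<open>The power of 1/q and \<open>p_weight\<close> in \<open>v\<close> are together
    the reciprocal of \<rho>'. What remains reassembles m_\<Omega> from its expansion, evaluated at
    \<open>mexp \<Lambda>\<close>, a monomial that only m_\<Lambda> contains.\<close>
  have v: "(\<Sum>\<Gamma>\<in>I. v \<Gamma> * B' \<Gamma> \<Omega>) = (if \<Omega> = \<Lambda> then 1 else 0)" for \<Omega>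
  proof (cases "\<Omega> \<in> I")
    case True
    have "v \<Gamma> * B' \<Gamma> \<Omega> = U \<Omega> \<Gamma> * mcoeff (xp_fun \<Gamma>) (mexp \<Lambda>)" if "\<Gamma> \<in> I" for \<Gamma>
    proof -
      have "p_weight (\<lambda>k. 1 / (1 - q_Qq ^ k)) (snd \<Gamma>) =
          1 / (of_nat (z_coeff (snd \<Gamma>)) * (\<Prod>k\<in>#snd \<Gamma>. 1 - q_Qq ^ k))"
        unfolding p_weight_pleth by (simp add: p_weight_def)
      then show ?thesis
        using q_nz[OF that] z_nz[OF that] q_Qq_nonzero True
        by (simp add: v_def B'_def \<rho>'_def power_inverse)
    qed
    then have "(\<Sum>\<Gamma>\<in>I. v \<Gamma> * B' \<Gamma> \<Omega>) = mcoeff (\<Sum>\<Gamma>\<in>I. mscale (U \<Omega> \<Gamma>) (xp_fun \<Gamma>)) (mexp \<Lambda>)"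
      by simp
    also have "\<dots> = mcoeff (m_fun \<Omega>) (mexp \<Lambda>)" by (simp only: m_xp[OF True])
    also have "\<dots> = (if \<Omega> = \<Lambda> then 1 else 0)"
      unfolding mcoeff_m_fun[OF subsetD[OF Im True]] mtype_mexp[OF L] by auto
    finally show ?thesis .
  next
    case False
    then show ?thesis using LI by (auto simp: B'_def)
  qed
  \<comment> \<open>Both sides solve the same system, and \<open>ind'\<close> makes its solution
    unique.\<close>
  have "w' \<Gamma> = C * v \<Gamma>" if "\<Gamma> \<in> I" for \<Gamma>
  proof -
    have "(\<Sum>\<Gamma>\<in>I. (w' \<Gamma> - C * v \<Gamma>) * B' \<Gamma> \<Omega>) = 0" for \<Omega>
    proof -
      have "(\<Sum>\<Gamma>\<in>I. (w' \<Gamma> - C * v \<Gamma>) * B' \<Gamma> \<Omega>) = (\<Sum>\<Gamma>\<in>I. w' \<Gamma> * B' \<Gamma> \<Omega>) - C * (\<Sum>\<Gamma>\<in>I. v \<Gamma> * B' \<Gamma> \<Omega>)"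
        by (simp add: left_diff_distrib sum_subtractf sum_distrib_left mult.assoc)
      then show ?thesis by (simp add: w'(2) v)
    qed
    from ind'[OF this] show ?thesis using that by auto
  qed
  then have "mscale C (pleth_q m q_Qq (h_fun q_Qq \<Lambda>)) = (\<Sum>\<Gamma>\<in>I. mscale (w' \<Gamma>) (xp_fun \<Gamma>))"
    unfolding h by (simp add: mps.scale_sum_right)
  moreover have "mps_limit_t1 (\<Sum>\<Gamma>\<in>I. mscale (w \<Gamma>) (?p \<Gamma>)) (\<Sum>\<Gamma>\<in>I. mscale (w' \<Gamma>) (xp_fun \<Gamma>))"
    by (intro mps_limit_t1_sum mps_limit_t1_mscale w'(1) mps_limit_t1_p_fun)
  ultimately show "mps_limit_t1 (pleth_t m t_Qqt (J_fun q_Qqt t_Qqt P (a, \<mu>)))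
      (mscale (q_Qq ^ sum_list a * q_fact_mpart q_Qq (a, \<mu>)) (pleth_q m q_Qq (h_fun q_Qq (a, \<mu>))))"
    by (simp add: J[unfolded \<Lambda>_def] C_def \<Lambda>_def)
next
  show "mscale (q_Qq ^ sum_list a * q_fact_mpart q_Qq (a, \<mu>)) (pleth_q m q_Qq (h_fun q_Qq (a, \<mu>))) =
      mscale (q_fact_mpart q_Qq (a, \<mu>)) ((\<Prod>i<m. h_pleth_x q_Qq i (a ! i)) * (\<Prod>r\<in>#\<mu>. h_pleth q_Qq r))"
    unfolding pleth_q_h_fun_eq_prod[OF assms(2) q_Qq_nonzero, symmetric] by (simp add: mult.commute)
qed

end
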